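(* If the limit $$\lim_{\text{even } x\to\infty}\left(\frac{c(x)\ln^2 x}{x\ln\ln x}\prod_{\substack{p\mid x\\ p \text{ odd prime}}}\frac{p-2}{p-1}\right)$$ exists, then it equals $2C_{tw}$.
   Context: For an even positive integer $n$, $c(n)$ denotes the number of decompositions of $n$ as a sum of a prime and a number which is either a prime or an odd semiprime: $c(n)=g(n)+s(n)$, where $g(n)$ is the number of unordered pairs $\{p,q\}$ of primes with $p+q=n$ and $s(n)$ is the number of pairs $(p,m)$ with $p$ prime and $m$ a product of two (not necessarily distinct) odd primes with $p+m=n$. $C_{tw}=\prod_{p \text{ odd prime}}\frac{p(p-2)}{(p-1)^2}=0.66016\ldots$ is the twin prime constant. *)

theory Defs
  imports "HOL-Analysis.Analysis" "HOL-Computational_Algebra.Primes"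
begin

definition odd_semiprime :: "nat \<Rightarrow> bool" where
  "odd_semiprime m \<longleftrightarrow> (\<exists>q r. prime q \<and> prime r \<and> odd q \<and> odd r \<and> m = q * r)"

definition gpairs :: "nat \<Rightarrow> nat" where
  "gpairs n = card {(p, q). prime p \<and> prime q \<and> p \<le> q \<and> p + q = n}"

definition spairs :: "nat \<Rightarrow> nat" where
  "spairs n = card {(p, m). prime p \<and> odd_semiprime m \<and> p + m = n}"

definition cdec :: "nat \<Rightarrow> nat" where
  "cdec n = gpairs n + spairs n"

definition C_tw :: real where
  "C_tw = (\<Prod>p. if prime p \<and> odd p then real p * (real p - 2) / (real p - 1)^2 else 1)"

definition ratio :: "nat \<Rightarrow> real" where
  "ratio x = real (cdec x) * (ln (real x))^2 / (real x * ln (ln (real x)))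
     * (\<Prod>p\<in>{p. prime p \<and> odd p \<and> p dvd x}. (real p - 2) / (real p - 1))"

end

(*
If the limit L exists, then summing c(x) over the even x up to N and using that the reciprocal of the
product over p | x has mean value 1 / C_tw over the even numbers gives

  sum of c(x)  ~  (L / C_tw) * N^2 / 4 * ln ln N / (ln N)^2.

On the other hand this sum counts, up to the negligible contribution of two primes, the pairs of an
odd prime p and an odd semiprime m with p + m <= N, which by the prime number theorem is asymptotic
to N^2 / 2 * ln ln N / (ln N)^2. Hence L / (4 C_tw) = 1 / 2.

The prime number theorem follows Wiener and Ikehara: zeta has no zeros with real part at least 1, so
the Laplace transform of psi(e^u) e^(-u) - 1 extends continuously to the closed right half plane;
testing against Fejer kernels and exploiting that psi is increasing gives psi(x) ~ x.
*)
theory Submission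
  imports Defs "HOL-Complex_Analysis.Complex_Analysis" "HOL-Number_Theory.Prime_Powers" "HOL-Real_Asymp.Real_Asymp"
begin

subsection \<open>The zeta function on the line of abscissa one\<close>

text \<open>No asymptotics of c at single even numbers are available, so the constant is pinned down
  on average only. The assumed limit enters once, through Stolz-Cesaro: \<open>ratio\<close> is
  exactly the quotient of the increments of two partial sums, one of c and one of the weights x ln
  ln x / (ln x)^2 times \<open>singular\<close>, the reciprocal of the product in
  \<open>ratio\<close>. The rest evaluates both sums unconditionally. The obstacle in the count of
  pairs is uniformity: semiprimes up to N - p are needed for all primes p up to N. It is met by
  measuring every count with the single slowly varying density ln ln N / ln N. Slow variation of ln
  ln also gives the semiprime count from the prime number theorem: for any a > 0 the primes up to
  y^a carry asymptotically the whole sum of reciprocals of the primes up to sqrt y. The factor ln ln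
  N gained over the count of primes is what makes sums of two primes negligible. The 2 in the result
  is parity: an odd prime plus an odd semiprime is even, so all pairs fall on half of the
  numbers.\<close>

lemma norm_of_nat_powr: "norm (of_nat n powr s :: complex) = real n powr Re s"
  by (subst norm_powr_real_powr) auto

text \<open>Replacing \<open>1 / (s - 1)\<close> by the telescoping integrals of \<open>x powr (-s)\<close> over \<open>{n..n+1}\<close> turns
  \<open>(s - 1) * zeta(s)\<close> into a series that converges for positive real part.\<close>

definition zeta_term :: "nat \<Rightarrow> complex \<Rightarrow> complex" where
  "zeta_term n s = (s - 1) * of_nat (Suc n) powr (-s)
     + of_nat (Suc (Suc n)) powr (1 - s) - of_nat (Suc n) powr (1 - s)"

definition regzeta :: "complex \<Rightarrow> complex" where
  "regzeta s = 1 + (\<Sum>n. zeta_term n s)"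

text \<open>\<open>zeta_term n s\<close> is the remainder of the first-order Taylor expansion of x
  powr (1 - s) at n + 1, evaluated at n + 2; the linear term is (1 - s) (n + 1) powr (-s). The
  second derivative gains one power of n over the terms of the zeta series, so summability extends
  from Re s > 1 to Re s > 0.\<close>

lemma norm_zeta_term_le:
  assumes "Re s > -1"
  shows "norm (zeta_term n s) \<le> norm (s - 1) * norm s * real (Suc n) powr (- Re s - 1)"
proof -
  define f :: "nat \<Rightarrow> complex \<Rightarrow> complex" where
    "f = (\<lambda>i x. if i = 0 then x powr (1 - s) else if i = 1 then (1 - s) * x powr (-s)
                else (1 - s) * (- s * x powr (-s - 1)))"
  \<comment> \<open>The expansion runs along a segment of positive reals, away from the branch cut
    of \<open>powr\<close>.\<close>
  define S where "S = closed_segment (of_nat (Suc n)) (of_nat (Suc (Suc n)) :: complex)"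
  have S: "\<exists>r. x = of_real r \<and> r \<ge> real (Suc n)" if x: "x \<in> S" for x
  proof -
    have "x \<in> closed_segment (of_real (real (Suc n))) (of_real (real (Suc (Suc n))))"
      using x unfolding S_def of_real_of_nat_eq .
    then obtain r where "x = of_real r" "r \<in> closed_segment (real (Suc n)) (real (Suc (Suc n)))"
      unfolding closed_segment_of_real by auto
    thus ?thesis by (auto simp: closed_segment_eq_real_ivl)
  qed
  have "norm (f 0 (of_nat (Suc (Suc n))) - (\<Sum>i\<le>1. f i (of_nat (Suc n)) *
       (of_nat (Suc (Suc n)) - of_nat (Suc n)) ^ i / fact i))
    \<le> (norm (s - 1) * norm s * real (Suc n) powr (- Re s - 1)) *
       norm (of_nat (Suc (Suc n)) - of_nat (Suc n) :: complex) ^ Suc 1 / fact 1"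
  proof (rule complex_Taylor[of S])
    show "convex S" by (simp add: S_def)
    fix i x assume x: "x \<in> S" and i: "i \<le> (1::nat)"
    from S[OF x] obtain r where r: "x = of_real r" "r \<ge> real (Suc n)" by auto
    have nx: "x \<notin> \<real>\<^sub>\<le>\<^sub>0" using r by (auto simp: complex_nonpos_Reals_iff)
    show "(f i has_field_derivative f (Suc i) x) (at x within S)"
    proof (cases "i = 0")
      case True
      have "((\<lambda>x. x powr (1 - s)) has_field_derivative (1 - s) * x powr (1 - s - 1)) (at x within S)"
        using nx by (rule has_field_derivative_at_within[OF has_field_derivative_powr])
      thus ?thesis using True by (simp add: f_def)
    next
      case False
      hence i: "i = 1" using i by auto
      have "((\<lambda>x. (1 - s) * x powr (-s)) has_field_derivative (1 - s) * (-s * x powr (-s - 1))) (at x within S)"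
        using nx by (rule has_field_derivative_at_within[OF DERIV_cmult[OF has_field_derivative_powr]])
      thus ?thesis using i by (simp add: f_def)
    qed
  next
    fix x assume x: "x \<in> S"
    from S[OF x] obtain r where r: "x = of_real r" "r \<ge> real (Suc n)" by auto
    have "norm (x powr (-s - 1)) = r powr (- Re s - 1)"
      using r by (subst norm_powr_real_powr) auto
    also have "\<dots> \<le> real (Suc n) powr (- Re s - 1)"
      using r assms by (intro powr_mono2') auto
    finally show "norm (f (Suc 1) x) \<le> norm (s - 1) * norm s * real (Suc n) powr (- Re s - 1)"
      by (auto simp: f_def norm_mult norm_minus_commute mult.assoc intro!: mult_left_mono)
  qed (auto simp: S_def)
  also have "f 0 (of_nat (Suc (Suc n))) - (\<Sum>i\<le>1. f i (of_nat (Suc n)) *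
       (of_nat (Suc (Suc n)) - of_nat (Suc n)) ^ i / fact i) = zeta_term n s"
    by (simp add: f_def zeta_term_def algebra_simps)
  finally show ?thesis by simp
qed

lemma summable_powr_Suc: "x > 1 \<Longrightarrow> summable (\<lambda>n. real (Suc n) powr (-x))"
  using summable_Suc_iff[of "\<lambda>n. real n powr (-x)"] by (simp add: summable_real_powr_iff)

lemma regzeta_sums_and_holomorphic:
  shows summable_zeta_term: "Re s > 0 \<Longrightarrow> summable (\<lambda>n. zeta_term n s)"
    and holomorphic_regzeta: "regzeta holomorphic_on {s. Re s > 0}"
proof -
  define S where "S = {s::complex. Re s > 0}"
  define f' where "f' = (\<lambda>n s. deriv (zeta_term n) s)"
  have S: "open S" by (simp add: S_def open_halfspace_Re_gt)
  have "\<exists>g g'. \<forall>x\<in>S. ((\<lambda>n. zeta_term n x) sums g x) \<and> ((\<lambda>n. f' n x) sums g' x)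
          \<and> (g has_field_derivative g' x) (at x)"
  proof (rule series_and_derivative_comparison_complex[OF S])
    fix n x assume "x \<in> S"
    have "zeta_term n holomorphic_on UNIV"
      unfolding zeta_term_def by (intro holomorphic_intros)
    thus "(zeta_term n has_field_derivative f' n x) (at x)"
      unfolding f'_def by (rule holomorphic_derivI) auto
  next
    fix x assume x: "x \<in> S"
    \<comment> \<open>Half the distance to the boundary: on the ball of radius d the real part stays
      above d, which gives one majorant for the whole ball.\<close>
    define d where "d = Re x / 2"
    have d: "d > 0" using x by (auto simp: d_def S_def)
    define C where "C = (norm x + d + 1) * (norm x + d)"
    define h where "h = (\<lambda>n. complex_of_real (C * real (Suc n) powr (- (d + 1))))"
    have "summable h" unfolding h_def summable_of_real_iff
      using d by (intro summable_mult summable_powr_Suc) auto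
    moreover have "range h \<subseteq> \<real>\<^sub>\<ge>\<^sub>0"
      using d by (auto simp: h_def C_def complex_nonneg_Reals_iff)
    moreover have "norm (zeta_term n y) \<le> norm (h n)" if y: "y \<in> ball x d \<inter> S" for n y
    proof -
      have xy: "norm (x - y) < d" using y by (auto simp: dist_norm)
      have "\<bar>Re (x - y)\<bar> < d" using abs_Re_le_cmod[of "x - y"] xy by linarith
      hence "Re x - Re y < d" by simp
      hence Re: "Re y > d" by (simp add: d_def field_simps)
      have ny: "norm y \<le> norm x + d" using xy norm_triangle_ineq2[of y x] norm_minus_commute[of x y] by linarith
      have ny1: "norm (y - 1) \<le> norm x + d + 1" using ny norm_triangle_ineq4[of y 1] by simp
      have "norm (zeta_term n y) \<le> norm (y - 1) * norm y * real (Suc n) powr (- Re y - 1)"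
        using Re d by (intro norm_zeta_term_le) auto
      also have "\<dots> \<le> C * real (Suc n) powr (- (d + 1))"
        unfolding C_def using ny ny1 Re d
        by (intro mult_mono powr_mono) auto
      also have "\<dots> \<le> norm (h n)" unfolding h_def norm_of_real by (rule abs_ge_self)
      finally show ?thesis .
    qed
    ultimately show "\<exists>d h. 0 < d \<and> summable h \<and> range h \<subseteq> \<real>\<^sub>\<ge>\<^sub>0 \<and>
        (\<forall>\<^sub>F n in sequentially. \<forall>y\<in>ball x d \<inter> S. norm (zeta_term n y) \<le> cmod (h n))"
      using d by (intro exI[of _ d] exI[of _ h]) auto
  qed
  then obtain g g' where g: "\<And>x. x \<in> S \<Longrightarrow> (\<lambda>n. zeta_term n x) sums g x"
    "\<And>x. x \<in> S \<Longrightarrow> (g has_field_derivative g' x) (at x)" by blast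
  show "summable (\<lambda>n. zeta_term n s)" if "Re s > 0"
    using g(1)[of s] that by (auto simp: S_def sums_iff)
  have "g holomorphic_on S" using g(2) S by (auto simp: holomorphic_on_open)
  hence "(\<lambda>s. 1 + g s) holomorphic_on S" by (intro holomorphic_intros)
  moreover have "regzeta s = 1 + g s" if "s \<in> S" for s
    using g(1)[OF that] by (auto simp: regzeta_def sums_iff)
  ultimately show "regzeta holomorphic_on {s. Re s > 0}"
    unfolding S_def[symmetric] using holomorphic_cong[OF refl, of S regzeta "\<lambda>s. 1 + g s"] by blast
qed

text \<open>The normalisation at the pole of zeta. It shows that \<open>regzeta\<close> is not the
  zero function, so that its zeros have finite order.\<close>

lemma regzeta_1: "regzeta 1 = 1"
proof -
  have "zeta_term n 1 = 0" for n by (simp add: zeta_term_def del: of_nat_Suc)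
  thus ?thesis by (simp add: regzeta_def)
qed

text \<open>The terms with \<open>n = 0\<close> vanish, since \<open>0 powr s = 0\<close>.\<close>

definition zeta_series :: "complex \<Rightarrow> complex" where "zeta_series s = (\<Sum>n. of_nat n powr (-s))"
definition mangoldt_series :: "complex \<Rightarrow> complex" where "mangoldt_series s = (\<Sum>n. mangoldt n * of_nat n powr (-s))"

section \<open>Dirichlet series of zeta and of the von Mangoldt function\<close>

lemma summable_ln_powr:
  assumes "x > (1::real)" shows "summable (\<lambda>n. ln (real n) * real n powr (-x))"
proof (rule summable_comparison_test_ev)
  define d where "d = (x - 1) / 2"
  have d: "d > 0" using assms by (simp add: d_def)
  have "(\<lambda>n. ln (real n)) \<in> o(\<lambda>n. real n powr d)" using d by real_asymp
  from landau_o.smallD[OF this, of 1]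
  have "eventually (\<lambda>n. ln (real n) \<le> real n powr d) at_top"
    by (auto elim!: eventually_mono)
  thus "eventually (\<lambda>n. norm (ln (real n) * real n powr (-x)) \<le> real n powr (-(1+d))) sequentially"
    using eventually_gt_at_top[of 0]
  proof eventually_elim
    case (elim n)
    have "norm (ln (real n) * real n powr (-x)) \<le> real n powr d * real n powr (-x)"
      using elim by (auto simp: abs_mult intro!: mult_right_mono)
    also have "\<dots> = real n powr (-(1+d))" unfolding powr_add [symmetric] by (rule arg_cong[of _ _ "(powr) (real n)"]) (simp add: d_def field_simps)
    finally show ?case .
  qed
  show "summable (\<lambda>n. real n powr (-(1+d)))" using d by (simp add: summable_real_powr_iff)
qed

lemma summable_mangoldt_powr:
  assumes "x > (1::real)" shows "summable (\<lambda>n. mangoldt n * real n powr (-x))"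
proof (rule summable_comparison_test'[OF summable_ln_powr[OF assms], of 1])
  fix n :: nat assume "n \<ge> 1"
  thus "norm (mangoldt n * real n powr - x) \<le> ln (real n) * real n powr - x"
    by (auto simp: abs_mult intro!: mult_right_mono mangoldt_le)
qed

lemma summable_norm_zeta_series:
  assumes "Re s > 1" shows "summable (\<lambda>n. norm (of_nat n powr (-s) :: complex))"
  using assms by (simp add: norm_of_nat_powr summable_real_powr_iff)

lemma summable_norm_mangoldt_series:
  assumes "Re s > 1" shows "summable (\<lambda>n. norm (mangoldt n * of_nat n powr (-s) :: complex))"
  using summable_mangoldt_powr[OF assms] by (simp add: norm_mult norm_of_nat_powr)

text \<open>The telescoping differences sum to -1, which cancels the leading 1 of
  \<open>regzeta\<close>.\<close>

lemma zeta_series_regzeta: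
  assumes s: "Re s > 1" shows "regzeta s = (s - 1) * zeta_series s"
proof -
  have 1: "(\<lambda>n. of_nat n powr (-s)) sums zeta_series s"
    unfolding zeta_series_def using summable_norm_cancel[OF summable_norm_zeta_series[OF s]] by (rule summable_sums)
  hence 2: "(\<lambda>n. of_nat (Suc n) powr (-s)) sums zeta_series s"
    by (subst sums_Suc_iff) auto
  have "(\<lambda>n. real n powr (Re (1 - s))) \<longlonglongrightarrow> 0"
    by (rule tendsto_neg_powr) (use s in \<open>auto intro: filterlim_real_sequentially\<close>)
  hence "(\<lambda>n. of_nat n powr (1 - s) :: complex) \<longlonglongrightarrow> 0"
    by (subst tendsto_norm_zero_iff[symmetric]) (simp add: norm_of_nat_powr)
  hence "(\<lambda>n. of_nat (Suc n) powr (1 - s) :: complex) \<longlonglongrightarrow> 0"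
    by (rule LIMSEQ_Suc)
  from telescope_sums[OF this]
  have 3: "(\<lambda>n. of_nat (Suc (Suc n)) powr (1 - s) - of_nat (Suc n) powr (1 - s)) sums (0 - 1 :: complex)"
    by simp
  have "(\<lambda>n. zeta_term n s) sums ((s - 1) * zeta_series s + (0 - 1))"
    using sums_add[OF sums_mult[OF 2, of "s - 1"] 3] by (simp add: zeta_term_def algebra_simps)
  thus ?thesis by (simp add: regzeta_def sums_iff)
qed

lemma zeta_series_deriv:
  assumes s: "Re s > 1"
  shows "(zeta_series has_field_derivative (\<Sum>n. - (complex_of_real (ln (real n)) * of_nat n powr (-s)))) (at s)"
proof -
  define S where "S = {s::complex. Re s > 1}"
  define f' where "f' = (\<lambda>n s. - (complex_of_real (ln (real n)) * of_nat n powr (-s)))"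
  have S: "open S" by (simp add: S_def open_halfspace_Re_gt)
  have "\<exists>g g'. \<forall>x\<in>S. ((\<lambda>n. of_nat n powr (-x) :: complex) sums g x) \<and> ((\<lambda>n. f' n x) sums g' x)
          \<and> (g has_field_derivative g' x) (at x)"
  proof (rule series_and_derivative_comparison_complex[OF S])
    fix n and x :: complex assume "x \<in> S"
    show "((\<lambda>s. of_nat n powr (-s)) has_field_derivative f' n x) (at x)"
    proof (cases "n = 0")
      case False
      hence "((\<lambda>s. of_nat n powr (-s)) has_field_derivative (Ln (of_nat n) * of_nat n powr (-x)) * (-1)) (at x)"
        by (intro DERIV_chain2[OF has_field_derivative_powr_right]) (auto intro!: derivative_eq_intros)
      thus ?thesis using False by (simp add: f'_def Ln_of_nat)
    qed (simp add: f'_def)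
  next
    fix x assume x: "x \<in> S"
    define d where "d = (Re x - 1) / 2"
    have d: "d > 0" using x by (auto simp: d_def S_def)
    define h where "h = (\<lambda>n. complex_of_real (real n powr (- (d + 1))))"
    have "summable h" unfolding h_def summable_of_real_iff using d by (simp add: summable_real_powr_iff)
    moreover have "range h \<subseteq> \<real>\<^sub>\<ge>\<^sub>0"
      using d by (auto simp: h_def complex_nonneg_Reals_iff)
    moreover have "norm (of_nat n powr (-y) :: complex) \<le> norm (h n)" if y: "y \<in> ball x d \<inter> S" for n y
    proof (cases "n = 0")
      case False
      have xy: "norm (x - y) < d" using y by (auto simp: dist_norm)
      have "\<bar>Re (x - y)\<bar> < d" using abs_Re_le_cmod[of "x - y"] xy by linarith
      hence "Re x - Re y < d" by simp
      hence Re: "Re y > 1 + d" by (simp add: d_def field_simps)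
      have "norm (of_nat n powr (-y) :: complex) = real n powr (- Re y)"
        by (simp add: norm_of_nat_powr)
      also have "\<dots> \<le> real n powr (- (d + 1))"
        using Re False by (intro powr_mono) auto
      also have "\<dots> \<le> norm (h n)" unfolding h_def by simp
      finally show ?thesis .
    qed auto
    ultimately show "\<exists>d h. 0 < d \<and> summable h \<and> range h \<subseteq> \<real>\<^sub>\<ge>\<^sub>0 \<and>
        (\<forall>\<^sub>F n in sequentially. \<forall>y\<in>ball x d \<inter> S. norm (of_nat n powr (-y) :: complex) \<le> cmod (h n))"
      using d by (intro exI[of _ d] exI[of _ h]) auto
  qed
  then obtain g g' where g: "\<And>x. x \<in> S \<Longrightarrow> (\<lambda>n. of_nat n powr (-x)) sums g x"
    "\<And>x. x \<in> S \<Longrightarrow> (\<lambda>n. f' n x) sums g' x"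
    "\<And>x. x \<in> S \<Longrightarrow> (g has_field_derivative g' x) (at x)" by blast
  have eq: "zeta_series x = g x" if "x \<in> S" for x using g(1)[OF that] by (simp add: zeta_series_def sums_iff)
  have sS: "s \<in> S" using s by (simp add: S_def)
  have "(zeta_series has_field_derivative g' s) (at s)"
    by (rule has_field_derivative_transform_within_open[OF g(3)[OF sS] S sS]) (simp add: eq)
  moreover have "g' s = (\<Sum>n. f' n s)" using g(2)[OF sS] by (simp add: sums_iff)
  ultimately show ?thesis by (simp add: f'_def)
qed

text \<open>By absolute convergence the double series may be grouped by the product n = m * d, and
  the sum of \<open>mangoldt\<close> over the divisors of n is ln n.\<close>

lemma zeta_series_mult_mangoldt_series:
  assumes s: "Re s > 1"
  shows "zeta_series s * mangoldt_series s = (\<Sum>n. complex_of_real (ln (real n)) * of_nat n powr (-s))"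
proof -
  define a where "a = (\<lambda>n. of_nat n powr (-s) :: complex)"
  define b where "b = (\<lambda>n. mangoldt n * of_nat n powr (-s) :: complex)"
  have a: "(a has_sum zeta_series s) UNIV"
    unfolding a_def zeta_series_def
    by (rule norm_summable_imp_has_sum[OF summable_norm_zeta_series[OF s] summable_sums[OF summable_norm_cancel[OF summable_norm_zeta_series[OF s]]]])
  have b: "(b has_sum mangoldt_series s) UNIV"
    unfolding b_def mangoldt_series_def
    by (rule norm_summable_imp_has_sum[OF summable_norm_mangoldt_series[OF s] summable_sums[OF summable_norm_cancel[OF summable_norm_mangoldt_series[OF s]]]])
  have sm: "(\<lambda>(m,n). a m * b n) summable_on (UNIV \<times> UNIV)"
  proof (rule abs_summable_summable, unfold Infinite_Sum.abs_summable_on_Sigma_iff, intro conjI ballI)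
    have a': "(\<lambda>m. norm (a m)) summable_on UNIV" and b': "(\<lambda>m. norm (b m)) summable_on UNIV"
      using a b by (auto simp: summable_on_iff_abs_summable_on_complex[symmetric] intro: has_sum_imp_summable)
    show "(\<lambda>y. norm (case (x, y) of (m, n) \<Rightarrow> a m * b n)) summable_on UNIV" for x
      using b' by (simp add: norm_mult summable_on_cmult_right)
    show "(\<lambda>x. norm (\<Sum>\<^sub>\<infinity>y. norm (case (x, y) of (m, n) \<Rightarrow> a m * b n))) summable_on UNIV"
      using a' by (simp add: norm_mult infsum_cmult_right' abs_mult summable_on_cmult_left infsum_nonneg)
  qed
  have "((\<lambda>(m,n). a m * b n) has_sum (zeta_series s * mangoldt_series s)) (UNIV \<times> UNIV)"
    by (rule has_sum_SigmaI[where g = "\<lambda>m. a m * mangoldt_series s"])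
       (use sm in \<open>auto intro!: has_sum_cmult_right has_sum_cmult_left a b\<close>)
  \<comment> \<open>Indices 0 contribute nothing and are removed before the grouping, since every
    number divides 0.\<close>
  also have "?this \<longleftrightarrow> ((\<lambda>(m,n). a m * b n) has_sum (zeta_series s * mangoldt_series s)) ({1..} \<times> {1..})"
    by (intro has_sum_cong_neutral) (auto simp: a_def b_def not_le)
  also have "\<dots> \<longleftrightarrow> ((\<lambda>(n,d). b d * a (n div d)) has_sum (zeta_series s * mangoldt_series s)) (SIGMA n:{1..}. {d. d dvd n})"
    by (rule has_sum_reindex_bij_witness[of _ "\<lambda>(n,d). (n div d, d)" "\<lambda>(m,d). (m * d, d)"])
       (auto simp: Suc_le_eq dest: dvd_imp_le elim!: dvdE)
  finally have "((\<lambda>(n,d). b d * a (n div d)) has_sum (zeta_series s * mangoldt_series s)) (SIGMA n:{1..}. {d. d dvd n})" .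
  hence "((\<lambda>n. complex_of_real (ln (real n)) * of_nat n powr (-s)) has_sum (zeta_series s * mangoldt_series s)) {1..}"
  proof (rule has_sum_SigmaD)
    fix n :: nat assume n: "n \<in> {1..}"
    have "(\<Sum>d | d dvd n. b d * a (n div d)) = (\<Sum>d | d dvd n. mangoldt d * of_nat n powr (-s))"
    proof (rule sum.cong)
      fix d assume "d \<in> {d. d dvd n}"
      then obtain m where m: "n = d * m" by auto
      have "d > 0" "m > 0" using m n by (auto intro!: Nat.gr0I)
      have "of_nat n powr (-s) = (of_nat d powr (-s) * of_nat m powr (-s) :: complex)"
        unfolding m using powr_times_real[of "of_nat d" "of_nat m" "-s"] by simp
      thus "b d * a (n div d) = mangoldt d * of_nat n powr (-s)"
        using \<open>d > 0\<close> m by (simp add: a_def b_def)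
    qed auto
    also have "\<dots> = complex_of_real (ln (real n)) * of_nat n powr (-s)"
      using n mangoldt_sum[of n, where ?'a = complex] by (simp add: sum_distrib_right [symmetric])
    finally show "((\<lambda>y. case (n, y) of (n, d) \<Rightarrow> b d * a (n div d)) has_sum 
        complex_of_real (ln (real n)) * of_nat n powr (-s)) {d. d dvd n}"
      using n by (auto intro!: has_sum_finiteI)
  qed
  also have "?this \<longleftrightarrow> ((\<lambda>n. complex_of_real (ln (real n)) * of_nat n powr (-s)) has_sum (zeta_series s * mangoldt_series s)) UNIV"
    by (intro has_sum_cong_neutral) (auto simp: not_le)
  finally show ?thesis by (auto dest!: has_sum_imp_sums simp: sums_iff)
qed

text \<open>The logarithmic derivative in a form without division by \<open>regzeta s\<close>, so
  that it is available before anything is known about zeros.\<close>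

lemma regzeta_deriv:
  assumes s: "Re s > 1"
  shows "deriv regzeta s = regzeta s * (1 / (s - 1) - mangoldt_series s)"
proof -
  have s1: "s \<noteq> 1" using s by auto
  have "summable (\<lambda>n. norm (complex_of_real (ln (real n)) * of_nat n powr (-s)))"
  proof (rule summable_cong[THEN iffD1, OF _ summable_ln_powr[OF s]], intro always_eventually allI)
    fix n :: nat
    show "ln (real n) * real n powr - Re s = norm (complex_of_real (ln (real n)) * of_nat n powr (-s))"
      by (cases "n = 0") (auto simp: norm_mult norm_of_nat_powr)
  qed
  from summable_minus[OF summable_norm_cancel[OF this]] suminf_minus[OF summable_norm_cancel[OF this]]
  have "(zeta_series has_field_derivative - (zeta_series s * mangoldt_series s)) (at s)"
    using zeta_series_deriv[OF s] zeta_series_mult_mangoldt_series[OF s] by simp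
  hence "((\<lambda>s. (s - 1) * zeta_series s) has_field_derivative zeta_series s + (s - 1) * - (zeta_series s * mangoldt_series s)) (at s)"
    by (auto intro!: derivative_eq_intros)
  hence "(regzeta has_field_derivative zeta_series s + (s - 1) * - (zeta_series s * mangoldt_series s)) (at s)"
    by (rule has_field_derivative_transform_within_open[of _ _ _ "{s. Re s > 1}"])
       (use s in \<open>auto simp: open_halfspace_Re_gt zeta_series_regzeta\<close>)
  hence "deriv regzeta s = zeta_series s + (s - 1) * - (zeta_series s * mangoldt_series s)"
    by (rule DERIV_imp_deriv)
  also have "\<dots> = regzeta s * (1 / (s - 1) - mangoldt_series s)"
    using s1 unfolding zeta_series_regzeta[OF s] by (simp add: field_simps)
  finally show ?thesis .
qed

lemma norm_mangoldt_series_le: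
  assumes s: "Re s > 1"
  shows "norm (mangoldt_series s) \<le> (\<Sum>n. mangoldt n * real n powr (- Re s))"
proof -
  have "norm (mangoldt_series s) \<le> (\<Sum>n. norm (mangoldt n * of_nat n powr (-s) :: complex))"
    unfolding mangoldt_series_def by (rule summable_norm[OF summable_norm_mangoldt_series[OF s]])
  thus ?thesis by (simp add: norm_mult norm_of_nat_powr)
qed

section \<open>Orders of zeros and non-vanishing\<close>

text \<open>Near s0 one has regzeta w = (w - s0)^n * g w with g free of zeros, so the logarithmic
  derivative is n / (w - s0) + g' / g. Multiplying by h = w - s0 and approaching s0 horizontally
  from the right extracts the order n.\<close>

lemma regzeta_log_deriv_order:
  assumes s: "Re s0 \<ge> 1"
  obtains n :: nat where "n = 0 \<longleftrightarrow> regzeta s0 \<noteq> 0"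
    "((\<lambda>h::real. h * (deriv regzeta (s0 + h) / regzeta (s0 + h))) \<longlongrightarrow> of_nat n) (at_right 0)"
proof -
  define S where "S = {s. Re s > 0}"
  have S: "open S" "connected S" "s0 \<in> S"
    using s by (auto simp: S_def open_halfspace_Re_gt convex_halfspace_Re_gt convex_connected)
  have hol: "regzeta holomorphic_on S" unfolding S_def by (rule holomorphic_regzeta)
  obtain g r n where gr: "(n::nat) = 0 \<longleftrightarrow> regzeta s0 \<noteq> 0" "r > 0" "g holomorphic_on ball s0 r"
    "\<And>w. w \<in> ball s0 r \<Longrightarrow> regzeta w = (w - s0) ^ n * g w"
    "\<And>w. w \<in> ball s0 r \<Longrightarrow> g w \<noteq> 0"
  proof (cases "regzeta s0 = 0")
    case True
    have "\<not> regzeta constant_on S"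
    proof
      assume "regzeta constant_on S"
      moreover have "1 \<in> S" by (simp add: S_def)
      ultimately have "regzeta s0 = regzeta 1" using S(3) by (auto simp: constant_on_def)
      thus False using True regzeta_1 by simp
    qed
    from holomorphic_factor_zero_nonconstant[OF hol S(1,2,3) True this] obtain g r n
      where "0 < n" "0 < r" "ball s0 r \<subseteq> S" "g holomorphic_on ball s0 r"
        "\<And>w. w \<in> ball s0 r \<Longrightarrow> regzeta w = (w - s0) ^ n * g w" "\<And>w. w \<in> ball s0 r \<Longrightarrow> g w \<noteq> 0"
      by metis
    thus ?thesis using True by (intro that[of n r g]) auto
  next
    case False
    have "isCont regzeta s0"
      using holomorphic_on_imp_continuous_on[OF hol] S(3) continuous_on_eq_continuous_at[OF S(1)] by blast
    from continuous_at_avoid[OF this False] obtain e where e: "e > 0" "\<And>y. dist s0 y < e \<Longrightarrow> regzeta y \<noteq> 0"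
      by auto
    obtain e' where e': "e' > 0" "ball s0 e' \<subseteq> S" using S openE by blast
    show ?thesis
      by (rule that[of 0 "min e e'" regzeta])
         (use e e' False in \<open>auto intro!: holomorphic_on_subset[OF hol] intro: subset_trans[OF subset_ball e'(2)]\<close>)
  qed
  have ev: "eventually (\<lambda>h::real. h \<in> {0<..<r}) (at_right 0)"
    using gr(2) by (rule eventually_at_right_real)
  have "((\<lambda>h::real. of_nat n + h * (deriv g (s0 + h) / g (s0 + h))) \<longlongrightarrow> of_nat n + 0 * (deriv g (s0 + 0) / g (s0 + 0))) (at_right 0)"
  proof (intro tendsto_intros)
    have dg: "deriv g holomorphic_on ball s0 r" using gr(3) by (rule holomorphic_deriv) auto
    have lim: "((\<lambda>h::real. f (s0 + h)) \<longlongrightarrow> f (s0 + 0)) (at_right 0)"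
      if "f holomorphic_on ball s0 r" for f :: "complex \<Rightarrow> complex"
    proof -
      have "isCont f s0" using holomorphic_on_imp_continuous_on[OF that] gr(2) 
        by (simp add: continuous_on_eq_continuous_at)
      moreover have "((\<lambda>h::real. s0 + of_real h) \<longlongrightarrow> s0 + of_real 0) (at_right 0)" by (intro tendsto_intros)
      ultimately show ?thesis using isCont_tendsto_compose[of s0 f "\<lambda>h. s0 + of_real h" "at_right 0"] by simp
    qed
    show "((\<lambda>h::real. deriv g (s0 + h)) \<longlongrightarrow> deriv g (s0 + 0)) (at_right 0)" using lim[OF dg] .
    show "((\<lambda>h::real. g (s0 + h)) \<longlongrightarrow> g (s0 + 0)) (at_right 0)" using lim[OF gr(3)] .
    show "g (s0 + 0) \<noteq> 0" using gr(5)[of s0] gr(2) by simp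
    show "(complex_of_real \<longlongrightarrow> 0) (at_right 0)" using tendsto_of_real[OF tendsto_ident_at, of 0 "{0<..}", where ?'a = complex] by simp
  qed
  hence "((\<lambda>h::real. h * (deriv regzeta (s0 + h) / regzeta (s0 + h))) \<longlongrightarrow> of_nat n + 0 * (deriv g (s0 + 0) / g (s0 + 0))) (at_right 0)"
  proof (rule Lim_transform_eventually)
    show "eventually (\<lambda>h::real. of_nat n + h * (deriv g (s0 + h) / g (s0 + h)) = 
       h * (deriv regzeta (s0 + h) / regzeta (s0 + h))) (at_right 0)"
      using ev
    proof eventually_elim
      case (elim h)
      define w where "w = s0 + of_real h"
      have w: "w \<in> ball s0 r" "w \<noteq> s0" and hw: "of_real h = w - s0" using elim by (auto simp: w_def dist_norm)
      have "(g has_field_derivative deriv g w) (at w)" using gr(3) w by (intro holomorphic_derivI) auto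
      hence "((\<lambda>w. (w - s0) ^ n * g w) has_field_derivative
               of_nat n * (w - s0) ^ (n - 1) * g w + (w - s0) ^ n * deriv g w) (at w)"
        by (auto intro!: derivative_eq_intros)
      hence "(regzeta has_field_derivative
               of_nat n * (w - s0) ^ (n - 1) * g w + (w - s0) ^ n * deriv g w) (at w)"
        by (rule has_field_derivative_transform_within_open[OF _ open_ball w(1)]) (use gr(4) in auto)
      hence d: "deriv regzeta w = of_nat n * (w - s0) ^ (n - 1) * g w + (w - s0) ^ n * deriv g w"
        by (rule DERIV_imp_deriv)
      have "of_nat n + (w - s0) * (deriv g w / g w) = (w - s0) * (deriv regzeta w / regzeta w)"
        unfolding d gr(4)[OF w(1)] using w(2) gr(5)[OF w(1)] by (cases n) (auto simp: field_simps)
      thus ?case by (simp add: w_def)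
    qed
  qed
  with gr(1) show ?thesis by (intro that[of n]) auto
qed

lemma regzeta_log_deriv:
  assumes "Re s > 1" "regzeta s \<noteq> 0"
  shows "deriv regzeta s / regzeta s = 1 / (s - 1) - mangoldt_series s"
  using regzeta_deriv[OF assms(1)] assms(2) by simp

text \<open>The coefficients satisfy 3 + 4 cos a + cos (2 a) = 2 (1 + cos a)^2, and the imaginary
  part u of the exponent turns the n-th term into a nonnegative multiple of cos (u ln n).\<close>

lemma Re_mangoldt_series_341:
  assumes "x > 1"
  shows "3 * Re (mangoldt_series (of_real x)) + 4 * Re (mangoldt_series (of_real x + \<i> * t)) + Re (mangoldt_series (of_real x + \<i> * (2 * of_real t))) \<ge> 0"
    (is "?L \<ge> 0")
proof -
  define c where "c = (\<lambda>n. mangoldt n * real n powr (-x))"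
  have *: "(\<lambda>n. c n * cos (u * ln (real n))) sums Re (mangoldt_series (of_real x + \<i> * of_real u))" for u :: real
  proof -
    have "(\<lambda>n. mangoldt n * of_nat n powr (- (of_real x + \<i> * of_real u)) :: complex) sums mangoldt_series (of_real x + \<i> * of_real u)"
      unfolding mangoldt_series_def using assms
      by (intro summable_sums summable_norm_cancel[OF summable_norm_mangoldt_series]) auto
    from sums_Re[OF this]
    have "(\<lambda>n. Re (mangoldt n * of_nat n powr (- (of_real x + \<i> * of_real u)) :: complex)) sums Re (mangoldt_series (of_real x + \<i> * of_real u))" .
    also have "(\<lambda>n. Re (mangoldt n * of_nat n powr (- (of_real x + \<i> * of_real u)) :: complex)) = (\<lambda>n. c n * cos (u * ln (real n)))"
    proof
      fix n
      show "Re (mangoldt n * of_nat n powr (- (of_real x + \<i> * of_real u)) :: complex) = c n * cos (u * ln (real n))"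
      proof (cases "n = 0")
        case False
        have "(mangoldt n :: complex) = of_real (mangoldt n)" by simp
        hence "Re (mangoldt n * of_nat n powr (- (of_real x + \<i> * of_real u)) :: complex) =
          mangoldt n * Re (of_nat n powr (- (of_real x + \<i> * of_real u)))"
          by (metis Re_complex_of_real Im_complex_of_real times_complex.simps(1) mult_zero_left diff_zero)
        moreover have "Re (of_nat n powr (- (of_real x + \<i> * of_real u))) = real n powr (-x) * cos (u * ln (real n))"
          using False by (simp add: powr_def Ln_of_nat Re_exp)
        ultimately show ?thesis by (simp add: c_def)
      qed (simp add: c_def)
    qed
    finally show ?thesis .
  qed
  have 1: "(\<lambda>n. 3 * (c n * cos (0 * ln (real n))) + 4 * (c n * cos (t * ln (real n))) + c n * cos (2 * t * ln (real n))) sums ?L"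
    using sums_add[OF sums_add[OF sums_mult[OF *[of 0], of 3] sums_mult[OF *[of t], of 4]] *[of "2 * t"]] by simp
  have 2: "3 * (c n * cos (0 * ln (real n))) + 4 * (c n * cos (t * ln (real n))) + c n * cos (2 * t * ln (real n)) \<ge> 0" for n
  proof -
    define y where "y = cos (t * ln (real n))"
    have "cos (2 * t * ln (real n)) = 2 * y^2 - 1"
      using cos_double_cos[of "t * ln (real n)"] by (simp add: y_def mult.assoc)
    hence "3 * (c n * cos (0 * ln (real n))) + 4 * (c n * cos (t * ln (real n))) + c n * cos (2 * t * ln (real n))
       = 3 * (c n * 1) + 4 * (c n * y) + c n * (2 * y^2 - 1)"
      unfolding y_def by simp
    also have "\<dots> = 2 * c n * (1 + y)^2"
      by (simp add: power2_eq_square algebra_simps)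
    also have "\<dots> \<ge> 0" by (simp add: c_def mangoldt_nonneg)
    finally show ?thesis .
  qed
  show ?thesis by (rule sums_le[OF 2 sums_zero 1])
qed

text \<open>To the right of s the logarithmic derivative stays bounded, because
  \<open>mangoldt_series\<close> is dominated by the convergent series of absolute values at Re s.
  Multiplied by h it tends to 0, so the order of vanishing at s is 0.\<close>

lemma regzeta_nonzero_gt1:
  assumes s: "Re s > 1" shows "regzeta s \<noteq> 0"
proof -
  obtain n :: nat where n: "n = 0 \<longleftrightarrow> regzeta s \<noteq> 0"
    "((\<lambda>h::real. h * (deriv regzeta (s + h) / regzeta (s + h))) \<longlongrightarrow> of_nat n) (at_right 0)"
    by (rule regzeta_log_deriv_order[OF less_imp_le[OF s]])
  define C where "C = 1 / (Re s - 1) + (\<Sum>n. mangoldt n * real n powr (- Re s))"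
  have "((\<lambda>h::real. h * (deriv regzeta (s + h) / regzeta (s + h))) \<longlongrightarrow> 0) (at_right 0)"
  proof (rule Lim_null_comparison)
    show "((\<lambda>h. h * C) \<longlongrightarrow> 0) (at_right 0)" by (auto intro!: tendsto_eq_intros)
    show "eventually (\<lambda>h::real. norm (h * (deriv regzeta (s + h) / regzeta (s + h))) \<le> h * C) (at_right 0)"
      using eventually_at_right_less[of 0]
    proof eventually_elim
      case (elim h)
      have "norm (deriv regzeta (s + h) / regzeta (s + h)) \<le> C"
      \<comment> \<open>At a zero of \<open>regzeta\<close> the quotient is 0 by the convention for
        division, and the bound is trivial.\<close>
      proof (cases "regzeta (s + h) = 0")
        case False
        have "norm (deriv regzeta (s + h) / regzeta (s + h)) = norm (1 / (s + h - 1) - mangoldt_series (s + h))"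
          using elim s False by (subst regzeta_log_deriv) auto
        also have "\<dots> \<le> norm (1 / (s + h - 1)) + norm (mangoldt_series (s + h))" by (rule norm_triangle_ineq4)
        also have "norm (1 / (s + h - 1)) \<le> 1 / (Re s - 1)"
          using complex_Re_le_cmod[of "s + h - 1"] s elim by (auto simp: norm_divide intro!: frac_le)
        also have "norm (mangoldt_series (s + h)) \<le> (\<Sum>n. mangoldt n * real n powr (- Re (s + h)))"
          using s elim by (intro norm_mangoldt_series_le) auto
        also have "\<dots> \<le> (\<Sum>n. mangoldt n * real n powr (- Re s))"
        proof (intro suminf_le summable_mangoldt_powr)
          fix n show "mangoldt n * real n powr (- Re (s + h)) \<le> mangoldt n * real n powr (- Re s)"
            using elim by (cases "n = 0") (auto intro!: mult_left_mono powr_mono mangoldt_nonneg)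
        qed (use s elim in auto)
        finally show ?thesis by (simp add: C_def)
      qed (use s in \<open>auto simp: C_def intro!: add_nonneg_nonneg suminf_nonneg summable_mangoldt_powr mult_nonneg_nonneg mangoldt_nonneg\<close>)
      hence "h * norm (deriv regzeta (s + h) / regzeta (s + h)) \<le> h * C"
        using elim by (intro mult_left_mono) auto
      thus ?case using elim unfolding norm_mult by simp
    qed
  qed
  hence "of_nat n = (0::complex)" using n(2) by (intro tendsto_unique[OF _ n(2)]) auto
  thus ?thesis using n(1) by simp
qed

text \<open>A zero at 1 + i t would make h * Re \<open>mangoldt_series\<close> tend to at most -1 at
  ordinate t and at most 0 at 2 t, while it tends to at most 1 at ordinate 0, where zeta has its
  simple pole. The 3-4-1 combination would then have a limit of at most 3 - 4 < 0, although it is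
  nonnegative for every h > 0.\<close>

lemma regzeta_nonzero:
  assumes s: "Re s \<ge> 1" shows "regzeta s \<noteq> 0"
proof (cases "Re s > 1")
  case True thus ?thesis by (rule regzeta_nonzero_gt1)
next
  case False
  define t where "t = Im s"
  have st: "s = 1 + \<i> * of_real t" using False s by (auto simp: t_def complex_eq_iff)
  show ?thesis
  proof
    assume 0: "regzeta s = 0"
    have t: "t \<noteq> 0" using 0 regzeta_1 st by auto
    \<comment> \<open>As h decreases to 0, \<open>L u h\<close> tends to the order of the pole of
      zeta at 1 + i u minus the order of the zero of \<open>regzeta\<close> there.\<close>
    define L where "L = (\<lambda>u (h::real). h * Re (mangoldt_series (of_real (1 + h) + \<i> * of_real u)))"
    have L: "\<exists>n::nat. (n = 0 \<longleftrightarrow> regzeta (1 + \<i> * of_real u) \<noteq> 0) \<and>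
        (L u \<longlongrightarrow> (if u = 0 then 1 else 0) - real n) (at_right 0)" for u
    proof -
      define z where "z = 1 + \<i> * of_real u"
      obtain n :: nat where n: "n = 0 \<longleftrightarrow> regzeta z \<noteq> 0"
        "((\<lambda>h::real. h * (deriv regzeta (z + h) / regzeta (z + h))) \<longlongrightarrow> of_nat n) (at_right 0)"
        by (rule regzeta_log_deriv_order[of z]) (auto simp: z_def)
      have "((\<lambda>h::real. of_real h / (\<i> * of_real u + of_real h)) \<longlongrightarrow> (if u = 0 then 1 else (0::complex))) (at_right 0)"
      proof (cases "u = 0")
        case True
        have "eventually (\<lambda>h::real. 1 = of_real h / (\<i> * of_real u + complex_of_real h)) (at_right 0)"
          using eventually_at_right_less[of 0] by eventually_elim (use True in auto)
        from Lim_transform_eventually[OF tendsto_const this] show ?thesis using True by simp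
      next
        case False
        have "((\<lambda>h::real. of_real h / (\<i> * of_real u + of_real h)) \<longlongrightarrow> of_real 0 / (\<i> * of_real u + of_real 0 :: complex)) (at_right 0)"
          using False by (intro tendsto_intros) auto
        thus ?thesis using False by simp
      qed
      from tendsto_Re[OF tendsto_diff[OF this n(2)]]
      have "((\<lambda>h::real. Re (of_real h / (\<i> * of_real u + of_real h) - h * (deriv regzeta (z + h) / regzeta (z + h)))) \<longlongrightarrow>
        (if u = 0 then 1 else 0) - real n) (at_right 0)" by (auto split: if_splits)
      hence "(L u \<longlongrightarrow> (if u = 0 then 1 else 0) - real n) (at_right 0)"
      proof (rule Lim_transform_eventually)
        show "eventually (\<lambda>h::real. Re (of_real h / (\<i> * of_real u + of_real h) - h * (deriv regzeta (z + h) / regzeta (z + h))) = L u h) (at_right 0)"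
          using eventually_at_right_less[of 0]
        proof eventually_elim
          case (elim h)
          have eq: "deriv regzeta (z + h) / regzeta (z + h) = 1 / (z + h - 1) - mangoldt_series (z + h)"
            using elim by (intro regzeta_log_deriv regzeta_nonzero_gt1) (auto simp: z_def)
          have "of_real h / (\<i> * of_real u + of_real h) - h * (deriv regzeta (z + h) / regzeta (z + h)) = h * mangoldt_series (z + h)"
            unfolding eq by (simp add: z_def right_diff_distrib)
          thus ?case by (simp add: L_def z_def add_ac)
        qed
      qed
      with n(1) show ?thesis unfolding z_def by (intro exI[of _ n] conjI)
    qed
    have L0: "\<exists>n::nat. (n = 0 \<longleftrightarrow> regzeta 1 \<noteq> 0) \<and> (L 0 \<longlongrightarrow> 1 - real n) (at_right 0)"
      using L[of 0] by simp
    then obtain n0 :: nat where n0: "n0 = 0 \<longleftrightarrow> regzeta 1 \<noteq> 0" "(L 0 \<longlongrightarrow> 1 - real n0) (at_right 0)"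
      by (elim exE conjE) (rule that)
    have L1: "\<exists>n::nat. (n = 0 \<longleftrightarrow> regzeta (1 + \<i> * of_real u) \<noteq> 0) \<and> (L u \<longlongrightarrow> 0 - real n) (at_right 0)"
      if "u \<noteq> 0" for u using L[of u] that by simp
    from L1[OF t] obtain n1 :: nat where n1: "n1 = 0 \<longleftrightarrow> regzeta s \<noteq> 0" "(L t \<longlongrightarrow> 0 - real n1) (at_right 0)"
      unfolding st[symmetric] by (elim exE conjE) (rule that)
    have "2 * t \<noteq> 0" using t by simp
    from L1[OF this] obtain n2 :: nat where n2: "(L (2 * t) \<longlongrightarrow> 0 - real n2) (at_right 0)"
      by (elim exE conjE) (rule that)
    have "((\<lambda>h. 3 * L 0 h + 4 * L t h + L (2 * t) h) \<longlongrightarrow> 3 * (1 - real n0) + 4 * (0 - real n1) + (0 - real n2)) (at_right 0)"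
      by (intro tendsto_intros n0 n1 n2)
    moreover have "eventually (\<lambda>h. 3 * L 0 h + 4 * L t h + L (2 * t) h \<ge> 0) (at_right 0)"
      using eventually_at_right_less[of 0]
    proof eventually_elim
      case (elim h)
      have "3 * L 0 h + 4 * L t h + L (2 * t) h = h * (3 * Re (mangoldt_series (of_real (1 + h))) + 4 * Re (mangoldt_series (of_real (1 + h) + \<i> * t)) + Re (mangoldt_series (of_real (1 + h) + \<i> * (2 * of_real t))))"
        by (simp add: L_def algebra_simps)
      also have "\<dots> \<ge> 0" using elim Re_mangoldt_series_341[of "1 + h" t] by (intro mult_nonneg_nonneg) auto
      finally show ?case .
    qed
    ultimately have ge: "3 * (1 - real n0) + 4 * (0 - real n1) + (0 - real n2) \<ge> 0"
      by (intro tendsto_lowerbound) auto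
    have "n1 \<noteq> 0" unfolding n1(1) using 0 by simp
    hence "real n1 \<ge> 1" by linarith
    moreover have "real n0 \<ge> 0" "real n2 \<ge> 0" by simp_all
    ultimately show False using ge by (simp add: algebra_simps)
  qed
qed

subsection \<open>A Tauberian theorem of Wiener and Ikehara\<close>

text \<open>The Fourier transform of \<open>tent l\<close>, that is l (sin x / x)^2 at x = l v / 2;
  the value at v = 0 is the continuous extension.\<close>

definition fejer :: "real \<Rightarrow> real \<Rightarrow> real" where
  "fejer l v = (if v = 0 then l else 2 * (1 - cos (l * v)) / (l * v ^ 2))"

definition tent :: "real \<Rightarrow> real \<Rightarrow> real" where
  "tent l w = max 0 (1 - \<bar>w\<bar> / l)"

lemma one_minus_cos_eq: "1 - cos x = 2 * sin (x / 2) ^ 2" for x :: real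
  using cos_double_sin[of "x / 2"] by simp

lemma one_minus_cos_le: "1 - cos x \<le> x ^ 2 / 2" for x :: real
proof -
  have "sin (x / 2) ^ 2 \<le> (x / 2) ^ 2"
    using power_mono[OF abs_sin_x_le_abs_x[of "x / 2"], of 2] by (simp add: power_divide)
  thus ?thesis by (simp add: one_minus_cos_eq power_divide)
qed

lemma one_minus_cos_ge:
  fixes x :: real assumes "\<bar>x\<bar> \<le> 1" shows "1 - cos x \<ge> x ^ 2 / 4"
proof -
  \<comment> \<open>On [0, 1/2] the cosine is at least 1 - (1/2)^2 / 2 = 7/8. The resulting constant
    2 * (49/64) / 4 = 49/128 exceeds 1/4.\<close>
  have "\<bar>sin y\<bar> \<ge> 7 / 8 * \<bar>y\<bar>" if "0 \<le> y" "y \<le> 1 / 2" for y :: real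
  proof (cases "y = 0")
    case False
    have "\<exists>z>0. z < y \<and> sin y - sin 0 = (y - 0) * cos z"
      using that False by (intro MVT2) auto
    then obtain z where z: "0 < z" "z < y" "sin y = y * cos z" by auto
    have "z ^ 2 \<le> (1 / 2) ^ 2" using z that by (intro power_mono) auto
    hence "cos z \<ge> 7 / 8" using one_minus_cos_le[of z] by (simp add: power2_eq_square)
    hence "y * cos z \<ge> y * (7 / 8)" using that by (intro mult_left_mono) auto
    thus ?thesis using z that by simp
  qed auto
  from this[of "\<bar>x\<bar> / 2"] assms have "\<bar>sin (\<bar>x\<bar> / 2)\<bar> \<ge> 7 / 8 * \<bar>x / 2\<bar>" by simp
  hence "\<bar>sin (\<bar>x\<bar> / 2)\<bar> ^ 2 \<ge> (7 / 8 * \<bar>x / 2\<bar>) ^ 2" by (intro power_mono) auto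
  hence "sin (x / 2) ^ 2 \<ge> 49 / 64 * (x ^ 2 / 4)"
    by (auto simp: power_mult_distrib power_divide abs_if split: if_splits)
  hence "1 - cos x \<ge> 2 * (49 / 64 * (x ^ 2 / 4))" unfolding one_minus_cos_eq by linarith
  moreover have "2 * (49 / 64 * (x ^ 2 / 4)) \<ge> x ^ 2 / 4" by (simp add: field_simps)
  ultimately show ?thesis by linarith
qed

lemma fejer_measurable [measurable]: "fejer l \<in> borel_measurable borel"
  unfolding fejer_def by measurable

lemma fejer_nonneg: "l > 0 \<Longrightarrow> fejer l v \<ge> 0"
  by (auto simp: fejer_def)

lemma fejer_le: assumes "l > 0" shows "fejer l v \<le> l"
proof (cases "v = 0")
  case False
  have "2 * (1 - cos (l * v)) \<le> l * (l * v ^ 2)"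
    using one_minus_cos_le[of "l * v"] by (simp add: power2_eq_square algebra_simps)
  thus ?thesis using False assms by (simp add: fejer_def pos_divide_le_eq)
qed (auto simp: fejer_def)

lemma fejer_le': assumes "l > 0" "v \<noteq> 0" shows "fejer l v \<le> 4 / l * (1 / v ^ 2)"
proof -
  have "2 * (1 - cos (l * v)) / (l * v ^ 2) \<le> 4 / (l * v ^ 2)"
  proof (rule divide_right_mono)
    show "2 * (1 - cos (l * v)) \<le> 4" using cos_ge_minus_one[of "l * v"] unfolding right_diff_distrib by linarith
  qed (use assms in auto)
  thus ?thesis using assms by (simp add: fejer_def)
qed

lemma fejer_ge: assumes "l > 0" "\<bar>v\<bar> \<le> 1 / l" shows "fejer l v \<ge> l / 2"
proof (cases "v = 0")
  case False
  have "\<bar>l * v\<bar> \<le> 1" using assms by (simp add: abs_mult field_simps)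
  from one_minus_cos_ge[OF this] have "l / 2 * (l * v ^ 2) \<le> 2 * (1 - cos (l * v))"
    by (simp add: power2_eq_square algebra_simps)
  thus ?thesis using False assms by (simp add: fejer_def pos_le_divide_eq)
qed (use assms in \<open>auto simp: fejer_def\<close>)

lemma inverse_square_tail:
  assumes "d > (0::real)"
  shows "has_bochner_integral lborel (\<lambda>v. indicator {d..} v * (1 / v ^ 2)) (1 / d)"
    and "has_bochner_integral lborel (\<lambda>v. indicator {d..} (-v) * (1 / v ^ 2)) (1 / d)"
proof -
  show 1: "has_bochner_integral lborel (\<lambda>v. indicator {d..} v * (1 / v ^ 2)) (1 / d)"
  proof (rule has_bochner_integral_nn_integral)
    have "(\<integral>\<^sup>+ x. ennreal (1 / x ^ 2) * indicator {d..} x \<partial>lborel) = ennreal (0 - (- 1 / d))"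
    proof (rule nn_integral_FTC_atLeast[where F = "\<lambda>x. - 1 / x"])
      fix x assume x: "d \<le> x"
      show "((\<lambda>x. - 1 / x) has_real_derivative 1 / x\<^sup>2) (at x)"
        using assms x by (auto intro!: derivative_eq_intros simp: power2_eq_square)
    next
      show "((\<lambda>x::real. - 1 / x) \<longlongrightarrow> 0) at_top" by real_asymp
    qed auto
    also have "(\<integral>\<^sup>+ x. ennreal (1 / x ^ 2) * indicator {d..} x \<partial>lborel) = (\<integral>\<^sup>+ x. ennreal (indicator {d..} x * (1 / x ^ 2)) \<partial>lborel)"
      by (intro nn_integral_cong) (auto simp: indicator_def)
    finally show "(\<integral>\<^sup>+ x. ennreal (indicator {d..} x * (1 / x ^ 2)) \<partial>lborel) = ennreal (1 / d)" by simp
  qed (use assms in auto)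
  show "has_bochner_integral lborel (\<lambda>v. indicator {d..} (-v) * (1 / v ^ 2)) (1 / d)"
    using lborel_has_bochner_integral_real_affine_iff[of "-1" "\<lambda>v. indicator {d..} v * (1 / v ^ 2)" "1/d" 0] 1 by simp
qed

lemma fejer_integrable: assumes "l > 0" shows "integrable lborel (fejer l)"
proof (rule Bochner_Integration.integrable_bound)
  note t = inverse_square_tail[of 1, THEN integrable.intros]
  show "integrable lborel (\<lambda>v. indicator {-1..1} v * l + (4 / l * (indicator {1..} v * (1 / v ^ 2)) + 4 / l * (indicator {1..} (-v) * (1 / v ^ 2))))"
    by (intro Bochner_Integration.integrable_add integrable_mult_right integrable_mult_left t integrable_real_indicator) auto
  show "AE v in lborel. norm (fejer l v) \<le> norm (indicator {-1..1} v * l + (4 / l * (indicator {1..} v * (1 / v ^ 2)) + 4 / l * (indicator {1..} (-v) * (1 / v ^ 2))))"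
  proof (intro AE_I2)
    fix v :: real
    show "norm (fejer l v) \<le> norm (indicator {-1..1} v * l + (4 / l * (indicator {1..} v * (1 / v ^ 2)) + 4 / l * (indicator {1..} (-v) * (1 / v ^ 2))))"
    proof (cases "\<bar>v\<bar> \<le> 1")
      case True
      have "fejer l v \<le> l" using fejer_le assms by auto
      also have "l \<le> indicator {-1..1} v * l + (4 / l * (indicator {1..} v * (1 / v ^ 2)) + 4 / l * (indicator {1..} (-v) * (1 / v ^ 2)))"
        using True assms by (auto simp: indicator_def)
      finally show ?thesis using fejer_nonneg[OF assms, of v] by simp
    next
      case False
      hence "fejer l v \<le> 4 / l * (1 / v ^ 2)" using fejer_le'[OF assms, of v] by auto
      also have "\<dots> = indicator {-1..1} v * l + (4 / l * (indicator {1..} v * (1 / v ^ 2)) + 4 / l * (indicator {1..} (-v) * (1 / v ^ 2)))"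
        using False by (auto simp: indicator_def)
      finally show ?thesis using fejer_nonneg[OF assms, of v] by simp
    qed
  qed
qed auto

text \<open>The true value is 2\<pi>. The symbol stands on both sides of the comparisons below,
  which the bound of \<open>fejer_mass_ge\<close> decides.\<close>

definition fejer_mass :: "real \<Rightarrow> real" where "fejer_mass l = (LBINT v. fejer l v)"
definition fejer_part :: "real \<Rightarrow> real \<Rightarrow> real" where
  "fejer_part l d = (LBINT v. indicator {-d..d} v * fejer l v)"

lemma integrable_indicator_mult:
  fixes f :: "real \<Rightarrow> real"
  assumes "integrable lborel f" "A \<in> sets borel"
  shows "integrable lborel (\<lambda>x. indicator A x * f x)"
  using integrable_mult_indicator[of A lborel f] assms by simp

lemma fejer_part_le: assumes "l > 0" shows "fejer_part l d \<le> fejer_mass l"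
  unfolding fejer_part_def fejer_mass_def using assms fejer_nonneg[OF assms]
  by (intro integral_mono integrable_indicator_mult fejer_integrable) (auto simp: indicator_def)

text \<open>Off 0 the kernel is at most 4 / (l v^2), and each of the two tails integrates to at most
  4 / (l d). At fixed d the mass outside [-d, d] therefore vanishes as l grows.\<close>

lemma fejer_tail:
  assumes "l > 0" "d > 0"
  shows "fejer_mass l - fejer_part l d = (LBINT v. indicator (- {-d..d}) v * fejer l v)"
    and "(LBINT v. indicator (- {-d..d}) v * fejer l v) \<le> 8 / (l * d)"
proof -
  have "fejer_mass l - fejer_part l d = (LBINT v. fejer l v - indicator {-d..d} v * fejer l v)"
    unfolding fejer_mass_def fejer_part_def using assms
    by (intro Bochner_Integration.integral_diff[symmetric] integrable_indicator_mult fejer_integrable) auto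
  also have "(\<lambda>v. fejer l v - indicator {-d..d} v * fejer l v) = (\<lambda>v. indicator (- {-d..d}) v * fejer l v)"
    by (auto simp: indicator_def)
  finally show "fejer_mass l - fejer_part l d = (LBINT v. indicator (- {-d..d}) v * fejer l v)" .
  note t = inverse_square_tail[OF assms(2)]
  note t' = t[THEN integrable.intros]
  have "(LBINT v. indicator (- {-d..d}) v * fejer l v) \<le>
      (LBINT v. 4 / l * (indicator {d..} v * (1 / v ^ 2)) + 4 / l * (indicator {d..} (-v) * (1 / v ^ 2)))"
  proof (intro integral_mono Bochner_Integration.integrable_add integrable_mult_right t' integrable_indicator_mult fejer_integrable)
    fix v
    show "indicator (- {-d..d}) v * fejer l v \<le> 4 / l * (indicator {d..} v * (1 / v ^ 2)) + 4 / l * (indicator {d..} (-v) * (1 / v ^ 2))"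
      using fejer_le'[of l v] assms by (auto simp: indicator_def)
  qed (use assms in auto)
  also have "\<dots> = 4 / l * (1 / d) + 4 / l * (1 / d)"
    by (subst Bochner_Integration.integral_add)
       (auto simp only: has_bochner_integral_integral_eq[OF t(1)] has_bochner_integral_integral_eq[OF t(2)] integral_mult_right_zero intro!: integrable_mult_right t')
  finally show "(LBINT v. indicator (- {-d..d}) v * fejer l v) \<le> 8 / (l * d)" by (simp add: mult.commute)
qed

text \<open>A box of height l / 2 over [-1/l, 1/l] lies below the kernel and has area 1.\<close>

lemma fejer_mass_ge: assumes "l > 0" shows "fejer_mass l \<ge> 1"
proof -
  have "1 = (LBINT v. indicator {-1/l..1/l} v * (l / 2))"
    using assms by simp
  also have "\<dots> \<le> fejer_mass l" unfolding fejer_mass_def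
  proof (intro integral_mono fejer_integrable assms)
    show "integrable lborel (\<lambda>v. indicator {-1/l..1/l} v * (l / 2))"
      by (intro integrable_mult_left integrable_real_indicator) (auto simp: emeasure_lborel_Icc_eq)
    show "indicator {-1/l..1/l} v * (l / 2) \<le> fejer l v" for v
      using fejer_nonneg[OF assms, of v] fejer_ge[OF assms, of v] by (auto simp: indicator_def abs_le_iff)
  qed
  finally show ?thesis .
qed

lemma LBINT_reflect:
  fixes g :: "real \<Rightarrow> real"
  shows "(LBINT u. g (T - u)) = (LBINT v. g v)"
  using lborel_integral_real_affine[of "-1" g T] by simp

lemma integrable_reflect:
  fixes g :: "real \<Rightarrow> real"
  assumes "integrable lborel g"
  shows "integrable lborel (\<lambda>u. g (T - u))"
  using lborel_integrable_real_affine[OF assms, of "-1" T] by simp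

text \<open>Integration by parts gives explicit primitives on the two linear pieces of the tent;
  they divide by v, hence the separate polynomial case v = 0.\<close>

lemma fejer_fourier:
  assumes l: "l > 0"
  shows "has_bochner_integral lborel (\<lambda>w. of_real (tent l w) * exp (\<i> * w * v)) (complex_of_real (fejer l v))"
proof -
  define G1 where "G1 = (\<lambda>z::complex. if v = 0 then z - z^2 / (2 * l)
     else (1 - z / l) * exp (\<i> * z * v) / (\<i> * v) + exp (\<i> * z * v) / (l * (\<i> * v) ^ 2))"
  define G2 where "G2 = (\<lambda>z::complex. if v = 0 then z + z^2 / (2 * l)
     else (1 + z / l) * exp (\<i> * z * v) / (\<i> * v) - exp (\<i> * z * v) / (l * (\<i> * v) ^ 2))"
  have 1: "has_bochner_integral lborel (\<lambda>w. indicator {0..l} w *\<^sub>R (of_real (1 - w / l) * exp (\<i> * w * v))) (G1 (of_real l) - G1 (of_real 0))"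
  proof (rule has_bochner_integral_FTC_Icc)
    fix w :: real
    have "(G1 has_field_derivative (1 - of_real w / l) * exp (\<i> * w * v)) (at (of_real w))"
      using l unfolding G1_def
      by (cases "v = 0") (auto intro!: derivative_eq_intros simp: field_simps power2_eq_square)
    from has_vector_derivative_real_field[OF this]
    show "((\<lambda>w. G1 (of_real w)) has_vector_derivative of_real (1 - w / l) * exp (\<i> * w * v)) (at w within {0..l})"
      by simp
  qed (use l in \<open>auto intro!: continuous_intros\<close>)
  have 2: "has_bochner_integral lborel (\<lambda>w. indicator {-l..0} w *\<^sub>R (of_real (1 + w / l) * exp (\<i> * w * v))) (G2 (of_real 0) - G2 (of_real (-l)))"
  proof (rule has_bochner_integral_FTC_Icc)
    fix w :: real
    have "(G2 has_field_derivative (1 + of_real w / l) * exp (\<i> * w * v)) (at (of_real w))"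
      using l unfolding G2_def
      by (cases "v = 0") (auto intro!: derivative_eq_intros simp: field_simps power2_eq_square)
    from has_vector_derivative_real_field[OF this]
    show "((\<lambda>w. G2 (of_real w)) has_vector_derivative of_real (1 + w / l) * exp (\<i> * w * v)) (at w within {-l..0})"
      by simp
  qed (use l in \<open>auto intro!: continuous_intros\<close>)
  have "has_bochner_integral lborel (\<lambda>w. of_real (tent l w) * exp (\<i> * w * v))
          ((G1 (of_real l) - G1 (of_real 0)) + (G2 (of_real 0) - G2 (of_real (-l))))"
  proof (rule has_bochner_integralI_AE[OF has_bochner_integral_add[OF 1 2]])
    show "(\<lambda>w. of_real (tent l w) * exp (\<i> * w * v)) \<in> borel_measurable lborel"
      unfolding tent_def by measurable
    \<comment> \<open>At w = 0 both closed pieces count, so the sum of the two integrands is the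
      tent only almost everywhere.\<close>
    have "AE w in lborel. w \<noteq> (0::real)" by (rule AE_lborel_singleton)
    thus "AE w in lborel. indicator {0..l} w *\<^sub>R (of_real (1 - w / l) * exp (\<i> * w * v)) + indicator {-l..0} w *\<^sub>R (of_real (1 + w / l) * exp (\<i> * w * v)) = of_real (tent l w) * exp (\<i> * w * v)"
    proof eventually_elim
      case (elim w)
      show ?case using elim l by (auto simp: tent_def indicator_def max_def field_simps)
    qed
  qed
  moreover have "(G1 (of_real l) - G1 (of_real 0)) + (G2 (of_real 0) - G2 (of_real (-l))) = of_real (fejer l v)"
  proof (cases "v = 0")
    case True
    thus ?thesis using l by (simp add: G1_def G2_def fejer_def power2_eq_square field_simps)
  next
    case False
    have "exp (\<i> * l * v) + exp (- (\<i> * l * v)) = 2 * cos (complex_of_real (l * v))"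
      by (simp add: cos_exp_eq mult_ac)
    also have "\<dots> = of_real (2 * cos (l * v))" unfolding cos_of_real by simp
    finally have *: "exp (\<i> * l * v) + exp (- (\<i> * l * v)) = of_real (2 * cos (l * v))" .
    have "(G1 (of_real l) - G1 (of_real 0)) + (G2 (of_real 0) - G2 (of_real (-l))) =
        (exp (\<i> * l * v) + exp (- (\<i> * l * v)) - 2) / (l * (\<i> * v) ^ 2)"
      using l False by (simp add: G1_def G2_def diff_divide_distrib add_divide_distrib)
    also have "\<dots> = of_real (fejer l v)"
      unfolding * using l False by (simp add: fejer_def power_mult_distrib field_simps)
    finally show ?thesis .
  qed
  ultimately show ?thesis by (simp only:)
qed

lemma exp_tail:
  assumes "s > (0::real)"
  shows "has_bochner_integral lborel (\<lambda>u. indicator {a..} u * exp (- (s * u))) (exp (- (s * a)) / s)"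
proof (rule has_bochner_integral_nn_integral)
  have "(\<integral>\<^sup>+ x. ennreal (exp (- (s * x))) * indicator {a..} x \<partial>lborel) = ennreal (0 - (- exp (- (s * a)) / s))"
  proof (rule nn_integral_FTC_atLeast[where F = "\<lambda>x. - exp (- (s * x)) / s"])
    fix x
    show "((\<lambda>x. - exp (- (s * x)) / s) has_real_derivative exp (- (s * x))) (at x)"
      using assms by (auto intro!: derivative_eq_intros)
  next
    show "((\<lambda>x::real. - exp (- (s * x)) / s) \<longlongrightarrow> 0) at_top" using assms by real_asymp
  qed auto
  also have "(\<integral>\<^sup>+ x. ennreal (exp (- (s * x))) * indicator {a..} x \<partial>lborel) = (\<integral>\<^sup>+ x. ennreal (indicator {a..} x * exp (- (s * x))) \<partial>lborel)"
    by (intro nn_integral_cong) (auto simp: indicator_def)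
  finally show "(\<integral>\<^sup>+ x. ennreal (indicator {a..} x * exp (- (s * x))) \<partial>lborel) = ennreal (exp (- (s * a)) / s)" by simp
qed (use assms in auto)

lemma tent_nonneg: "tent l w \<ge> 0" by (simp add: tent_def)

lemma tent_eq_0: "l > 0 \<Longrightarrow> \<bar>w\<bar> \<ge> l \<Longrightarrow> tent l w = 0"
  by (auto simp: tent_def max_def field_simps)

lemma tent_measurable [measurable]: "tent l \<in> borel_measurable borel"
  unfolding tent_def by measurable

lemma continuous_on_tent [continuous_intros]:
  "l > 0 \<Longrightarrow> continuous_on A g \<Longrightarrow> continuous_on A (\<lambda>x. tent l (g x))"
  unfolding tent_def by (intro continuous_intros) auto

text \<open>Translating by half a period \<open>\<pi> / T\<close> flips the sign of the oscillating factor, so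
  uniform continuity alone gives decay, uniformly in the abscissa.\<close>

lemma tent_riemann_lebesgue:
  fixes H :: "complex \<Rightarrow> complex"
  assumes l: "l > 0" and H: "continuous_on {z. Re z \<ge> 0} H" and e: "e > 0"
  obtains T0 where "T0 > 0" "\<And>T s. T \<ge> T0 \<Longrightarrow> 0 < s \<Longrightarrow> s \<le> 1 \<Longrightarrow>
     norm (LBINT w. of_real (tent l w) * exp (\<i> * w * of_real T) * H (Complex s w)) \<le> e"
proof -
  define \<Phi> where "\<Phi> = (\<lambda>(s,w). of_real (tent l w) * H (Complex s w))"
  \<comment> \<open>The box contains s = 0, where continuity of \<open>H\<close> up to the boundary
    is used, and is wide enough to hold w + h for w in [-l-1, l+1] and h \<le> 1.\<close>
  define K :: "(real \<times> real) set" where "K = {0..1} \<times> {-l-1..l+2}"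
  have cont: "continuous_on K \<Phi>"
    unfolding \<Phi>_def K_def case_prod_unfold
    by (intro continuous_intros l continuous_on_compose2[OF H]) (auto simp: Complex_eq intro!: continuous_intros)
  have "uniformly_continuous_on K \<Phi>"
    by (intro compact_uniformly_continuous cont) (auto simp: K_def intro!: compact_Times)
  \<comment> \<open>On an interval of length 2 (l + 1) this accuracy adds up to 2 e, and pairing w
    with w + h produces twice the integral.\<close>
  moreover have "e / (l + 1) > 0" using l e by simp
  ultimately obtain d where d: "d > 0"
    "\<And>x y. x \<in> K \<Longrightarrow> y \<in> K \<Longrightarrow> dist y x < d \<Longrightarrow> dist (\<Phi> y) (\<Phi> x) < e / (l + 1)"
    unfolding uniformly_continuous_on_def by metis
  \<comment> \<open>Guarantees that the shift \<pi> / T is at most 1 and smaller than d.\<close>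
  define T0 where "T0 = pi * (1 + 2 / d)"
  have "T0 > 0" using d by (auto simp: T0_def intro!: mult_pos_pos add_pos_pos)
  moreover have "norm (LBINT w. of_real (tent l w) * exp (\<i> * w * of_real T) * H (Complex s w)) \<le> e"
    if T: "T \<ge> T0" and s: "0 < s" "s \<le> 1" for T s
  proof -
    define h where "h = pi / T"
    have Tpos: "T > 0" using T \<open>T0 > 0\<close> by simp
    have T1: "pi \<le> T" and T2: "pi * 2 / d \<le> T"
      using T d by (auto simp: T0_def algebra_simps intro: order_trans[rotated])
    have "pi * 2 \<le> T * d" using T2 d by (simp add: pos_divide_le_eq)
    hence "pi < T * d" using pi_gt_zero by linarith
    hence h: "0 < h" "h \<le> 1" "h < d"
      using Tpos T1 by (auto simp: h_def pos_divide_less_eq mult.commute)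
    define G where "G = (\<lambda>w. \<Phi> (s, w) * exp (\<i> * w * of_real T))"
    have "set_integrable lborel {-l..l} G"
      unfolding G_def \<Phi>_def prod.case
      by (intro borel_integrable_atLeastAtMost' continuous_intros l continuous_on_compose2[OF H])
         (use s in \<open>auto simp: Complex_eq intro!: continuous_intros\<close>)
    moreover have "indicator {-l..l} w *\<^sub>R G w = G w" for w
      using tent_eq_0[OF l, of w] by (auto simp: G_def \<Phi>_def indicator_def)
    ultimately have Gi: "integrable lborel G" by (simp add: set_integrable_def)
    have Gi': "integrable lborel (\<lambda>w. G (h + w))"
      using lborel_integrable_real_affine[OF Gi, of 1 h] by simp
    have "(LBINT w. G w) = (LBINT w. G (h + w))"
      using lborel_integral_real_affine[of 1 G h] by simp
    hence "2 * (LBINT w. G w) = (LBINT w. G w) + (LBINT w. G (h + w))" by simp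
    also have "\<dots> = (LBINT w. G w + G (h + w))"
      by (rule Bochner_Integration.integral_add[OF Gi Gi', symmetric])
    finally have "2 * norm (LBINT w. G w) = norm (LBINT w. G w + G (h + w))"
      by (metis norm_mult norm_numeral)
    also have "\<dots> \<le> (LBINT w. norm (G w + G (h + w)))" by (rule integral_norm_bound)
    also have "\<dots> \<le> (LBINT w. indicator {-l-1..l+1} w * (e / (l + 1)))"
    proof (rule integral_mono)
      show "integrable lborel (\<lambda>w. norm (G w + G (h + w)))"
        by (intro integrable_norm Bochner_Integration.integrable_add Gi Gi')
      show "integrable lborel (\<lambda>w. indicator {-l-1..l+1} w * (e / (l + 1)))"
        by (intro integrable_mult_left integrable_real_indicator) (auto simp: emeasure_lborel_Icc_eq)
      fix w
      have "\<i> * of_real (h + w) * of_real T = \<i> * w * T + of_real pi * \<i>"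
        using Tpos by (simp add: h_def algebra_simps)
      hence "exp (\<i> * of_real (h + w) * of_real T) = exp (\<i> * w * T) * exp (of_real pi * \<i>)"
        by (simp only: exp_add)
      also have "\<dots> = - exp (\<i> * w * T)" by simp
      finally have "G w + G (h + w) = (\<Phi> (s, w) - \<Phi> (s, h + w)) * exp (\<i> * w * T)"
        by (simp add: G_def algebra_simps)
      hence eq: "norm (G w + G (h + w)) = dist (\<Phi> (s, w)) (\<Phi> (s, h + w))"
        by (simp add: norm_mult dist_norm norm_exp_eq_Re)
      show "norm (G w + G (h + w)) \<le> indicator {-l-1..l+1} w * (e / (l + 1))"
      proof (cases "w \<in> {-l-1..l+1}")
        case True
        have "dist (\<Phi> (s, w)) (\<Phi> (s, h + w)) < e / (l + 1)"
          using True h s l by (intro d) (auto simp: K_def dist_Pair_Pair dist_real_def)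
        thus ?thesis using True eq by simp
      next
        case False
        hence "tent l w = 0" "tent l (h + w) = 0"
          using l h by (auto intro!: tent_eq_0)
        thus ?thesis using False unfolding eq by (simp add: \<Phi>_def)
      qed
    qed
    also have "\<dots> = 2 * e"
      using l by (simp add: field_simps)
    finally have "norm (LBINT w. G w) \<le> e" by simp
    thus ?thesis by (simp add: G_def \<Phi>_def mult_ac)
  qed
  ultimately show ?thesis by (rule that)
qed

section \<open>The Tauberian argument\<close>

text \<open>To be applied to f u = psi (e^u) e^(-u). \<open>f_mono\<close> is the Tauberian
  condition: f falls at most like e^(-u), so a single value bounds f from below on the stretch after
  it and from above on the stretch before it. \<open>H\<close> extends the Laplace transform of f -
  1 to the closed half plane.\<close>

locale laplace_boundary =
  fixes f :: "real \<Rightarrow> real" and H :: "complex \<Rightarrow> complex"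
  assumes f_measurable [measurable]: "f \<in> borel_measurable borel"
    and f_nonneg: "u \<ge> 0 \<Longrightarrow> f u \<ge> 0"
    and f_mono: "0 \<le> u \<Longrightarrow> u \<le> v \<Longrightarrow> exp u * f u \<le> exp v * f v"
    and f_integrable: "s > 0 \<Longrightarrow> integrable lborel (\<lambda>u. indicator {0..} u * (f u * exp (- (s * u))))"
    and f_laplace: "Re z > 0 \<Longrightarrow>
          (LBINT u. indicator {0..} u *\<^sub>R (of_real (f u - 1) * exp (- (z * of_real u)))) = H z"
    and H_cont: "continuous_on {z. Re z \<ge> 0} H"
begin

text \<open>Averages of f and of 1 around T. The damping by s > 0 gives access to the Laplace
  transform and is removed by letting s tend to 0 at fixed T.\<close>

definition fejer_f :: "real \<Rightarrow> real \<Rightarrow> real \<Rightarrow> real" where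
  "fejer_f l s T = (LBINT u. indicator {0..} u * (f u * exp (- (s * u))) * fejer l (T - u))"
definition fejer_1 :: "real \<Rightarrow> real \<Rightarrow> real \<Rightarrow> real" where
  "fejer_1 l s T = (LBINT u. indicator {0..} u * exp (- (s * u)) * fejer l (T - u))"

lemma integrable_mult_fejer:
  assumes l: "l > 0" and g: "integrable lborel g"
  shows "integrable lborel (\<lambda>u. g u * fejer l (T - u))"
proof (rule Bochner_Integration.integrable_bound[OF integrable_mult_left[OF g, of l]])
  show "AE u in lborel. norm (g u * fejer l (T - u)) \<le> norm (g u * l)"
    using l fejer_nonneg[OF l] fejer_le[OF l] by (intro AE_I2) (auto simp: abs_mult intro!: mult_left_mono)
qed (use g in measurable)

text \<open>Writing the kernel as the Fourier integral of \<open>tent\<close> and exchanging the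
  integrals turns the inner one into the Laplace transform at s + i w. As the tent has compact
  support, only boundary values with \<bar>w\<bar> \<le> l enter.\<close>

lemma fejer_identity:
  assumes l: "l > 0" and s: "s > 0"
  shows "(LBINT w. of_real (tent l w) * exp (\<i> * w * of_real T) * H (Complex s w)) =
         of_real (fejer_f l s T - fejer_1 l s T)"
proof -
  define g where "g = (\<lambda>u. indicator {0..} u * (f u * exp (- (s * u))) - indicator {0..} u * exp (- (s * u)))"
  define P where "P = (\<lambda>u w. complex_of_real (g u) * (of_real (tent l w) * exp (\<i> * w * of_real (T - u))))"
  have g: "integrable lborel g"
    unfolding g_def by (intro Bochner_Integration.integrable_diff f_integrable s integrable.intros[OF exp_tail])
  have [measurable]: "g \<in> borel_measurable borel" unfolding g_def by measurable
  have ff: "integrable lborel (\<lambda>w. of_real (tent l w) * exp (\<i> * w * of_real v) :: complex)" for v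
    using fejer_fourier[OF l, of v] by (rule integrable.intros)
  have np: "norm (P u w) = \<bar>g u\<bar> * tent l w" for u w
    by (simp add: P_def norm_mult norm_exp_eq_Re tent_nonneg)
  have "integrable (lborel \<Otimes>\<^sub>M lborel) (\<lambda>(u, w). P u w)"
  proof (rule lborel_pair.Fubini_integrable)
    show "(\<lambda>(u, w). P u w) \<in> borel_measurable (lborel \<Otimes>\<^sub>M lborel)"
      unfolding P_def by measurable
    have "integrable lborel (\<lambda>u. \<bar>g u\<bar> * (LBINT w. tent l w))"
      by (intro integrable_mult_left integrable_abs g)
    thus "integrable lborel (\<lambda>u. LBINT w. norm (case (u, w) of (u, w) \<Rightarrow> P u w))"
      by (simp add: np)
    show "AE u in lborel. integrable lborel (\<lambda>w. case (u, w) of (u, w) \<Rightarrow> P u w)"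
      unfolding P_def prod.case by (intro AE_I2 integrable_mult_right ff)
  qed
  from lborel_pair.Fubini_integral[OF this]
  have "(LBINT w. LBINT u. P u w) = (LBINT u. LBINT w. P u w)" .
  also have "(LBINT u. LBINT w. P u w) = (LBINT u. complex_of_real (g u * fejer l (T - u)))"
    unfolding P_def integral_mult_right_zero has_bochner_integral_integral_eq[OF fejer_fourier[OF l]] by simp
  also have "\<dots> = of_real (LBINT u. g u * fejer l (T - u))" by (rule integral_complex_of_real)
  also have "(LBINT u. g u * fejer l (T - u)) = fejer_f l s T - fejer_1 l s T"
    unfolding g_def left_diff_distrib fejer_f_def fejer_1_def
    by (intro Bochner_Integration.integral_diff integrable_mult_fejer l f_integrable s integrable.intros[OF exp_tail])
  also have "(\<lambda>w. LBINT u. P u w) = (\<lambda>w. of_real (tent l w) * exp (\<i> * w * of_real T) * H (Complex s w))"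
  proof
    fix w
    have "(LBINT u. P u w) = (LBINT u. of_real (tent l w) * exp (\<i> * w * of_real T) * (indicator {0..} u *\<^sub>R (of_real (f u - 1) * exp (- (Complex s w * of_real u)))))"
    proof (rule Bochner_Integration.integral_cong)
      fix u
      have "exp (\<i> * w * of_real (T - u)) * exp (- (of_real (s * u))) = exp (\<i> * w * of_real T) * exp (- (Complex s w * of_real u))"
        unfolding exp_add [symmetric] by (simp add: Complex_eq algebra_simps)
      moreover have "complex_of_real (exp (- (s * u))) = exp (- (of_real (s * u)))"
        unfolding of_real_minus[symmetric] exp_of_real ..
      ultimately show "P u w = of_real (tent l w) * exp (\<i> * w * of_real T) * (indicator {0..} u *\<^sub>R (of_real (f u - 1) * exp (- (Complex s w * of_real u))))"
        by (simp add: P_def g_def indicator_def algebra_simps)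
    qed auto
    also have "\<dots> = of_real (tent l w) * exp (\<i> * w * of_real T) * H (Complex s w)"
      using s by (subst integral_mult_right_zero, subst f_laplace) auto
    finally show "(LBINT u. P u w) = \<dots>" .
  qed
  finally show ?thesis .
qed

text \<open>\<open>T0\<close> does not depend on s, since the decay of the oscillating integral is
  uniform in the abscissa. This allows s to tend to 0 after T has been fixed.\<close>

lemma fejer_close:
  assumes l: "l > 0" and e: "e > 0"
  obtains T0 where "T0 > 0" "\<And>T s. T \<ge> T0 \<Longrightarrow> 0 < s \<Longrightarrow> s \<le> 1 \<Longrightarrow> \<bar>fejer_f l s T - fejer_1 l s T\<bar> \<le> e"
proof -
  obtain T0 where T0: "T0 > 0" "\<And>T s. T \<ge> T0 \<Longrightarrow> 0 < s \<Longrightarrow> s \<le> 1 \<Longrightarrow>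
     norm (LBINT w. of_real (tent l w) * exp (\<i> * w * of_real T) * H (Complex s w)) \<le> e"
    using tent_riemann_lebesgue[OF l H_cont e] by metis
  show ?thesis
  proof (rule that[OF T0(1)])
    fix T s :: real assume "T \<ge> T0" "0 < s" "s \<le> 1"
    from T0(2)[OF this] show "\<bar>fejer_f l s T - fejer_1 l s T\<bar> \<le> e"
      unfolding fejer_identity[OF l \<open>0 < s\<close>] norm_of_real .
  qed
qed

lemma fejer_1_le: assumes l: "l > 0" and s: "s > 0" shows "fejer_1 l s T \<le> fejer_mass l"
proof -
  have "fejer_1 l s T \<le> (LBINT u. fejer l (T - u))"
    unfolding fejer_1_def
  proof (intro integral_mono integrable_mult_fejer l integrable_reflect fejer_integrable integrable.intros[OF exp_tail] s)
    show "indicator {0..} u * exp (- (s * u)) * fejer l (T - u) \<le> fejer l (T - u)" for u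
      using s fejer_nonneg[OF l, of "T - u"] by (intro mult_left_le_one_le) (auto simp: indicator_def)
  qed
  also have "\<dots> = fejer_mass l" unfolding fejer_mass_def by (rule LBINT_reflect)
  finally show ?thesis .
qed

text \<open>Only u in [0, 2 T] is kept, where the damping is at least e^(-2 s T).\<close>

lemma fejer_1_ge: assumes l: "l > 0" and s: "s > 0" and T: "T > 0"
  shows "exp (- (2 * s * T)) * fejer_part l T \<le> fejer_1 l s T"
proof -
  have "exp (- (2 * s * T)) * fejer_part l T = exp (- (2 * s * T)) * (LBINT u. indicator {-T..T} (T - u) * fejer l (T - u))"
    unfolding fejer_part_def by (subst LBINT_reflect[symmetric, where T = T]) simp
  also have "\<dots> = (LBINT u. exp (- (2 * s * T)) * (indicator {-T..T} (T - u) * fejer l (T - u)))" by simp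
  also have "\<dots> \<le> fejer_1 l s T"
    unfolding fejer_1_def
  proof (rule integral_mono)
    show "integrable lborel (\<lambda>u. exp (- (2 * s * T)) * (indicator {-T..T} (T - u) * fejer l (T - u)))"
      by (intro integrable_mult_right integrable_reflect[of "\<lambda>v. indicator {-T..T} v * fejer l v"]
          integrable_indicator_mult fejer_integrable l) auto
    show "integrable lborel (\<lambda>u. indicator {0..} u * exp (- (s * u)) * fejer l (T - u))"
      by (intro integrable_mult_fejer l integrable.intros[OF exp_tail] s)
    fix u
    have "exp (- (2 * s * T)) \<le> exp (- (s * u))" if "u \<le> 2 * T"
      using that s by (simp add: mult_left_mono mult.assoc mult.left_commute)
    thus "exp (- (2 * s * T)) * (indicator {-T..T} (T - u) * fejer l (T - u)) \<le> indicator {0..} u * exp (- (s * u)) * fejer l (T - u)"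
      using fejer_nonneg[OF l, of "T - u"] by (auto simp: indicator_def intro!: mult_right_mono)
  qed
  finally show ?thesis .
qed

end

lemma tendsto_exp_at_right_0: "((\<lambda>s. exp (- (a * s))) \<longlongrightarrow> (1::real)) (at_right 0)"
  by (rule tendsto_eq_intros | simp)+

context laplace_boundary
begin

text \<open>The kernel is centred at T + d, so that its window of radius d is [T, T + 2 d], to the
  right of T; there \<open>f_mono\<close> gives f u \<ge> e^(-2 d) f T.\<close>

lemma fejer_f_ge:
  assumes l: "l > 0" and s: "s > 0" and T: "T \<ge> 0" and d: "d > 0"
  shows "exp (- (s * (T + 2 * d))) * (exp (- (2 * d)) * f T * fejer_part l d) \<le> fejer_f l s (T + d)"
proof -
  have "exp (- (s * (T + 2 * d))) * (exp (- (2 * d)) * f T * fejer_part l d) =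
     (LBINT u. exp (- (s * (T + 2 * d))) * (exp (- (2 * d)) * f T) * (indicator {-d..d} (T + d - u) * fejer l (T + d - u)))"
    unfolding fejer_part_def by (subst LBINT_reflect[symmetric, where T = "T + d"]) simp
  also have "\<dots> \<le> fejer_f l s (T + d)"
    unfolding fejer_f_def
  proof (rule integral_mono)
    show "integrable lborel (\<lambda>u. exp (- (s * (T + 2 * d))) * (exp (- (2 * d)) * f T) * (indicator {-d..d} (T + d - u) * fejer l (T + d - u)))"
      by (intro integrable_mult_right integrable_reflect[of "\<lambda>v. indicator {-d..d} v * fejer l v"]
          integrable_indicator_mult fejer_integrable l) auto
    show "integrable lborel (\<lambda>u. indicator {0..} u * (f u * exp (- (s * u))) * fejer l (T + d - u))"
      by (intro integrable_mult_fejer l f_integrable s)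
    fix u
    have *: "exp (- (s * (T + 2 * d))) * (exp (- (2 * d)) * f T) \<le> exp (- (s * u)) * f u"
      if u: "T \<le> u" "u \<le> T + 2 * d"
    proof (intro mult_mono)
      show "exp (- (s * (T + 2 * d))) \<le> exp (- (s * u))" using u s by simp
      have "exp (- (2 * d)) * f T \<le> exp (T - u) * f T" using u f_nonneg[OF T] by (intro mult_right_mono) auto
      also have "\<dots> = exp (- u) * (exp T * f T)" by (simp add: exp_diff exp_minus divide_inverse)
      also have "\<dots> \<le> exp (- u) * (exp u * f u)" using f_mono[OF T u(1)] by (intro mult_left_mono) auto
      also have "\<dots> = f u" by (simp add: exp_minus)
      finally show "exp (- (2 * d)) * f T \<le> f u" .
    qed (use f_nonneg[OF T] in auto)
    show "exp (- (s * (T + 2 * d))) * (exp (- (2 * d)) * f T) * (indicator {-d..d} (T + d - u) * fejer l (T + d - u))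
        \<le> indicator {0..} u * (f u * exp (- (s * u))) * fejer l (T + d - u)"
    proof (cases "T \<le> u \<and> u \<le> T + 2 * d")
      case True
      hence "indicator {-d..d} (T + d - u) = (1::real)" "indicator {0..} u = (1::real)" using T by (auto simp: indicator_def)
      thus ?thesis using mult_right_mono[OF * fejer_nonneg[OF l, of "T + d - u"]] True by (simp add: mult_ac)
    next
      case False
      hence 0: "indicator {-d..d} (T + d - u) = (0::real)" by (auto simp: indicator_def)
      show ?thesis unfolding 0 using f_nonneg[of u] fejer_nonneg[OF l, of "T + d - u"] by (auto simp: indicator_def)
    qed
  qed
  finally show ?thesis .
qed

text \<open>On the window [T - d, T + d] \<open>f_mono\<close> gives f u \<le> e^(2 d) f (T + d).
  Outside of it f is bounded by \<open>M\<close> and the mass of the kernel by its tail.\<close>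

lemma fejer_f_le:
  assumes l: "l > 0" and s: "s > 0" and d: "d > 0" and T: "T \<ge> d" and M: "\<And>u. u \<ge> 0 \<Longrightarrow> f u \<le> M"
  shows "fejer_f l s T \<le> exp (2 * d) * f (T + d) * fejer_mass l + M * (8 / (l * d))"
proof -
  have M0: "M \<ge> 0" using M[of 0] f_nonneg[of 0] by simp
  define I1 where "I1 = (\<lambda>v. indicator {-d..d} v * fejer l v)"
  define I2 where "I2 = (\<lambda>v. indicator (-{-d..d}) v * fejer l v)"
  have I: "integrable lborel I1" "integrable lborel I2"
    unfolding I1_def I2_def by (intro integrable_indicator_mult fejer_integrable l; simp)+
  have "fejer_f l s T \<le> (LBINT u. exp (2 * d) * f (T + d) * I1 (T - u) + M * I2 (T - u))"
    unfolding fejer_f_def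
  proof (rule integral_mono)
    show "integrable lborel (\<lambda>u. indicator {0..} u * (f u * exp (- (s * u))) * fejer l (T - u))"
      by (intro integrable_mult_fejer l f_integrable s)
    show "integrable lborel (\<lambda>u. exp (2 * d) * f (T + d) * I1 (T - u) + M * I2 (T - u))"
      by (intro Bochner_Integration.integrable_add integrable_mult_right integrable_reflect I)
    fix u
    have k: "fejer l (T - u) \<ge> 0" using l by (rule fejer_nonneg)
    show "indicator {0..} u * (f u * exp (- (s * u))) * fejer l (T - u) \<le> exp (2 * d) * f (T + d) * I1 (T - u) + M * I2 (T - u)"
    proof (cases "u \<ge> 0")
      case u: True
      have e: "f u * exp (- (s * u)) \<le> f u" using u s f_nonneg[OF u] by (intro mult_right_le_one_le) auto
      show ?thesis
      proof (cases "\<bar>T - u\<bar> \<le> d")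
        case True
        have "f u = exp (- u) * (exp u * f u)" by (simp add: exp_minus)
        also have "\<dots> \<le> exp (- u) * (exp (T + d) * f (T + d))"
          using True u by (intro mult_left_mono f_mono) auto
        also have "\<dots> = exp (T + d - u) * f (T + d)" by (simp add: exp_diff exp_minus divide_inverse)
        also have "\<dots> \<le> exp (2 * d) * f (T + d)"
          using True T d by (intro mult_right_mono f_nonneg) auto
        finally have "f u * exp (- (s * u)) \<le> exp (2 * d) * f (T + d)" using e by linarith
        thus ?thesis using True u mult_right_mono[OF _ k] by (auto simp: I1_def I2_def indicator_def)
      next
        case False
        have "f u * exp (- (s * u)) \<le> M" using e M[OF u] by linarith
        thus ?thesis using False u mult_right_mono[OF _ k] by (auto simp: I1_def I2_def indicator_def)
      qed
    next
      case False
      thus ?thesis using k M0 f_nonneg[of "T + d"] T d by (auto simp: I1_def I2_def indicator_def)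
    qed
  qed
  also have "\<dots> = exp (2 * d) * f (T + d) * (LBINT u. I1 (T - u)) + M * (LBINT u. I2 (T - u))"
    by (subst Bochner_Integration.integral_add) (auto intro!: integrable_mult_right integrable_reflect I)
  also have "\<dots> = exp (2 * d) * f (T + d) * fejer_part l d + M * (LBINT v. I2 v)"
    unfolding LBINT_reflect by (simp add: I1_def fejer_part_def)
  also have "\<dots> \<le> exp (2 * d) * f (T + d) * fejer_mass l + M * (8 / (l * d))"
    unfolding I2_def using T d f_nonneg[of "T + d"] M0
    by (intro add_mono mult_left_mono fejer_part_le l fejer_tail) auto
  finally show ?thesis .
qed

lemma eventually_f_upper:
  assumes c: "c > 1"
  shows "eventually (\<lambda>T. f T \<le> c) at_top"
proof -
  \<comment> \<open>Two losses of a factor r are allowed: e^(2 d) = r from the window of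
    monotonicity, and r for the mass outside [-d, d] together with the error of
    \<open>fejer_close\<close>.\<close>
  define r where "r = sqrt c"
  have r: "r > 1" "r * r = c" using c by (auto simp: r_def)
  define d where "d = ln r / 2"
  have d: "d > 0" "exp (- (2 * d)) = 1 / r" using r by (auto simp: d_def exp_minus inverse_eq_divide)
  \<comment> \<open>Makes r times the tail bound 8 / (l d) equal to (r - 1) / 2; the other half of
    the slack r - 1 goes to \<open>fejer_close\<close>.\<close>
  define l where "l = 16 * r / (d * (r - 1))"
  have l: "l > 0" using d r by (auto simp: l_def)
  have ld: "r * (8 / (l * d)) = (r - 1) / 2" using d r by (simp add: l_def field_simps)
  have "(r - 1) / 2 > 0" using r by simp
  from fejer_close[OF l this] obtain T0 where T0: "T0 > 0"
    "\<And>T s. T \<ge> T0 \<Longrightarrow> 0 < s \<Longrightarrow> s \<le> 1 \<Longrightarrow> \<bar>fejer_f l s T - fejer_1 l s T\<bar> \<le> (r - 1) / 2" by metis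
  have "f T \<le> c" if T: "T \<ge> T0" for T
  proof -
    have "exp (- (2 * d)) * f T * fejer_part l d \<le> fejer_mass l + (r - 1) / 2"
    proof (rule tendsto_upperbound)
      show "((\<lambda>s. exp (- ((T + 2 * d) * s)) * (exp (- (2 * d)) * f T * fejer_part l d)) \<longlongrightarrow> exp (- (2 * d)) * f T * fejer_part l d) (at_right 0)"
        using tendsto_mult[OF tendsto_exp_at_right_0[of "T + 2 * d"] tendsto_const] by simp
      show "eventually (\<lambda>s. exp (- ((T + 2 * d) * s)) * (exp (- (2 * d)) * f T * fejer_part l d) \<le> fejer_mass l + (r - 1) / 2) (at_right 0)"
        using eventually_at_right_real[of 0 1, OF zero_less_one]
      proof eventually_elim
        case (elim s)
        have s: "0 < s" "s \<le> 1" using elim by auto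
        have "exp (- (s * (T + 2 * d))) * (exp (- (2 * d)) * f T * fejer_part l d) \<le> fejer_f l s (T + d)"
          using s T T0 d by (intro fejer_f_ge l) auto
        also have "\<dots> \<le> fejer_1 l s (T + d) + (r - 1) / 2"
          using T0(2)[of "T + d" s] T d s by linarith
        also have "fejer_1 l s (T + d) \<le> fejer_mass l" by (rule fejer_1_le[OF l s(1)])
        finally show ?case by (simp add: mult.commute)
      qed
    qed auto
    also have "fejer_mass l + (r - 1) / 2 \<le> r * fejer_part l d"
    proof -
      have "r * (fejer_mass l - fejer_part l d) \<le> r * (8 / (l * d))"
        using fejer_tail[OF l d(1)] r by (intro mult_left_mono) auto
      moreover have "(r - 1) * fejer_mass l \<ge> (r - 1) * 1"
        using fejer_mass_ge[OF l] r by (intro mult_left_mono) auto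
      ultimately show ?thesis unfolding ld right_diff_distrib left_diff_distrib diff_divide_distrib by linarith
    qed
    finally have "r * (exp (- (2 * d)) * f T * fejer_part l d) \<le> r * (r * fejer_part l d)"
      using r by (intro mult_left_mono) auto
    hence "f T * fejer_part l d \<le> c * fejer_part l d"
      unfolding d(2) using r by (simp add: mult.assoc[symmetric])
    moreover have "0 < r * fejer_part l d"
      using \<open>fejer_mass l + (r - 1) / 2 \<le> r * fejer_part l d\<close> fejer_mass_ge[OF l] r
      unfolding diff_divide_distrib by linarith
    hence "fejer_part l d > 0" by (rule zero_less_mult_pos) (use r in auto)
    ultimately show "f T \<le> c" by simp
  qed
  thus ?thesis unfolding eventually_at_top_linorder by blast
qed

text \<open>Controls f in the tail of the kernel for the lower estimate: large u by the upper
  estimate, small u because e^u f u is increasing.\<close>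

lemma f_bounded: obtains M where "\<And>u. u \<ge> 0 \<Longrightarrow> f u \<le> M"
proof -
  obtain T1 where T1: "\<And>T. T \<ge> T1 \<Longrightarrow> f T \<le> 2"
    using eventually_f_upper[of 2] unfolding eventually_at_top_linorder by auto
  define T where "T = max 0 T1"
  have "f u \<le> max 2 (exp T * 2)" if u: "u \<ge> 0" for u
  proof (cases "u \<ge> T")
    case True thus ?thesis using T1[of u] by (intro max.coboundedI1) (simp add: T_def)
  next
    case False
    have "1 * f u \<le> exp u * f u" using u f_nonneg[OF u] by (intro mult_right_mono) auto
    also have "\<dots> \<le> exp T * f T" using False u by (intro f_mono) auto
    also have "\<dots> \<le> exp T * 2" using T1[of T] by (intro mult_left_mono) (auto simp: T_def)
    finally show ?thesis by simp
  qed
  thus ?thesis by (rule that)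
qed

lemma eventually_f_lower:
  assumes c: "0 < c" "c < 1"
  shows "eventually (\<lambda>T. f T \<ge> c) at_top"
proof -
  obtain M where M: "\<And>u. u \<ge> 0 \<Longrightarrow> f u \<le> M" using f_bounded by blast
  have M0: "M \<ge> 0" using M[of 0] f_nonneg[of 0] by simp
  define r where "r = sqrt c"
  have r: "0 < r" "r < 1" "r * r = c" using c by (auto simp: r_def)
  define d where "d = - ln r / 2"
  have d: "d > 0" "exp (2 * d) = 1 / r" using r by (auto simp: d_def exp_minus inverse_eq_divide)
  \<comment> \<open>The tail weighted by \<open>M\<close> (for f) and by 1 (for the constant
    function) takes (1 - r) / 3 altogether, and \<open>fejer_close\<close> takes another third; the
    sum stays below (1 - r) times the mass.\<close>
  define l where "l = 24 * (M + 1) / (d * (1 - r))"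
  have l: "l > 0" using d r M0 by (auto simp: l_def)
  have e: "l * d = 24 * (M + 1) / (1 - r)" using d r by (simp add: l_def)
  have "M + 1 > 0" using M0 by simp
  hence ld: "(M + 1) * (8 / (l * d)) = (1 - r) / 3" unfolding e using r by (simp add: divide_simps) (simp add: algebra_simps)
  have "(1 - r) / 3 > 0" using r by simp
  from fejer_close[OF l this] obtain T0 where T0: "T0 > 0"
    "\<And>T s. T \<ge> T0 \<Longrightarrow> 0 < s \<Longrightarrow> s \<le> 1 \<Longrightarrow> \<bar>fejer_f l s T - fejer_1 l s T\<bar> \<le> (1 - r) / 3" by metis
  have "f (T + d) \<ge> c" if T: "T \<ge> max T0 d" for T
  proof -
    have "fejer_part l T - (1 - r) / 3 \<le> exp (2 * d) * f (T + d) * fejer_mass l + M * (8 / (l * d))"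
    proof (rule tendsto_upperbound)
      show "((\<lambda>s. exp (- ((2 * T) * s)) * fejer_part l T - (1 - r) / 3) \<longlongrightarrow> fejer_part l T - (1 - r) / 3) (at_right 0)"
        using tendsto_diff[OF tendsto_mult[OF tendsto_exp_at_right_0[of "2 * T"] tendsto_const[of "fejer_part l T"]] tendsto_const[of "(1 - r) / 3"]] by simp
      show "eventually (\<lambda>s. exp (- ((2 * T) * s)) * fejer_part l T - (1 - r) / 3 \<le> exp (2 * d) * f (T + d) * fejer_mass l + M * (8 / (l * d))) (at_right 0)"
        using eventually_at_right_real[of 0 1, OF zero_less_one]
      proof eventually_elim
        case (elim s)
        have s: "0 < s" "s \<le> 1" using elim by auto
        have "exp (- (2 * s * T)) * fejer_part l T \<le> fejer_1 l s T"
          using T d s by (intro fejer_1_ge l) auto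
        moreover have "\<bar>fejer_f l s T - fejer_1 l s T\<bar> \<le> (1 - r) / 3" using T0(2)[of T s] T s by simp
        hence "fejer_1 l s T - (1 - r) / 3 \<le> fejer_f l s T" by linarith
        moreover have "fejer_f l s T \<le> exp (2 * d) * f (T + d) * fejer_mass l + M * (8 / (l * d))"
          using T by (intro fejer_f_le l s d M) auto
        ultimately show ?case by (simp add: mult_ac)
      qed
    qed auto
    moreover have "fejer_mass l - fejer_part l T \<le> 8 / (l * d)"
    proof -
      have "fejer_mass l - fejer_part l T \<le> 8 / (l * T)"
        using fejer_tail[OF l, of T] T d by auto
      also have "\<dots> \<le> 8 / (l * d)" using T d l by (intro divide_left_mono mult_left_mono mult_pos_pos) auto
      finally show ?thesis .
    qed
    ultimately have "fejer_mass l - (1 - r) / 3 - (M + 1) * (8 / (l * d)) \<le> exp (2 * d) * f (T + d) * fejer_mass l"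
      unfolding distrib_right by linarith
    moreover have "(1 - r) * fejer_mass l \<ge> (1 - r) * 1"
      using fejer_mass_ge[OF l] r by (intro mult_left_mono) auto
    ultimately have "r * fejer_mass l \<le> exp (2 * d) * f (T + d) * fejer_mass l"
      unfolding ld left_diff_distrib diff_divide_distrib using r(2) by linarith
    hence "r \<le> exp (2 * d) * f (T + d)" using fejer_mass_ge[OF l] by simp
    hence "r \<le> f (T + d) / r" unfolding d(2) by simp
    thus ?thesis using r by (simp add: pos_le_divide_eq)
  qed
  hence "f T \<ge> c" if "T \<ge> max T0 d + d" for T using that by (metis add.commute diff_add_cancel le_diff_eq)
  thus ?thesis unfolding eventually_at_top_linorder by blast
qed

theorem f_tendsto_1: "(f \<longlongrightarrow> 1) at_top"
proof (rule order_tendstoI)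
  fix a :: real assume a: "a < 1"
  define c where "c = (max a 0 + 1) / 2"
  have "0 < c" "c < 1" "a < c" using a by (auto simp: c_def max_def)
  from eventually_f_lower[OF this(1,2)] show "eventually (\<lambda>T. a < f T) at_top"
    by eventually_elim (use \<open>a < c\<close> in auto)
next
  fix a :: real assume a: "a > 1"
  define c where "c = (a + 1) / 2"
  have "1 < c" "c < a" using a by (auto simp: c_def)
  from eventually_f_upper[OF this(1)] show "eventually (\<lambda>T. f T < a) at_top"
    by eventually_elim (use \<open>c < a\<close> in auto)
qed

end

subsection \<open>The prime number theorem\<close>

lemma complex_exp_tail:
  fixes z :: complex
  assumes z: "Re z > 0"
  shows "has_bochner_integral lborel (\<lambda>u. indicator {a..} u *\<^sub>R exp (- (z * of_real u))) (exp (- (z * of_real a)) / z)"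
proof -
  have z0: "z \<noteq> 0" using z by auto
  have int: "integrable lborel (\<lambda>u. indicator {a..} u *\<^sub>R exp (- (z * of_real u)))"
  proof (rule Bochner_Integration.integrable_bound[OF integrable.intros[OF exp_tail[OF z, of a]]])
    show "AE u in lborel. norm (indicator {a..} u *\<^sub>R exp (- (z * of_real u))) \<le> norm (indicator {a..} u * exp (- (Re z * u)))"
      by (intro AE_I2) (simp add: norm_exp_eq_Re)
  qed measurable
  have "((\<lambda>b. LBINT u. indicator {..b} u *\<^sub>R (indicator {a..} u *\<^sub>R exp (- (z * of_real u)))) \<longlongrightarrow>
          (LBINT u. indicator {a..} u *\<^sub>R exp (- (z * of_real u)))) at_top"
    by (rule tendsto_integral_at_top[OF _ int]) auto
  moreover have "((\<lambda>b. LBINT u. indicator {..b} u *\<^sub>R (indicator {a..} u *\<^sub>R exp (- (z * of_real u)))) \<longlongrightarrow>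
          exp (- (z * of_real a)) / z - 0 / z) at_top"
  proof (rule Lim_transform_eventually)
    show "((\<lambda>b. exp (- (z * of_real a)) / z - exp (- (z * of_real b)) / z) \<longlongrightarrow> exp (- (z * of_real a)) / z - 0 / z) at_top"
    proof (intro tendsto_intros z0)
      have "((\<lambda>b. exp (- (Re z * b))) \<longlongrightarrow> 0) at_top" using z by real_asymp
      thus "((\<lambda>b::real. exp (- (z * of_real b))) \<longlongrightarrow> 0) at_top"
        by (subst tendsto_norm_zero_iff[symmetric]) (simp add: norm_exp_eq_Re)
    qed
    show "eventually (\<lambda>b. exp (- (z * of_real a)) / z - exp (- (z * of_real b)) / z =
       (LBINT u. indicator {..b} u *\<^sub>R (indicator {a..} u *\<^sub>R exp (- (z * of_real u))))) at_top"
      using eventually_ge_at_top[of a]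
    proof eventually_elim
      case (elim b)
      have "has_bochner_integral lborel (\<lambda>u. indicator {a..b} u *\<^sub>R exp (- (z * of_real u)))
              (- exp (- (z * of_real b)) / z - (- exp (- (z * of_real a)) / z))"
      proof (rule has_bochner_integral_FTC_Icc[OF elim])
        fix u :: real
        have "((\<lambda>w. - exp (- (z * w)) / z) has_field_derivative exp (- (z * of_real u))) (at (of_real u))"
          using z0 by (auto intro!: derivative_eq_intros)
        from has_vector_derivative_real_field[OF this]
        show "((\<lambda>u. - exp (- (z * of_real u)) / z) has_vector_derivative exp (- (z * of_real u))) (at u within {a..b})" .
      qed (auto intro!: continuous_intros)
      moreover have "(\<lambda>u. indicator {a..b} u *\<^sub>R exp (- (z * of_real u))) =
          (\<lambda>u. indicator {..b} u *\<^sub>R (indicator {a..} u *\<^sub>R exp (- (z * of_real u))))"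
        by (auto simp: indicator_def)
      ultimately show ?case by (auto dest!: has_bochner_integral_integral_eq)
    qed
  qed
  ultimately have "(LBINT u. indicator {a..} u *\<^sub>R exp (- (z * of_real u))) = exp (- (z * of_real a)) / z - 0 / z"
    by (intro tendsto_unique[where F = at_top]) auto
  with has_bochner_integral_integrable[OF int] show ?thesis by simp
qed

section \<open>The Chebyshev function and its Laplace transform\<close>

definition psi :: "nat \<Rightarrow> real" where "psi N = (\<Sum>n\<le>N. mangoldt n)"

lemma psi_nonneg: "psi N \<ge> 0" unfolding psi_def by (intro sum_nonneg mangoldt_nonneg)

lemma psi_mono: "M \<le> N \<Longrightarrow> psi M \<le> psi N"
  unfolding psi_def by (intro sum_mono2) (auto simp: mangoldt_nonneg)

definition psi_exp :: "real \<Rightarrow> real" where "psi_exp u = psi (nat \<lfloor>exp u\<rfloor>) * exp (- u)"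

text \<open>Splits the step function into single steps, the n-th one starting at u = ln n, so that
  the Laplace transform can be taken termwise. The index 0, where \<open>ln\<close> has a junk
  value, drops out because \<open>mangoldt 0\<close> is 0.\<close>

lemma psi_exp_conv_suminf:
  "(\<lambda>n. mangoldt n * (indicator {ln (real n)..} u * exp (- u))) sums (indicator {0..} u * psi_exp u)"
proof -
  have "(\<lambda>n. mangoldt n * (indicator {ln (real n)..} u * exp (- u))) sums
          (\<Sum>n\<le>nat \<lfloor>exp u\<rfloor>. mangoldt n * (indicator {ln (real n)..} u * exp (- u)))"
  proof (rule sums_finite)
    fix n assume n: "n \<notin> {..nat \<lfloor>exp u\<rfloor>}"
    hence "\<lfloor>exp u\<rfloor> < int n" by simp
    hence "real n > exp u" by (simp add: floor_less_iff)
    moreover from this have "n > 0" using exp_gt_zero[of u] by (intro Nat.gr0I) auto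
    ultimately have "ln (real n) > u" by (metis exp_gt_zero less_trans ln_exp ln_less_cancel_iff)
    thus "mangoldt n * (indicator {ln (real n)..} u * exp (- u)) = 0" by simp
  qed auto
  also have "(\<Sum>n\<le>nat \<lfloor>exp u\<rfloor>. mangoldt n * (indicator {ln (real n)..} u * exp (- u))) = indicator {0..} u * psi_exp u"
  proof (cases "u \<ge> 0")
    case True
    have "(\<Sum>n\<le>nat \<lfloor>exp u\<rfloor>. mangoldt n * (indicator {ln (real n)..} u * exp (- u))) = (\<Sum>n\<le>nat \<lfloor>exp u\<rfloor>. mangoldt n * exp (- u))"
    proof (rule sum.cong)
      fix n assume "n \<in> {..nat \<lfloor>exp u\<rfloor>}"
      hence "real n \<le> exp u" by (simp add: le_nat_iff le_floor_iff)
      hence "n > 0 \<Longrightarrow> ln (real n) \<le> u" by (metis exp_gt_zero ln_exp ln_le_cancel_iff of_nat_0_less_iff)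
      thus "mangoldt n * (indicator {ln (real n)..} u * exp (- u)) = mangoldt n * exp (- u)"
        by (cases "n = 0") auto
    qed auto
    thus ?thesis using True by (simp add: psi_exp_def psi_def sum_distrib_right)
  next
    case False
    hence "exp u < 1" by simp
    hence "nat \<lfloor>exp u\<rfloor> = 0" by (simp add: floor_le_iff)
    thus ?thesis using False by simp
  qed
  finally show ?thesis .
qed

lemma psi_exp_measurable [measurable]: "psi_exp \<in> borel_measurable borel"
proof -
  have [measurable]: "(\<lambda>u::real. psi (nat \<lfloor>exp u\<rfloor>)) \<in> borel_measurable borel"
    by (intro borel_measurable_mono monoI psi_mono nat_mono floor_mono) simp
  show ?thesis unfolding psi_exp_def by measurable
qed

text \<open>The step starting at ln n integrates to mangoldt n * n powr (-(1 + z)) / (1 + z). The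
  integrals of the norms form the same series at Re z, which converges and justifies the exchange of
  sum and integral.\<close>

lemma psi_exp_laplace:
  assumes z: "Re z > 0"
  shows "has_bochner_integral lborel (\<lambda>u. indicator {0..} u *\<^sub>R (of_real (psi_exp u) * exp (- (z * of_real u)))) (mangoldt_series (1 + z) / (1 + z))"
proof -
  define g where "g = (\<lambda>n u. mangoldt n * (indicator {ln (real n)..} u *\<^sub>R exp (- ((1 + z) * of_real u))) :: complex)"
  have z1: "Re (1 + z) > 0" using z by simp
  have g1: "has_bochner_integral lborel (g n) (mangoldt n * of_nat n powr (-(1 + z)) / (1 + z))" for n
  proof (cases "n = 0")
    case False
    have "exp (- ((1 + z) * of_real (ln (real n)))) = of_nat n powr (-(1 + z))"
      using False by (simp add: powr_def Ln_of_nat algebra_simps)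
    thus ?thesis using has_bochner_integral_mult_right[OF complex_exp_tail[OF z1, of "ln (real n)"], of "mangoldt n"]
      by (simp add: g_def)
  qed (simp add: g_def has_bochner_integral_zero)
  have ng: "norm (g n u) = mangoldt n * (indicator {ln (real n)..} u * exp (- (Re (1 + z) * u)))" for n u
    by (simp add: g_def norm_mult norm_exp_eq_Re)
  have "(LBINT u. norm (g n u)) = mangoldt n * real n powr (- Re (1 + z)) / Re (1 + z)" for n
  proof (cases "n = 0")
    case False
    have "exp (- (Re (1 + z) * ln (real n))) = real n powr (- Re (1 + z))"
      using False by (simp add: powr_def algebra_simps)
    thus ?thesis using has_bochner_integral_integral_eq[OF exp_tail[OF z1, of "ln (real n)"]] by (simp add: ng)
  qed (simp add: g_def)
  moreover have "summable (\<lambda>n. mangoldt n * real n powr (- Re (1 + z)) / Re (1 + z))"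
    using z by (intro summable_divide summable_mangoldt_powr) auto
  ultimately have g3: "summable (\<lambda>n. LBINT u. norm (g n u))" by (simp only:)
  have g2: "AE u in lborel. summable (\<lambda>n. norm (g n u))"
  proof (intro AE_I2)
    fix u
    have "norm (g n u) = mangoldt n * (indicator {ln (real n)..} u * exp (- u)) * exp (- (Re z * u))" for n
      unfolding ng by (simp add: exp_add [symmetric] algebra_simps)
    thus "summable (\<lambda>n. norm (g n u))"
      using summable_mult2[OF sums_summable[OF psi_exp_conv_suminf[of u]]] by simp
  qed
  have eq: "(\<Sum>n. g n u) = indicator {0..} u *\<^sub>R (of_real (psi_exp u) * exp (- (z * of_real u)))" for u
  proof -
    have "g n u = of_real (mangoldt n * (indicator {ln (real n)..} u * exp (- u))) * exp (- (z * of_real u))" for n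
    proof -
      have "exp (- ((1 + z) * of_real u)) = of_real (exp (- u)) * exp (- (z * of_real u))"
        unfolding exp_of_real[symmetric] exp_add[symmetric] by (simp add: algebra_simps)
      thus ?thesis by (simp add: g_def indicator_def)
    qed
    hence "(\<lambda>n. g n u) sums (of_real (indicator {0..} u * psi_exp u) * exp (- (z * of_real u)))"
      using sums_mult2[OF sums_of_real[OF psi_exp_conv_suminf[of u]]] by simp
    thus ?thesis by (simp add: sums_iff indicator_def)
  qed
  have int: "integrable lborel (\<lambda>u. \<Sum>n. g n u)"
    by (rule integrable_suminf[OF integrable.intros[OF g1] g2 g3])
  have "(LBINT u. \<Sum>n. g n u) = (\<Sum>n. LBINT u. g n u)"
    by (rule integral_suminf[OF integrable.intros[OF g1] g2 g3])
  hence "(LBINT u. \<Sum>n. g n u) = (\<Sum>n. mangoldt n * of_nat n powr (-(1 + z)) / (1 + z))"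
    by (simp only: has_bochner_integral_integral_eq[OF g1])
  also have "\<dots> = mangoldt_series (1 + z) / (1 + z)"
    unfolding mangoldt_series_def using z by (intro suminf_divide summable_norm_cancel[OF summable_norm_mangoldt_series]) auto
  finally show ?thesis using int unfolding eq by (simp add: has_bochner_integral_iff)
qed

lemma psi_exp_tendsto: "(psi_exp \<longlongrightarrow> 1) at_top"
proof -
  \<comment> \<open>The poles at z = 0 cancel: with D the logarithmic derivative of
    \<open>regzeta\<close> at 1 + z, the transform is (1 / z - D) / (1 + z) - 1 / z = -(D + 1) / (1
    + z). Non-vanishing of \<open>regzeta\<close> makes this continuous for Re z \<ge> 0.\<close>
  define H where "H = (\<lambda>z. - (deriv regzeta (1 + z) / regzeta (1 + z) + 1) / (1 + z))"
  interpret laplace_boundary psi_exp H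
  proof
    show "psi_exp \<in> borel_measurable borel" by measurable
    show "psi_exp u \<ge> 0" for u by (simp add: psi_exp_def psi_nonneg)
    show "exp u * psi_exp u \<le> exp v * psi_exp v" if "0 \<le> u" "u \<le> v" for u v
    proof -
      have "exp x * psi_exp x = psi (nat \<lfloor>exp x\<rfloor>)" for x by (simp add: psi_exp_def exp_minus)
      thus ?thesis using that by (auto intro!: psi_mono nat_mono floor_mono)
    qed
    show "integrable lborel (\<lambda>u. indicator {0..} u * (psi_exp u * exp (- (s * u))))" if s: "s > 0" for s
    proof -
      have "integrable lborel (\<lambda>u. indicator {0..} u *\<^sub>R (of_real (psi_exp u) * exp (- (of_real s * of_real u))) :: complex)"
        using s by (intro integrable.intros[OF psi_exp_laplace]) auto
      also have "(\<lambda>u. indicator {0..} u *\<^sub>R (of_real (psi_exp u) * exp (- (of_real s * of_real u))) :: complex) =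
          (\<lambda>u. of_real (indicator {0..} u * (psi_exp u * exp (- (s * u)))))"
        by (auto simp: indicator_def exp_of_real[symmetric])
      finally show ?thesis by (simp only: complex_of_real_integrable_eq)
    qed
    show "(LBINT u. indicator {0..} u *\<^sub>R (of_real (psi_exp u - 1) * exp (- (z * of_real u)))) = H z" if z: "Re z > 0" for z
    proof -
      have "(LBINT u. indicator {0..} u *\<^sub>R (of_real (psi_exp u - 1) * exp (- (z * of_real u)))) =
        (LBINT u. indicator {0..} u *\<^sub>R (of_real (psi_exp u) * exp (- (z * of_real u))) - indicator {0..} u *\<^sub>R exp (- (z * of_real u)))"
        by (intro Bochner_Integration.integral_cong) (auto simp: algebra_simps)
      also have "\<dots> = mangoldt_series (1 + z) / (1 + z) - exp (- (z * of_real 0)) / z"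
        by (rule has_bochner_integral_integral_eq[OF has_bochner_integral_diff[OF psi_exp_laplace[OF z] complex_exp_tail[OF z]]])
      also have "\<dots> = H z"
      proof -
        have z0: "z \<noteq> 0" "1 + z \<noteq> 0" using z by (auto simp: complex_eq_iff)
        have eq: "deriv regzeta (1 + z) / regzeta (1 + z) = 1 / z - mangoldt_series (1 + z)"
          using regzeta_log_deriv[of "1 + z"] regzeta_nonzero[of "1 + z"] z by simp
        show ?thesis using z0 unfolding H_def eq by (simp add: divide_simps)
      qed
      finally show ?thesis .
    qed
    show "continuous_on {z. Re z \<ge> 0} H"
    proof -
      have "deriv regzeta holomorphic_on {s. Re s > 0}"
        by (intro holomorphic_deriv holomorphic_regzeta open_halfspace_Re_gt)
      hence c: "continuous_on {s. Re s > 0} (deriv regzeta)" "continuous_on {s. Re s > 0} regzeta"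
        using holomorphic_regzeta by (auto intro: holomorphic_on_imp_continuous_on)
      have "regzeta (1 + z) \<noteq> 0 \<and> 1 + z \<noteq> 0" if "Re z \<ge> 0" for z
        using that regzeta_nonzero[of "1 + z"] by (auto simp: complex_eq_iff)
      thus ?thesis unfolding H_def
        by (intro continuous_intros continuous_on_compose2[OF c(1)] continuous_on_compose2[OF c(2)]) auto
    qed
  qed
  show ?thesis by (rule f_tendsto_1)
qed

lemma psi_asymp: "(\<lambda>N. psi N / real N) \<longlonglongrightarrow> 1"
proof -
  have "filterlim (\<lambda>N. ln (real N)) at_top sequentially" by real_asymp
  from filterlim_compose[OF psi_exp_tendsto this]
  show ?thesis
  proof (rule Lim_transform_eventually)
    show "eventually (\<lambda>N. psi_exp (ln (real N)) = psi N / real N) sequentially"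
      using eventually_gt_at_top[of 0] by eventually_elim (simp add: psi_exp_def exp_minus inverse_eq_divide)
  qed
qed

section \<open>Partial sums by Stolz-Cesaro\<close>

lemma abs_diff_mult_eq: "D > 0 \<Longrightarrow> \<bar>x - l * D\<bar> = \<bar>x / D - l\<bar> * D" for D :: real
proof -
  assume "D > 0"
  hence "x - l * D = (x / D - l) * D" by (simp add: left_diff_distrib)
  thus ?thesis using \<open>D > 0\<close> by (simp add: abs_mult)
qed

text \<open>The errors of the increments telescope to at most r / 2 times the growth of b, and the
  error at the starting index is absorbed because b tends to infinity. Growth of b is asked for only
  eventually, as the iterated logarithms used below misbehave at small arguments.\<close>

lemma stolz_cesaro:
  fixes a b :: "nat \<Rightarrow> real"
  assumes mono: "eventually (\<lambda>n. b n < b (Suc n)) sequentially"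
    and lim: "filterlim b at_top sequentially"
    and ratio: "(\<lambda>n. (a (Suc n) - a n) / (b (Suc n) - b n)) \<longlonglongrightarrow> l"
  shows "(\<lambda>n. a n / b n) \<longlonglongrightarrow> l"
proof (rule LIMSEQ_I)
  fix r :: real assume r: "r > 0"
  have "eventually (\<lambda>n. b n < b (Suc n) \<and> 0 \<le> b n \<and>
          dist ((a (Suc n) - a n) / (b (Suc n) - b n)) l < r / 2) sequentially"
    using mono filterlim_at_top[THEN iffD1, OF lim, rule_format, of 0] tendstoD[OF ratio, of "r / 2"] r
    by (auto intro: eventually_conj)
  then obtain n0 where n0: "\<And>n. n \<ge> n0 \<Longrightarrow> b n < b (Suc n)" "\<And>n. n \<ge> n0 \<Longrightarrow> 0 \<le> b n"
    "\<And>n. n \<ge> n0 \<Longrightarrow> \<bar>(a (Suc n) - a n) / (b (Suc n) - b n) - l\<bar> < r / 2"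
    by (auto simp: eventually_sequentially dist_real_def)
  have step: "\<bar>(a (Suc n) - a n) - l * (b (Suc n) - b n)\<bar> \<le> r / 2 * (b (Suc n) - b n)" if n: "n \<ge> n0" for n
  proof -
    have pos: "b (Suc n) - b n > 0" using n0(1)[OF n] by simp
    have "\<bar>(a (Suc n) - a n) - l * (b (Suc n) - b n)\<bar> =
        \<bar>(a (Suc n) - a n) / (b (Suc n) - b n) - l\<bar> * (b (Suc n) - b n)"
      using pos by (rule abs_diff_mult_eq)
    also have "\<dots> \<le> r / 2 * (b (Suc n) - b n)"
      using n0(3)[OF n] pos by (intro mult_right_mono) auto
    finally show ?thesis .
  qed
  have tele: "\<bar>(a n - a n0) - l * (b n - b n0)\<bar> \<le> r / 2 * (b n - b n0)" if "n \<ge> n0" for n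
    using that
  proof (induction n rule: dec_induct)
    case (step n)
    have "(a (Suc n) - a n0) - l * (b (Suc n) - b n0) =
       ((a n - a n0) - l * (b n - b n0)) + ((a (Suc n) - a n) - l * (b (Suc n) - b n))"
      by (simp add: algebra_simps)
    also have "\<bar>\<dots>\<bar> \<le> r / 2 * (b n - b n0) + r / 2 * (b (Suc n) - b n)"
      using step.IH \<open>\<And>n. n \<ge> n0 \<Longrightarrow> \<bar>(a (Suc n) - a n) - l * (b (Suc n) - b n)\<bar> \<le> r / 2 * (b (Suc n) - b n)\<close>[OF step.hyps(1)]
      by (intro order_trans[OF abs_triangle_ineq] add_mono)
    also have "\<dots> = r / 2 * (b (Suc n) - b n0)" unfolding right_diff_distrib by simp
    finally show ?case .
  qed auto
  define C where "C = \<bar>a n0 - l * b n0\<bar>"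
  have "eventually (\<lambda>n. b n > 2 * C / r + 1 \<and> n \<ge> n0) sequentially"
    using filterlim_at_top_dense[THEN iffD1, OF lim] by (auto intro: eventually_conj eventually_ge_at_top)
  hence "eventually (\<lambda>n. norm (a n / b n - l) < r) sequentially"
  proof eventually_elim
    case (elim n)
    have C0: "C \<ge> 0" by (simp add: C_def)
    hence "0 \<le> 2 * C / r" using r by simp
    hence bpos: "b n > 0" "b n > 2 * C / r" using elim by linarith+
    hence Cb: "C < r / 2 * b n" using r by (simp add: pos_divide_less_eq algebra_simps)
    have "a n - l * b n = ((a n - a n0) - l * (b n - b n0)) + (a n0 - l * b n0)" by (simp add: algebra_simps)
    also have "\<bar>\<dots>\<bar> \<le> r / 2 * (b n - b n0) + C"
      unfolding C_def using tele[of n] elim by (intro order_trans[OF abs_triangle_ineq] add_mono) auto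
    also have "\<dots> \<le> r / 2 * b n + C" using n0(2)[of n0] r by (simp add: algebra_simps)
    also have "\<dots> < r / 2 * b n + r / 2 * b n" using Cb by simp
    also have "\<dots> = r * b n" by simp
    finally have "\<bar>a n - l * b n\<bar> < r * b n" .
    moreover have "\<bar>a n / b n - l\<bar> * b n = \<bar>a n - l * b n\<bar>"
      using bpos(1) by (rule abs_diff_mult_eq[symmetric])
    ultimately show ?case using bpos by (metis mult_less_cancel_right_pos real_norm_def)
  qed
  thus "\<exists>no. \<forall>n\<ge>no. norm (a n / b n - l) < r" by (simp add: eventually_sequentially)
qed

section \<open>From the Chebyshev function to the counting of primes\<close>

definition primepi :: "nat \<Rightarrow> nat" where "primepi N = card {p. prime p \<and> p \<le> N}"

lemma finite_primes_le: "finite {p::nat. prime p \<and> p \<le> N}" "finite {p::nat. prime p \<and> odd p \<and> p \<le> N}"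
  by (rule finite_subset[of _ "{..N}"]; auto)+

text \<open>A prime p has at most ln N / ln p powers up to N, each of weight ln p, so it contributes
  at most ln N.\<close>

lemma psi_le_primepi: "psi N \<le> real (primepi N) * ln (real N)"
proof (cases "N = 0")
  case False
  define S where "S = {n. primepow n \<and> n \<le> N}"
  have fin: "finite S" by (rule finite_subset[of _ "{..N}"]) (auto simp: S_def)
  have sub: "aprimedivisor ` S \<subseteq> {p. prime p \<and> p \<le> N}"
  proof safe
    fix n assume "n \<in> S"
    hence n: "primepow n" "n \<le> N" by (auto simp: S_def)
    show "prime (aprimedivisor n)" using n(1) by (auto simp: primepow_def aprimedivisor_prime_power)
    show "aprimedivisor n \<le> N" using n aprimedivisor_le_nat[of n] primepow_gt_Suc_0[OF n(1)] by simp
  qed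
  have "psi N = (\<Sum>n\<in>S. mangoldt n)"
    unfolding psi_def S_def by (intro sum.mono_neutral_right) (auto simp: mangoldt_def)
  also have "\<dots> = (\<Sum>p\<in>aprimedivisor ` S. \<Sum>n\<in>{n\<in>S. aprimedivisor n = p}. mangoldt n)"
    by (rule sum.image_gen[OF fin])
  also have "\<dots> \<le> (\<Sum>p\<in>aprimedivisor ` S. ln (real N))"
  proof (rule sum_mono)
    fix p assume "p \<in> aprimedivisor ` S"
    hence p: "prime p" "p \<le> N" using sub by auto
    have p1: "p > 1" "ln (real p) > 0" using prime_gt_1_nat[OF p(1)] by auto
    define T where "T = {n\<in>S. aprimedivisor n = p}"
    have "T \<subseteq> (\<lambda>k. p ^ k) ` {1..nat \<lfloor>ln (real N) / ln (real p)\<rfloor>}"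
    proof
      fix n assume "n \<in> T"
      hence n: "primepow n" "n \<le> N" "aprimedivisor n = p" by (auto simp: T_def S_def)
      from n(1) obtain q k where k: "prime q" "k > 0" "n = q ^ k" by (auto simp: primepow_def)
      hence q: "q = p" using n(3) by (simp add: aprimedivisor_prime_power)
      have "real k * ln (real p) = ln (real n)" using k q p1 by (simp add: ln_realpow)
      also have "\<dots> \<le> ln (real N)" using n primepow_gt_Suc_0[OF n(1)] by simp
      finally have "real k \<le> ln (real N) / ln (real p)" using p1 by (simp add: pos_le_divide_eq)
      hence "k \<le> nat \<lfloor>ln (real N) / ln (real p)\<rfloor>" by (simp add: le_nat_iff le_floor_iff)
      thus "n \<in> (\<lambda>k. p ^ k) ` {1..nat \<lfloor>ln (real N) / ln (real p)\<rfloor>}" using k q by auto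
    qed
    hence "card T \<le> card ((\<lambda>k. p ^ k) ` {1..nat \<lfloor>ln (real N) / ln (real p)\<rfloor>})" by (intro card_mono) auto
    also have "\<dots> \<le> nat \<lfloor>ln (real N) / ln (real p)\<rfloor>" by (rule order_trans[OF card_image_le]) auto
    finally have "real (card T) \<le> ln (real N) / ln (real p)"
      using False p1 by (subst (asm) le_nat_iff) (auto simp: le_floor_iff)
    hence "real (card T) * ln (real p) \<le> ln (real N)" using p1 by (simp add: pos_le_divide_eq)
    moreover have "(\<Sum>n\<in>T. mangoldt n) = (\<Sum>n\<in>T. ln (real p))"
      by (intro sum.cong) (auto simp: T_def S_def mangoldt_def)
    ultimately show "(\<Sum>n\<in>{n\<in>S. aprimedivisor n = p}. mangoldt n) \<le> ln (real N)" by (simp add: T_def)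
  qed
  also have "\<dots> \<le> real (primepi N) * ln (real N)"
    using card_mono[OF finite_primes_le(1) sub] False by (simp add: primepi_def mult_right_mono)
  finally show ?thesis .
qed (simp add: psi_def)

text \<open>There are at most y primes up to y, and each larger one has weight above ln y in
  \<open>psi N\<close>.\<close>

lemma primepi_le_psi:
  assumes y: "y > 1" shows "real (primepi N) \<le> y + psi N / ln y"
proof -
  define A where "A = {p. prime p \<and> p \<le> N \<and> real p \<le> y}"
  define B where "B = {p. prime p \<and> p \<le> N \<and> real p > y}"
  have fin: "finite A" "finite B" by (rule finite_subset[of _ "{..N}"]; auto simp: A_def B_def)+
  have "{p. prime p \<and> p \<le> N} = A \<union> B" "A \<inter> B = {}" by (auto simp: A_def B_def)
  hence "real (primepi N) = real (card A) + real (card B)"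
    unfolding primepi_def using fin by (simp add: card_Un_disjoint)
  also have "real (card A) \<le> y"
  proof -
    have "A \<subseteq> {1..nat \<lfloor>y\<rfloor>}" by (auto simp: A_def le_nat_iff le_floor_iff prime_ge_1_nat Suc_le_eq prime_gt_0_nat)
    from card_mono[OF _ this] have "card A \<le> nat \<lfloor>y\<rfloor>" by simp
    thus ?thesis using y by (subst (asm) le_nat_iff) (auto simp: le_floor_iff)
  qed
  also have "real (card B) \<le> psi N / ln y"
  proof -
    have "real (card B) * ln y = (\<Sum>p\<in>B. ln y)" by simp
    also have "\<dots> \<le> (\<Sum>p\<in>B. mangoldt p)" using y by (intro sum_mono) (auto simp: B_def)
    also have "\<dots> \<le> psi N" unfolding psi_def by (intro sum_mono2) (auto simp: B_def mangoldt_nonneg)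
    finally show ?thesis using y by (simp add: pos_le_divide_eq)
  qed
  finally show ?thesis by simp
qed

theorem prime_number_theorem: "(\<lambda>N. real (primepi N) * ln (real N) / real N) \<longlonglongrightarrow> 1"
proof (rule real_tendsto_sandwich)
  show "(\<lambda>N. psi N / real N) \<longlonglongrightarrow> 1" by (rule psi_asymp)
  show "eventually (\<lambda>N. psi N / real N \<le> real (primepi N) * ln (real N) / real N) sequentially"
    by (intro always_eventually allI divide_right_mono psi_le_primepi) auto
  \<comment> \<open>Small enough to be negligible against N / ln N, yet large enough that ln y is
    asymptotic to ln N.\<close>
  define y where "y = (\<lambda>N::nat. real N / ln (real N) ^ 2)"
  have "(\<lambda>N. y N * ln (real N) / real N + psi N / real N * (ln (real N) / ln (y N))) \<longlonglongrightarrow> 0 + 1 * 1"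
  proof (intro tendsto_add tendsto_mult psi_asymp)
    show "(\<lambda>N. y N * ln (real N) / real N) \<longlonglongrightarrow> 0" unfolding y_def by real_asymp
    show "(\<lambda>N. ln (real N) / ln (y N)) \<longlonglongrightarrow> 1" unfolding y_def by real_asymp
  qed
  thus "(\<lambda>N. y N * ln (real N) / real N + psi N / real N * (ln (real N) / ln (y N))) \<longlonglongrightarrow> 1" by simp
  have "eventually (\<lambda>N. y N > 1) sequentially" unfolding y_def by real_asymp
  thus "eventually (\<lambda>N. real (primepi N) * ln (real N) / real N \<le> y N * ln (real N) / real N + psi N / real N * (ln (real N) / ln (y N))) sequentially"
    using eventually_gt_at_top[of 1]
  proof eventually_elim
    case (elim N)
    have "real (primepi N) * (ln (real N) / real N) \<le> (y N + psi N / ln (y N)) * (ln (real N) / real N)"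
      using elim by (intro mult_right_mono primepi_le_psi) auto
    thus ?case by (simp add: algebra_simps)
  qed
qed

section \<open>Odd primes: summed counts and reciprocals\<close>

text \<open>In an even sum with an odd semiprime the prime is odd, so 2 is left out of the counts
  from here on.\<close>

definition oddpi :: "nat \<Rightarrow> nat" where "oddpi N = card {p. prime p \<and> odd p \<and> p \<le> N}"

lemma oddpi_0 [simp]: "oddpi 0 = 0"
  by (auto simp: oddpi_def prime_gt_0_nat)

lemma oddpi_Suc: "oddpi (Suc N) = oddpi N + (if prime (Suc N) \<and> odd (Suc N) then 1 else 0)"
proof -
  have "{p. prime p \<and> odd p \<and> p \<le> Suc N} =
     (if prime (Suc N) \<and> odd (Suc N) then insert (Suc N) {p. prime p \<and> odd p \<and> p \<le> N} else {p. prime p \<and> odd p \<and> p \<le> N})"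
    by (auto simp: le_Suc_eq)
  thus ?thesis using finite_primes_le(2)[of N] by (simp add: oddpi_def)
qed

lemma primepi_eq_oddpi: "N \<ge> 2 \<Longrightarrow> primepi N = Suc (oddpi N)"
proof -
  assume N: "N \<ge> 2"
  have "{p. prime p \<and> p \<le> N} = insert 2 {p. prime p \<and> odd p \<and> p \<le> N}"
    using N prime_odd_nat by (auto simp: prime_nat_iff) (metis One_nat_def even_numeral primes_dvd_imp_eq two_is_prime_nat prime_nat_iff)
  thus ?thesis using finite_primes_le(2)[of N] by (simp add: primepi_def oddpi_def)
qed

lemma oddpi_asymp: "(\<lambda>N. real (oddpi N) * ln (real N) / real N) \<longlonglongrightarrow> 1"
proof -
  have "(\<lambda>N. real (primepi N) * ln (real N) / real N - ln (real N) / real N) \<longlonglongrightarrow> 1 - 0"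
    by (intro tendsto_diff prime_number_theorem) real_asymp
  hence "(\<lambda>N. real (primepi N) * ln (real N) / real N - ln (real N) / real N) \<longlonglongrightarrow> 1" by simp
  thus ?thesis
  proof (rule Lim_transform_eventually)
    show "eventually (\<lambda>N. real (primepi N) * ln (real N) / real N - ln (real N) / real N = real (oddpi N) * ln (real N) / real N) sequentially"
      using eventually_ge_at_top[of 2]
      by eventually_elim (simp add: primepi_eq_oddpi diff_divide_distrib[symmetric] algebra_simps)
  qed
qed

text \<open>The increments of N^2 / (2 ln N) are asymptotic to N / ln N, the size of
  \<open>oddpi N\<close>.\<close>

lemma sum_oddpi_asymp: "(\<lambda>N. (\<Sum>n<N. real (oddpi n)) / (real N ^ 2 / (2 * ln (real N)))) \<longlonglongrightarrow> 1"
proof (rule stolz_cesaro)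
  show "eventually (\<lambda>N. real N ^ 2 / (2 * ln (real N)) < real (Suc N) ^ 2 / (2 * ln (real (Suc N)))) sequentially"
    by real_asymp
  show "filterlim (\<lambda>N. real N ^ 2 / (2 * ln (real N))) at_top sequentially" by real_asymp
  have "(\<lambda>N. real (oddpi N) * ln (real N) / real N * 
     (real N / ln (real N) / (real (Suc N) ^ 2 / (2 * ln (real (Suc N))) - real N ^ 2 / (2 * ln (real N))))) \<longlonglongrightarrow> 1 * 1"
    by (intro tendsto_mult oddpi_asymp) real_asymp
  hence "(\<lambda>N. real (oddpi N) * ln (real N) / real N * 
     (real N / ln (real N) / (real (Suc N) ^ 2 / (2 * ln (real (Suc N))) - real N ^ 2 / (2 * ln (real N))))) \<longlonglongrightarrow> 1" by simp
  thus "(\<lambda>N. ((\<Sum>n<Suc N. real (oddpi n)) - (\<Sum>n<N. real (oddpi n))) /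
      (real (Suc N) ^ 2 / (2 * ln (real (Suc N))) - real N ^ 2 / (2 * ln (real N)))) \<longlonglongrightarrow> 1"
  proof (rule Lim_transform_eventually)
    show "eventually (\<lambda>N. real (oddpi N) * ln (real N) / real N * 
     (real N / ln (real N) / (real (Suc N) ^ 2 / (2 * ln (real (Suc N))) - real N ^ 2 / (2 * ln (real N)))) =
     ((\<Sum>n<Suc N. real (oddpi n)) - (\<Sum>n<N. real (oddpi n))) /
      (real (Suc N) ^ 2 / (2 * ln (real (Suc N))) - real N ^ 2 / (2 * ln (real N)))) sequentially"
      using eventually_ge_at_top[of 2] by eventually_elim simp
  qed
qed

definition oddrecip :: "nat \<Rightarrow> real" where "oddrecip N = (\<Sum>p | prime p \<and> odd p \<and> p \<le> N. 1 / real p)"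

text \<open>Summation by parts, with 1 / n - 1 / (n + 1) = 1 / (n (n + 1)).\<close>

lemma oddrecip_conv: "oddrecip N = real (oddpi N) / real N + (\<Sum>n<N. real (oddpi n) / (real n * real (Suc n)))"
proof (induction N)
  case 0
  show ?case by (simp add: oddrecip_def)
next
  case (Suc N)
  have "{p. prime p \<and> odd p \<and> p \<le> Suc N} =
     (if prime (Suc N) \<and> odd (Suc N) then insert (Suc N) {p. prime p \<and> odd p \<and> p \<le> N} else {p. prime p \<and> odd p \<and> p \<le> N})"
    by (auto simp: le_Suc_eq)
  hence 1: "oddrecip (Suc N) = oddrecip N + (if prime (Suc N) \<and> odd (Suc N) then 1 / real (Suc N) else 0)"
    using finite_primes_le(2)[of N] by (simp add: oddrecip_def del: of_nat_Suc)
  have "real (oddpi (Suc N)) / real (Suc N) = real (oddpi N) / real (Suc N) + (if prime (Suc N) \<and> odd (Suc N) then 1 / real (Suc N) else 0)"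
    by (simp add: oddpi_Suc add_divide_distrib del: of_nat_Suc)
  moreover have "real (oddpi N) / real N = real (oddpi N) / real (Suc N) + real (oddpi N) / (real N * real (Suc N))"
  proof (cases "N = 0")
    case False
    thus ?thesis by (simp add: divide_simps) (simp add: algebra_simps)
  qed simp
  ultimately show ?case unfolding 1 Suc.IH by simp
qed

text \<open>Mertens' theorem to leading order. After summation by parts the terms are asymptotic to
  1 / (n ln n), hence to the increments of ln ln n, and the boundary term tends to 0.\<close>

lemma oddrecip_asymp: "(\<lambda>N. oddrecip N / ln (ln (real N))) \<longlonglongrightarrow> 1"
proof -
  have "(\<lambda>N. (\<Sum>n<N. real (oddpi n) / (real n * real (Suc n))) / ln (ln (real N))) \<longlonglongrightarrow> 1"
  proof (rule stolz_cesaro)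
    show "eventually (\<lambda>N. ln (ln (real N)) < ln (ln (real (Suc N)))) sequentially" by real_asymp
    show "filterlim (\<lambda>N. ln (ln (real N))) at_top sequentially" by real_asymp
    have "(\<lambda>N. real (oddpi N) * ln (real N) / real N * 
       (1 / (ln (real N) * real (Suc N)) / (ln (ln (real (Suc N))) - ln (ln (real N))))) \<longlonglongrightarrow> 1 * 1"
      by (intro tendsto_mult oddpi_asymp) real_asymp
    hence "(\<lambda>N. real (oddpi N) * ln (real N) / real N * 
       (1 / (ln (real N) * real (Suc N)) / (ln (ln (real (Suc N))) - ln (ln (real N))))) \<longlonglongrightarrow> 1" by simp
    thus "(\<lambda>N. ((\<Sum>n<Suc N. real (oddpi n) / (real n * real (Suc n))) - (\<Sum>n<N. real (oddpi n) / (real n * real (Suc n)))) /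
      (ln (ln (real (Suc N))) - ln (ln (real N)))) \<longlonglongrightarrow> 1"
    proof (rule Lim_transform_eventually)
      show "eventually (\<lambda>N. real (oddpi N) * ln (real N) / real N * 
       (1 / (ln (real N) * real (Suc N)) / (ln (ln (real (Suc N))) - ln (ln (real N)))) =
       ((\<Sum>n<Suc N. real (oddpi n) / (real n * real (Suc n))) - (\<Sum>n<N. real (oddpi n) / (real n * real (Suc n)))) /
      (ln (ln (real (Suc N))) - ln (ln (real N)))) sequentially"
        using eventually_ge_at_top[of 2] by eventually_elim simp
    qed
  qed
  moreover have "(\<lambda>N. real (oddpi N) * ln (real N) / real N * (1 / (ln (real N) * ln (ln (real N))))) \<longlonglongrightarrow> 1 * 0"
    by (intro tendsto_mult oddpi_asymp) real_asymp
  ultimately have "(\<lambda>N. real (oddpi N) * ln (real N) / real N * (1 / (ln (real N) * ln (ln (real N)))) +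
     (\<Sum>n<N. real (oddpi n) / (real n * real (Suc n))) / ln (ln (real N))) \<longlonglongrightarrow> 1 * 0 + 1"
    by (intro tendsto_add)
  hence "(\<lambda>N. real (oddpi N) * ln (real N) / real N * (1 / (ln (real N) * ln (ln (real N)))) +
     (\<Sum>n<N. real (oddpi n) / (real n * real (Suc n))) / ln (ln (real N))) \<longlonglongrightarrow> 1" by simp
  thus ?thesis
  proof (rule Lim_transform_eventually)
    show "eventually (\<lambda>N. real (oddpi N) * ln (real N) / real N * (1 / (ln (real N) * ln (ln (real N)))) +
     (\<Sum>n<N. real (oddpi n) / (real n * real (Suc n))) / ln (ln (real N)) = oddrecip N / ln (ln (real N))) sequentially"
      using eventually_ge_at_top[of 2] by eventually_elim (simp add: oddrecip_conv add_divide_distrib)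
  qed
qed

text \<open>Since ln ln (N^a) = ln ln N + ln a, cutting the sum of reciprocals at any fixed power of
  N leaves its leading term unchanged.\<close>

lemma oddrecip_powr_asymp:
  assumes "a > 0"
  shows "(\<lambda>N. oddrecip (nat \<lfloor>real N powr a\<rfloor>) / ln (ln (real N))) \<longlonglongrightarrow> 1"
proof -
  have "filterlim (\<lambda>N::nat. nat \<lfloor>real N powr a\<rfloor>) sequentially sequentially" 
    using assms by real_asymp
  from filterlim_compose[OF oddrecip_asymp this]
  have "(\<lambda>N. oddrecip (nat \<lfloor>real N powr a\<rfloor>) / ln (ln (real (nat \<lfloor>real N powr a\<rfloor>))) *
     (ln (ln (real (nat \<lfloor>real N powr a\<rfloor>))) / ln (ln (real N)))) \<longlonglongrightarrow> 1 * 1"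
    by (intro tendsto_mult) (assumption, use assms in real_asymp)
  moreover have "filterlim (\<lambda>N::nat. ln (ln (real (nat \<lfloor>real N powr a\<rfloor>)))) at_top sequentially"
    using assms by real_asymp
  hence "eventually (\<lambda>N::nat. ln (ln (real (nat \<lfloor>real N powr a\<rfloor>))) > 0) sequentially"
    by (simp add: filterlim_at_top_dense)
  ultimately show ?thesis
    by (auto elim!: Lim_transform_eventually eventually_mono)
qed

subsection \<open>Semiprimes\<close>

definition semipi :: "nat \<Rightarrow> nat" where "semipi N = card {m. odd_semiprime m \<and> m \<le> N}"

lemma finite_semiprimes_le: "finite {m. odd_semiprime m \<and> m \<le> N}"
  by (rule finite_subset[of _ "{..N}"]) auto

lemma semipi_mono: "M \<le> N \<Longrightarrow> semipi M \<le> semipi N"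
  unfolding semipi_def by (intro card_mono finite_semiprimes_le) auto

definition lowprimes :: "nat \<Rightarrow> nat set" where "lowprimes y = {q. prime q \<and> odd q \<and> q * q \<le> y}"

lemma finite_lowprimes: "finite (lowprimes y)"
proof (rule finite_subset)
  show "lowprimes y \<subseteq> {..y}"
  proof
    fix q assume "q \<in> lowprimes y"
    hence "q * q \<le> y" "q > 0" by (auto simp: lowprimes_def prime_gt_0_nat)
    moreover have "q * 1 \<le> q * q" using \<open>q > 0\<close> by (intro mult_le_mono) auto
    ultimately have "q \<le> y" by linarith
    thus "q \<in> {..y}" by simp
  qed
qed auto

text \<open>Ordering the two prime factors as q \<le> r makes the factorisation unique, and then q *
  q \<le> q * r \<le> y.\<close>

lemma semipi_eq_sum:
  "semipi y = (\<Sum>q\<in>lowprimes y. card {r. prime r \<and> odd r \<and> q \<le> r \<and> q * r \<le> y})"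
proof -
  define R where "R = (\<lambda>q. {r. prime r \<and> odd r \<and> q \<le> r \<and> q * r \<le> y})"
  have finR: "finite (R q)" if "q \<in> lowprimes y" for q
  proof (rule finite_subset)
    have "q > 0" using that by (auto simp: lowprimes_def prime_gt_0_nat)
    hence "r \<le> q * r" for r by simp
    thus "R q \<subseteq> {..y}" unfolding R_def using order_trans by blast
  qed auto
  have "bij_betw (\<lambda>(q, r). q * r) (SIGMA q:lowprimes y. R q) {m. odd_semiprime m \<and> m \<le> y}"
    unfolding bij_betw_def
  proof
    show "inj_on (\<lambda>(q, r). q * r) (SIGMA q:lowprimes y. R q)"
    proof (rule inj_onI, clarify)
      fix q r q' r'
      assume "q \<in> lowprimes y" "q' \<in> lowprimes y" "r \<in> R q" "r' \<in> R q'" and eq: "q * r = q' * r'"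
      hence p: "prime q" "prime q'" "prime r" "prime r'" "q \<le> r" "q' \<le> r'"
        by (auto simp: lowprimes_def R_def)
      have "q dvd q' * r'" using eq by (metis dvd_triv_left)
      hence "q = q' \<or> q = r'" using p prime_dvd_mult_iff primes_dvd_imp_eq by metis
      moreover have "q' dvd q * r" using eq by (metis dvd_triv_left)
      hence "q' = q \<or> q' = r" using p prime_dvd_mult_iff primes_dvd_imp_eq by metis
      ultimately have "q = q'" using p by auto
      thus "q = q' \<and> r = r'" using eq p prime_gt_0_nat by auto
    qed
    show "(\<lambda>(q, r). q * r) ` (SIGMA q:lowprimes y. R q) = {m. odd_semiprime m \<and> m \<le> y}"
    proof (intro equalityI subsetI)
      fix m assume "m \<in> (\<lambda>(q, r). q * r) ` (SIGMA q:lowprimes y. R q)"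
      thus "m \<in> {m. odd_semiprime m \<and> m \<le> y}" by (auto simp: lowprimes_def R_def odd_semiprime_def)
    next
      fix m assume "m \<in> {m. odd_semiprime m \<and> m \<le> y}"
      then obtain q0 r0 where "prime q0" "prime r0" "odd q0" "odd r0" "m = q0 * r0" "m \<le> y"
        by (auto simp: odd_semiprime_def)
      then obtain q r where qr: "prime q" "prime r" "odd q" "odd r" "m = q * r" "m \<le> y" "q \<le> r"
        by (metis linear mult.commute)
      have "q * q \<le> q * r" using qr by simp
      hence "q * q \<le> y" using qr by linarith
      hence "q \<in> lowprimes y" "r \<in> R q" using qr by (auto simp: lowprimes_def R_def)
      thus "m \<in> (\<lambda>(q, r). q * r) ` (SIGMA q:lowprimes y. R q)" using qr by force
    qed
  qed
  from bij_betw_same_card[OF this] show ?thesis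
    unfolding semipi_def using finite_lowprimes finR by (simp add: R_def card_SigmaI)
qed

text \<open>The integer square root, written as a power so that \<open>oddrecip_powr_asymp\<close>
  applies to it.\<close>

definition nroot :: "nat \<Rightarrow> nat" where "nroot y = nat \<lfloor>real y powr (1/2)\<rfloor>"

lemma lowprimes_eq: "lowprimes y = {q. prime q \<and> odd q \<and> q \<le> nroot y}"
proof -
  have "q * q \<le> y \<longleftrightarrow> q \<le> nroot y" for q :: nat
  proof -
    have "q \<le> nroot y \<longleftrightarrow> real q \<le> sqrt (real y)"
      by (simp add: nroot_def le_nat_iff le_floor_iff powr_half_sqrt)
    also have "\<dots> \<longleftrightarrow> real q ^ 2 \<le> real y"
      using real_sqrt_le_iff[of "real q ^ 2" "real y"] by simp
    also have "\<dots> \<longleftrightarrow> real (q * q) \<le> real y" by (simp add: power2_eq_square)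
    finally show ?thesis by (simp only: of_nat_le_iff)
  qed
  thus ?thesis by (simp add: lowprimes_def)
qed

text \<open>Dropping the condition q \<le> r overcounts by at most \<open>oddpi (nroot y)\<close>
  for each q. The total error is a square of order y / (ln y)^2, below the main term.\<close>

lemma semipi_bounds:
  shows "real (semipi y) \<le> (\<Sum>q\<in>lowprimes y. real (oddpi (y div q)))"
    and "real (semipi y) \<ge> (\<Sum>q\<in>lowprimes y. real (oddpi (y div q))) - real (oddpi (nroot y)) ^ 2"
proof -
  define R where "R = (\<lambda>q. {r. prime r \<and> odd r \<and> q \<le> r \<and> q * r \<le> y})"
  have div: "q * r \<le> y \<longleftrightarrow> r \<le> y div q" if "q \<in> lowprimes y" for q r
    using that by (auto simp: lowprimes_def less_eq_div_iff_mult_less_eq prime_gt_0_nat mult.commute)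
  have S: "real (semipi y) = (\<Sum>q\<in>lowprimes y. real (card (R q)))"
    unfolding semipi_eq_sum R_def by simp
  have "real (card (R q)) \<le> real (oddpi (y div q))" if "q \<in> lowprimes y" for q
    unfolding oddpi_def of_nat_le_iff
    by (intro card_mono finite_primes_le) (auto simp: R_def div[OF that])
  thus "real (semipi y) \<le> (\<Sum>q\<in>lowprimes y. real (oddpi (y div q)))"
    unfolding S by (intro sum_mono)
  have "real (oddpi (y div q)) - real (oddpi (nroot y)) \<le> real (card (R q))" if "q \<in> lowprimes y" for q
  proof -
    have fin: "finite (R q)" by (rule finite_subset[OF _ finite_primes_le(2)[of "y div q"]]) (auto simp: R_def div[OF that])
    have "{r. prime r \<and> odd r \<and> r \<le> y div q} \<subseteq> R q \<union> {r. prime r \<and> odd r \<and> r \<le> nroot y}"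
      using that by (auto simp: R_def div[OF that] lowprimes_eq)
    hence "oddpi (y div q) \<le> card (R q \<union> {r. prime r \<and> odd r \<and> r \<le> nroot y})"
      unfolding oddpi_def using fin finite_primes_le by (intro card_mono) auto
    also have "\<dots> \<le> card (R q) + oddpi (nroot y)" unfolding oddpi_def by (rule card_Un_le)
    finally show ?thesis by linarith
  qed
  hence "(\<Sum>q\<in>lowprimes y. real (oddpi (y div q)) - real (oddpi (nroot y))) \<le> real (semipi y)"
    unfolding S by (intro sum_mono)
  moreover have "(\<Sum>q\<in>lowprimes y. real (oddpi (nroot y))) = real (oddpi (nroot y)) ^ 2"
    by (simp add: lowprimes_eq oddpi_def power2_eq_square)
  ultimately show "real (semipi y) \<ge> (\<Sum>q\<in>lowprimes y. real (oddpi (y div q))) - real (oddpi (nroot y)) ^ 2"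
    by (simp add: sum_subtractf)
qed

text \<open>Beyond the cost of the integer division, the last claim is the point: all arguments
  \<open>y div q\<close> are at least \<open>nroot y\<close>, so the prime number theorem applies to
  all of them at once.\<close>

lemma lowprimes_quotient:
  assumes "q \<in> lowprimes y"
  shows "real (y div q) \<le> real y / real q" "real y / real q - 1 \<le> real (y div q)"
    and "real y / real q \<le> 2 * real (y div q)" "nroot y \<le> y div q"
proof -
  have q: "q > 0" "q * q \<le> y" "q \<le> nroot y" using assms by (auto simp: lowprimes_def prime_gt_0_nat) (use assms lowprimes_eq in auto)
  show 1: "real (y div q) \<le> real y / real q" by (simp add: of_nat_div_le_of_nat)
  have "y = q * (y div q) + y mod q" by simp
  hence "real y = real q * real (y div q) + real (y mod q)" by (metis of_nat_add of_nat_mult)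
  moreover have "real (y mod q) \<le> real q" using q by (simp add: less_imp_le)
  ultimately show 2: "real y / real q - 1 \<le> real (y div q)" using q by (simp add: field_simps)
  have "y div q \<ge> q" using q by (simp add: less_eq_div_iff_mult_less_eq)
  hence "real (y div q) \<ge> 1" using q by linarith
  thus "real y / real q \<le> 2 * real (y div q)" using 2 by linarith
  have "real (nroot y) \<le> sqrt (real y)" by (simp add: nroot_def powr_half_sqrt of_nat_floor)
  hence n: "real (nroot y) ^ 2 \<le> real y" by (metis of_nat_0_le_iff power_mono real_sqrt_pow2)
  hence "nroot y * nroot y \<le> y" by (metis of_nat_le_iff of_nat_mult power2_eq_square)
  hence "nroot y * q \<le> y" using q by (meson le_trans mult_le_mono2)
  thus "nroot y \<le> y div q" using q by (simp add: less_eq_div_iff_mult_less_eq)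
qed

lemma filterlim_nroot: "filterlim nroot sequentially sequentially"
  unfolding nroot_def by real_asymp

lemma sum_lowprimes_recip: "(\<Sum>q\<in>lowprimes y. 1 / real q) = oddrecip (nroot y)"
  unfolding lowprimes_eq oddrecip_def ..

lemma card_lowprimes: "card (lowprimes y) = oddpi (nroot y)"
  unfolding lowprimes_eq oddpi_def ..

section \<open>Asymptotics of the semiprime count\<close>

text \<open>Rewrites the bound of \<open>semipi_upper\<close>, divided by the main term, in
  quotients with known limits. \<open>Y\<close>, \<open>M\<close>, \<open>W\<close> stand for y, ln
  ln y, ln y; \<open>R\<close> and \<open>S\<close> for the sums of reciprocals up to y^a and up to
  sqrt y.\<close>

lemma semipi_upper_algebra:
  fixes Y M W A B R S e :: real
  assumes "Y \<noteq> 0" "M \<noteq> 0" "W \<noteq> 0"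
  shows "(1 + e) * Y * (R / A + (S - R) / B) / (Y * (M / W)) = (1 + e) * (R / M * (W / A) + (S / M - R / M) * (W / B))"
proof -
  have "(1 + e) * Y * (R / A + (S - R) / B) / (Y * (M / W)) = (1 + e) * ((R / A + (S - R) / B) * (W / M))"
    using assms by simp
  also have "(R / A + (S - R) / B) * (W / M) = R / M * (W / A) + (S / M - R / M) * (W / B)"
    by (simp add: divide_inverse algebra_simps)
  finally show ?thesis .
qed
text \<open>The counterpart for \<open>semipi_lower\<close>; here \<open>N\<close> and
  \<open>P\<close> are the integer root of y and its logarithm, and \<open>Q\<close> is the number
  of odd primes up to that root.\<close>

lemma semipi_lower_algebra:
  fixes Y M W N P R Q e :: real
  assumes "Y \<noteq> 0" "M \<noteq> 0" "W \<noteq> 0" "N \<noteq> 0" "P \<noteq> 0"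
  shows "(1-e)*(R/M - (Q*P/N)*(N/P/(Y*M))) - (Q*P/N)^2*((N/P)^2*W/(Y*M)) = ((1-e)*(Y*R - Q)/W - Q^2)/(Y*(M/W))"
proof -
  have "(Q*P/N)*(N/P/(Y*M)) = Q / (Y * M)" using assms by simp
  moreover have "(Q*P/N)^2*((N/P)^2*W/(Y*M)) = Q^2 * W / (Y * M)"
    using assms by (simp add: power_mult_distrib power_divide)
  moreover have "((1-e)*(Y*R - Q)/W - Q^2)/(Y*(M/W)) = (1-e)*(R/M - Q/(Y*M)) - Q^2 * W / (Y * M)"
    using assms by (simp add: divide_simps)
  ultimately show ?thesis by simp
qed

text \<open>For q up to y^a the logarithm of y / q is at least (1 - a) ln y. For the remaining q
  only 1/2 ln y is guaranteed, but their reciprocals add up to little. The ln 2 pays for replacing y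
  / q by \<open>y div q\<close>.\<close>

lemma semipi_upper:
  fixes e a :: real
  assumes e: "e > 0" and a: "0 < a" "a < 1/2"
  defines "t \<equiv> \<lambda>y::nat. nat \<lfloor>real y powr a\<rfloor>"
  shows "eventually (\<lambda>y. real (semipi y) \<le> (1 + e) * real y *
     (oddrecip (t y) / ((1 - a) * ln (real y) - ln 2) + (oddrecip (nroot y) - oddrecip (t y)) / (1/2 * ln (real y) - ln 2))) sequentially"
proof -
  have "eventually (\<lambda>n. real (oddpi n) * ln (real n) / real n < 1 + e) sequentially"
    using order_tendstoD(2)[OF oddpi_asymp, of "1 + e"] e by simp
  hence "eventually (\<lambda>n. real (oddpi n) \<le> (1 + e) * (real n / ln (real n))) sequentially"
    using eventually_gt_at_top[of 1] by eventually_elim (simp add: field_simps)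
  then obtain N0 where N0: "\<And>n. n \<ge> N0 \<Longrightarrow> real (oddpi n) \<le> (1 + e) * (real n / ln (real n))"
    by (auto simp: eventually_sequentially)
  have "eventually (\<lambda>y. nroot y \<ge> N0) sequentially"
    using filterlim_nroot by (simp add: filterlim_at_top)
  moreover have "eventually (\<lambda>y::nat. 1/2 * ln (real y) - ln 2 > 0) sequentially" by real_asymp
  moreover have "eventually (\<lambda>y::nat. real y powr a \<le> real y powr (1/2)) sequentially" using a by real_asymp
  ultimately show ?thesis using eventually_gt_at_top[of 1]
  proof eventually_elim
    case (elim y)
    define B where "B = (\<lambda>q. if q \<le> t y then 1 / real q / ((1 - a) * ln (real y) - ln 2) else 1 / real q / (1/2 * ln (real y) - ln 2))"
    have "(1 - a) * ln (real y) \<ge> 1/2 * ln (real y)" using a elim by (intro mult_right_mono) auto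
    hence d: "(1 - a) * ln (real y) - ln 2 > 0" "1/2 * ln (real y) - ln 2 > 0" using elim by linarith+
    have ty: "t y \<le> nroot y" unfolding t_def nroot_def using elim by (intro nat_mono floor_mono) auto
    have bound: "real (oddpi (y div q)) \<le> (1 + e) * real y * B q" if q: "q \<in> lowprimes y" for q
    proof -
      note lq = lowprimes_quotient[OF q]
      have q0: "q > 0" using q by (auto simp: lowprimes_def prime_gt_0_nat)
      define u where "u = (if q \<le> t y then (1 - a) * ln (real y) - ln 2 else 1/2 * ln (real y) - ln 2)"
      have u: "u > 0" using d by (simp add: u_def)
      have "ln (real q) \<le> (if q \<le> t y then a * ln (real y) else 1/2 * ln (real y))"
      proof (cases "q \<le> t y")
        case True
        hence "real q \<le> real y powr a" by (simp add: t_def le_nat_iff le_floor_iff)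
        hence "ln (real q) \<le> ln (real y powr a)" using q0 elim by (subst ln_le_cancel_iff) auto
        thus ?thesis using True elim by (simp add: ln_powr)
      next
        case False
        have "q \<le> nroot y" using q by (simp add: lowprimes_eq)
        hence "real q \<le> real y powr (1/2)" by (simp add: nroot_def le_nat_iff le_floor_iff)
        hence "ln (real q) \<le> ln (real y powr (1/2))" using q0 elim by (subst ln_le_cancel_iff) auto
        thus ?thesis using False elim by (simp add: ln_powr)
      qed
      hence "u \<le> ln (real y) - ln (real q) - ln 2" by (auto simp: u_def algebra_simps split: if_splits)
      also have "\<dots> = ln (real y / real q / 2)" using q0 elim by (simp add: ln_div ln_mult)
      also have "\<dots> \<le> ln (real (y div q))"
      proof -
        have "real y / real q / 2 > 0" using q0 elim by simp
        moreover have "real y / real q / 2 \<le> real (y div q)" using lq(3) by simp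
        ultimately show ?thesis by simp
      qed
      finally have ul: "u \<le> ln (real (y div q))" .
      have "real (oddpi (y div q)) \<le> (1 + e) * (real (y div q) / ln (real (y div q)))"
        using elim lq(4) by (intro N0) auto
      also have "\<dots> \<le> (1 + e) * ((real y / real q) / u)"
        using e u ul lq(1) by (intro mult_left_mono frac_le) auto
      also have "\<dots> = (1 + e) * real y * B q" by (simp add: B_def u_def)
      finally show ?thesis .
    qed
    have "real (semipi y) \<le> (\<Sum>q\<in>lowprimes y. real (oddpi (y div q)))" by (rule semipi_bounds)
    also have "\<dots> \<le> (\<Sum>q\<in>lowprimes y. (1 + e) * real y * B q)" by (intro sum_mono bound)
    also have "\<dots> = (1 + e) * real y * (\<Sum>q\<in>lowprimes y. B q)" by (simp add: sum_distrib_left)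
    also have "(\<Sum>q\<in>lowprimes y. B q) = oddrecip (t y) / ((1 - a) * ln (real y) - ln 2) + (oddrecip (nroot y) - oddrecip (t y)) / (1/2 * ln (real y) - ln 2)"
    proof -
      define A where "A = {q. prime q \<and> odd q \<and> q \<le> t y}"
      have A: "A \<subseteq> lowprimes y" using ty by (auto simp: A_def lowprimes_eq)
      have "(\<Sum>q\<in>lowprimes y. B q) = (\<Sum>q\<in>lowprimes y - A. B q) + (\<Sum>q\<in>A. B q)"
        by (rule sum.subset_diff[OF A finite_lowprimes])
      also have "(\<Sum>q\<in>A. B q) = (\<Sum>q\<in>A. 1 / real q / ((1 - a) * ln (real y) - ln 2))"
        by (intro sum.cong) (auto simp: A_def B_def)
      also have "\<dots> = oddrecip (t y) / ((1 - a) * ln (real y) - ln 2)"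
        unfolding sum_divide_distrib[symmetric] oddrecip_def A_def ..
      also have "(\<Sum>q\<in>lowprimes y - A. B q) = (\<Sum>q\<in>lowprimes y - A. 1 / real q / (1/2 * ln (real y) - ln 2))"
        by (intro sum.cong) (auto simp: A_def B_def lowprimes_eq)
      also have "\<dots> = (\<Sum>q\<in>lowprimes y - A. 1 / real q) / (1/2 * ln (real y) - ln 2)"
        by (rule sum_divide_distrib[symmetric])
      also have "(\<Sum>q\<in>lowprimes y - A. 1 / real q) = oddrecip (nroot y) - oddrecip (t y)"
        using A by (subst sum_diff) (auto simp: finite_lowprimes sum_lowprimes_recip, auto simp: A_def oddrecip_def)
      finally show ?thesis by simp
    qed
    finally show ?case .
  qed
qed

text \<open>Here ln (y div q) \<le> ln y is good enough for every q, so the range of q is not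
  split.\<close>

lemma semipi_lower:
  fixes e :: real
  assumes e: "0 < e" "e < 1"
  shows "eventually (\<lambda>y. real (semipi y) \<ge> (1 - e) * (real y * oddrecip (nroot y) - real (oddpi (nroot y))) / ln (real y)
     - real (oddpi (nroot y)) ^ 2) sequentially"
proof -
  have "eventually (\<lambda>n. real (oddpi n) * ln (real n) / real n > 1 - e) sequentially"
    using order_tendstoD(1)[OF oddpi_asymp, of "1 - e"] e by simp
  hence "eventually (\<lambda>n. real (oddpi n) \<ge> (1 - e) * (real n / ln (real n))) sequentially"
    using eventually_gt_at_top[of 1] by eventually_elim (simp add: field_simps)
  then obtain N0 where N0: "\<And>n. n \<ge> N0 \<Longrightarrow> real (oddpi n) \<ge> (1 - e) * (real n / ln (real n))"
    by (auto simp: eventually_sequentially)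
  have "eventually (\<lambda>y. nroot y \<ge> max N0 2) sequentially"
    using filterlim_nroot by (simp add: filterlim_at_top del: max.bounded_iff)
  thus ?thesis using eventually_gt_at_top[of 1]
  proof eventually_elim
    case (elim y)
    have bound: "real (oddpi (y div q)) \<ge> (1 - e) / ln (real y) * (real y * (1 / real q) - 1)" if q: "q \<in> lowprimes y" for q
    proof -
      note lq = lowprimes_quotient[OF q]
      have n: "y div q \<ge> 2" "y div q \<ge> N0" using elim lq(4) by auto
      have "(1 - e) / ln (real y) * (real y * (1 / real q) - 1) \<le> (1 - e) / ln (real y) * real (y div q)"
        using lq(2) e elim by (intro mult_left_mono) auto
      also have "\<dots> \<le> (1 - e) / ln (real (y div q)) * real (y div q)"
      proof (intro mult_right_mono divide_left_mono)
        show "ln (real (y div q)) \<le> ln (real y)" using n elim by (subst ln_le_cancel_iff) (auto simp: div_le_dividend)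
        show "0 < ln (real y) * ln (real (y div q))" using n elim by (intro mult_pos_pos ln_gt_zero) auto
      qed (use e in auto)
      also have "\<dots> \<le> real (oddpi (y div q))" using N0[OF n(2)] by simp
      finally show ?thesis .
    qed
    have "(\<Sum>q\<in>lowprimes y. (1 - e) / ln (real y) * (real y * (1 / real q) - 1)) \<le> (\<Sum>q\<in>lowprimes y. real (oddpi (y div q)))"
      by (intro sum_mono bound)
    also have "(\<Sum>q\<in>lowprimes y. (1 - e) / ln (real y) * (real y * (1 / real q) - 1)) =
       (1 - e) / ln (real y) * (real y * (\<Sum>q\<in>lowprimes y. 1 / real q) - real (card (lowprimes y)))"
      by (simp only: sum_distrib_left[symmetric] sum_subtractf) simp
    also have "\<dots> = (1 - e) * (real y * oddrecip (nroot y) - real (oddpi (nroot y))) / ln (real y)"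
      by (simp add: sum_lowprimes_recip card_lowprimes)
    finally show ?case using semipi_bounds(2)[of y] by linarith
  qed
qed

text \<open>The density of semiprimes near N. It varies slowly, so the value at N also serves at c N
  for fixed c > 0.\<close>

definition loglogdens :: "nat \<Rightarrow> real" where "loglogdens N = ln (ln (real N)) / ln (real N)"

lemma oddrecip_nroot_asymp: "(\<lambda>N. oddrecip (nroot N) / ln (ln (real N))) \<longlonglongrightarrow> 1"
  unfolding nroot_def by (rule oddrecip_powr_asymp) simp

theorem semipi_asymp: "(\<lambda>y. real (semipi y) / (real y * loglogdens y)) \<longlonglongrightarrow> 1"
proof (rule order_tendstoI)
  fix c :: real assume c: "c > 1"
  \<comment> \<open>With e = d - 1 and 1 - a = 1 / d the limit of the upper bound is (1 + e) / (1 -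
    a) = d^2, at most (1 + c) / 2 and so below c. The cap 3/2 keeps a below 1/2.\<close>
  define d where "d = min (sqrt ((1 + c) / 2)) (3 / 2)"
  have d1: "d > 1" "d < 2" using c by (auto simp: d_def)
  have "d ^ 2 \<le> sqrt ((1 + c) / 2) ^ 2" using d1 by (intro power_mono) (auto simp: d_def)
  hence dc: "d * d < c" using c by (simp add: power2_eq_square)
  define e where "e = d - 1"
  define a where "a = 1 - 1 / d"
  have e: "e > 0" and a: "0 < a" "a < 1/2" using d1 by (auto simp: e_def a_def field_simps)
  define t where "t = (\<lambda>y::nat. nat \<lfloor>real y powr a\<rfloor>)"
  define U where "U = (\<lambda>y. (1 + e) * (oddrecip (t y) / ln (ln (real y)) * (ln (real y) / ((1 - a) * ln (real y) - ln 2)) +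
     (oddrecip (nroot y) / ln (ln (real y)) - oddrecip (t y) / ln (ln (real y))) * (ln (real y) / (1/2 * ln (real y) - ln 2))))"
  \<comment> \<open>The primes between y^a and sqrt y enter with 1 - 1 = 0, which removes the lossy
    factor 2 of that range.\<close>
  have "U \<longlonglongrightarrow> (1 + e) * (1 * (1 / (1 - a)) + (1 - 1) * 2)"
    unfolding U_def
  proof (intro tendsto_mult tendsto_add tendsto_diff tendsto_const oddrecip_nroot_asymp)
    show "(\<lambda>y. oddrecip (t y) / ln (ln (real y))) \<longlonglongrightarrow> 1"
      unfolding t_def using a by (intro oddrecip_powr_asymp) auto
    thus "(\<lambda>y. oddrecip (t y) / ln (ln (real y))) \<longlonglongrightarrow> 1" .
    have "(\<lambda>y. ln (real y) / ((1 - a) * ln (real y) - ln 2)) \<longlonglongrightarrow> inverse (1 - a)" using a by real_asymp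
    thus "(\<lambda>y. ln (real y) / ((1 - a) * ln (real y) - ln 2)) \<longlonglongrightarrow> 1 / (1 - a)" by (simp add: inverse_eq_divide)
    show "(\<lambda>y. ln (real y) / (1/2 * ln (real y) - ln 2)) \<longlonglongrightarrow> 2" by real_asymp
  qed
  also have "(1 + e) * (1 * (1 / (1 - a)) + (1 - 1) * 2) = d * d" using d1 by (simp add: e_def a_def)
  finally have "eventually (\<lambda>y. U y < c) sequentially" using dc by (rule order_tendstoD(2))
  moreover have "eventually (\<lambda>y::nat. ln (ln (real y)) > 0) sequentially" by real_asymp
  ultimately show "eventually (\<lambda>y. real (semipi y) / (real y * loglogdens y) < c) sequentially"
    using semipi_upper[OF e a] eventually_gt_at_top[of 1]
  proof eventually_elim
    case (elim y)
    have pos: "real y * loglogdens y > 0" using elim by (simp add: loglogdens_def)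
    have "real (semipi y) / (real y * loglogdens y) \<le> ((1 + e) * real y *
       (oddrecip (t y) / ((1 - a) * ln (real y) - ln 2) + (oddrecip (nroot y) - oddrecip (t y)) / (1/2 * ln (real y) - ln 2))) / (real y * loglogdens y)"
      using elim(3) pos by (intro divide_right_mono) (auto simp: t_def)
    also have "\<dots> = U y" unfolding U_def loglogdens_def
      by (rule semipi_upper_algebra) (use elim in auto)
    finally show ?case using elim by linarith
  qed
next
  fix c :: real assume c: "c < 1"
  define e where "e = min (1/2) ((1 - c) / 2)"
  have e: "0 < e" "e < 1" "c < 1 - e" using c by (auto simp: e_def min_def field_simps)
  define V where "V = (\<lambda>y. (1 - e) * (oddrecip (nroot y) / ln (ln (real y)) -
       (real (oddpi (nroot y)) * ln (real (nroot y)) / real (nroot y)) * (real (nroot y) / ln (real (nroot y)) / (real y * ln (ln (real y))))) -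
     (real (oddpi (nroot y)) * ln (real (nroot y)) / real (nroot y)) ^ 2 * ((real (nroot y) / ln (real (nroot y)))^2 * ln (real y) / (real y * ln (ln (real y)))))"
  have al: "(\<lambda>y. real (oddpi (nroot y)) * ln (real (nroot y)) / real (nroot y)) \<longlonglongrightarrow> 1"
    by (rule filterlim_compose[OF oddpi_asymp filterlim_nroot])
  have "V \<longlonglongrightarrow> (1 - e) * (1 - 1 * 0) - 1 ^ 2 * 0"
    unfolding V_def
  proof (intro tendsto_mult tendsto_diff tendsto_power tendsto_const oddrecip_nroot_asymp al)
    show "(\<lambda>y. real (nroot y) / ln (real (nroot y)) / (real y * ln (ln (real y)))) \<longlonglongrightarrow> 0"
      unfolding nroot_def by real_asymp
    show "(\<lambda>y. (real (nroot y) / ln (real (nroot y)))^2 * ln (real y) / (real y * ln (ln (real y)))) \<longlonglongrightarrow> 0"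
      unfolding nroot_def by real_asymp
  qed
  hence "eventually (\<lambda>y. V y > c) sequentially" using e by (intro order_tendstoD(1)) auto
  moreover have "eventually (\<lambda>y::nat. ln (ln (real y)) > 0) sequentially" by real_asymp
  moreover have "eventually (\<lambda>y::nat. nroot y > 1) sequentially"
    using filterlim_at_top[THEN iffD1, OF filterlim_nroot, rule_format, of 2] by (auto elim: eventually_mono)
  ultimately show "eventually (\<lambda>y. c < real (semipi y) / (real y * loglogdens y)) sequentially"
    using semipi_lower[OF e(1,2)] eventually_gt_at_top[of 1]
  proof eventually_elim
    case (elim y)
    have pos: "real y * loglogdens y > 0" using elim by (simp add: loglogdens_def)
    have n: "real (nroot y) \<noteq> 0" "ln (real (nroot y)) \<noteq> 0" using elim by auto
    have "V y = ((1 - e) * (real y * oddrecip (nroot y) - real (oddpi (nroot y))) / ln (real y) - real (oddpi (nroot y)) ^ 2) / (real y * loglogdens y)"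
      unfolding V_def loglogdens_def by (rule semipi_lower_algebra) (use elim n in auto)
    also have "\<dots> \<le> real (semipi y) / (real y * loglogdens y)"
      using elim(4) pos by (intro divide_right_mono) auto
    finally show ?case using elim by linarith
  qed
qed

lemma semipi_0 [simp]: "semipi 0 = 0"
  by (auto simp: semipi_def odd_semiprime_def)

lemma eventually_loglogdens_pos: "eventually (\<lambda>N. loglogdens N > 0) sequentially"
  unfolding loglogdens_def by real_asymp

lemma semipi_scaled:
  assumes c: "c \<ge> 0"
  shows "(\<lambda>N. real (semipi (nat \<lfloor>c * real N\<rfloor>)) / (real N * loglogdens N)) \<longlonglongrightarrow> c"
proof (cases "c = 0")
  case False
  hence c: "c > 0" using c by simp
  have lim: "filterlim (\<lambda>N::nat. nat \<lfloor>c * real N\<rfloor>) sequentially sequentially"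
    using c by real_asymp
  have "(\<lambda>N. real (nat \<lfloor>c * real N\<rfloor>) * loglogdens (nat \<lfloor>c * real N\<rfloor>) / (real N * loglogdens N)) \<longlonglongrightarrow> c"
    unfolding loglogdens_def using c by real_asymp
  from tendsto_mult[OF filterlim_compose[OF semipi_asymp lim] this]
  have "(\<lambda>N. real (semipi (nat \<lfloor>c * real N\<rfloor>)) / (real (nat \<lfloor>c * real N\<rfloor>) * loglogdens (nat \<lfloor>c * real N\<rfloor>)) *
     (real (nat \<lfloor>c * real N\<rfloor>) * loglogdens (nat \<lfloor>c * real N\<rfloor>) / (real N * loglogdens N))) \<longlonglongrightarrow> c" by simp
  moreover have "filterlim (\<lambda>N. real (nat \<lfloor>c * real N\<rfloor>) * loglogdens (nat \<lfloor>c * real N\<rfloor>)) at_top sequentially"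
    unfolding loglogdens_def using c by real_asymp
  hence "eventually (\<lambda>N. real (nat \<lfloor>c * real N\<rfloor>) * loglogdens (nat \<lfloor>c * real N\<rfloor>) > 0) sequentially"
    by (simp add: filterlim_at_top_dense)
  hence "eventually (\<lambda>N. real (semipi (nat \<lfloor>c * real N\<rfloor>)) / (real (nat \<lfloor>c * real N\<rfloor>) * loglogdens (nat \<lfloor>c * real N\<rfloor>)) *
     (real (nat \<lfloor>c * real N\<rfloor>) * loglogdens (nat \<lfloor>c * real N\<rfloor>) / (real N * loglogdens N)) =
     real (semipi (nat \<lfloor>c * real N\<rfloor>)) / (real N * loglogdens N)) sequentially"
    by eventually_elim auto
  ultimately show ?thesis by (rule Lim_transform_eventually)
qed simp

text \<open>Pointwise convergence of monotone functions to a continuous limit is uniform.\<close>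

lemma semipi_uniform:
  assumes e: "e > 0"
  shows "eventually (\<lambda>N. \<forall>m\<le>N. \<bar>real (semipi m) - real m * loglogdens N\<bar> \<le> e * (real N * loglogdens N)) sequentially"
proof -
  \<comment> \<open>The grid of multiples of N / k costs 1 / k for the accuracy at the grid points
    and 1 / k for the distance to a neighbour, together 2 / k \<le> e.\<close>
  define k where "k = nat \<lceil>2 / e\<rceil>"
  have ke: "real k \<ge> 2 / e" unfolding k_def by linarith
  have "2 / e > 0" using e by simp
  hence k0: "real k > 0" using ke by linarith
  hence k: "k > 0" "2 / real k \<le> e" using e ke by (auto simp: pos_divide_le_eq mult.commute)
  define n where "n = (\<lambda>j N::nat. nat \<lfloor>real j / real k * real N\<rfloor>)"
  have "\<forall>j\<in>{..k}. eventually (\<lambda>N. \<bar>real (semipi (n j N)) / (real N * loglogdens N) - real j / real k\<bar> < 1 / real k) sequentially"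
  proof
    fix j
    have "1 / real k > 0" using k by simp
    from tendstoD[OF semipi_scaled[of "real j / real k"] this]
    show "eventually (\<lambda>N. \<bar>real (semipi (n j N)) / (real N * loglogdens N) - real j / real k\<bar> < 1 / real k) sequentially"
      by (simp add: n_def dist_real_def)
  qed
  hence "eventually (\<lambda>N. \<forall>j\<in>{..k}. \<bar>real (semipi (n j N)) / (real N * loglogdens N) - real j / real k\<bar> < 1 / real k) sequentially"
    by (intro eventually_ball_finite) auto
  thus ?thesis using eventually_loglogdens_pos eventually_gt_at_top[of 0]
  proof eventually_elim
    case (elim N)
    define W where "W = real N * loglogdens N"
    have W: "W > 0" using elim by (simp add: W_def)
    have bd: "(real j / real k - 1 / real k) * W \<le> real (semipi (n j N))" "real (semipi (n j N)) \<le> (real j / real k + 1 / real k) * W"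
      if "j \<le> k" for j
    proof -
      have "\<bar>real (semipi (n j N)) / W - real j / real k\<bar> < 1 / real k" using elim(1) that by (auto simp: W_def)
      hence "real j / real k - 1 / real k \<le> real (semipi (n j N)) / W" "real (semipi (n j N)) / W \<le> real j / real k + 1 / real k"
        by linarith+
      thus "(real j / real k - 1 / real k) * W \<le> real (semipi (n j N))" "real (semipi (n j N)) \<le> (real j / real k + 1 / real k) * W"
        using W by (simp_all add: pos_le_divide_eq pos_divide_le_eq)
    qed
    show ?case
    proof (intro allI impI)
      fix m assume m: "m \<le> N"
      define j where "j = nat \<lfloor>real k * real m / real N\<rfloor>"
      have j: "real j \<le> real k * real m / real N" "real k * real m / real N < real j + 1"
        unfolding j_def by (simp_all add: of_nat_floor)
      have "real k * real m / real N \<le> real k" using m elim by (simp add: pos_divide_le_eq mult_left_mono)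
      hence jk: "j \<le> k" using j by linarith
      have mW: "real m * loglogdens N = real m / real N * W" using elim by (simp add: W_def)
      have jm: "real j / real k \<le> real m / real N" "real m / real N \<le> real j / real k + 1 / real k"
        using j k elim by (auto simp: field_simps)
      have lo: "(real m / real N - 2 / real k) * W \<le> real (semipi m)"
      proof -
        have "real j / real k * real N \<le> real m" using jm(1) elim by (simp add: pos_le_divide_eq)
        hence "n j N \<le> m" unfolding n_def by linarith
        hence "real (semipi (n j N)) \<le> real (semipi m)" using semipi_mono by simp
        moreover have "(real m / real N - 2 / real k) * W \<le> (real j / real k - 1 / real k) * W"
          using jm W by (intro mult_right_mono) auto
        ultimately show ?thesis using bd(1)[OF jk] by linarith
      qed
      have hi: "real (semipi m) \<le> (real m / real N + 2 / real k) * W"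
      \<comment> \<open>At the right end there is no next grid point, but then m = N is itself
        one.\<close>
      proof (cases "j = k")
        case True
        hence "real m / real N \<ge> 1" using jm(1) k by simp
        hence "m = N" using m elim by (simp add: pos_le_divide_eq)
        moreover have "n k N = N" using k by (simp add: n_def)
        ultimately have "real (semipi m) \<le> (real m / real N + 1 / real k) * W"
          using bd(2)[of k] k elim by simp
        also have "\<dots> \<le> (real m / real N + 2 / real k) * W" using W by (intro mult_right_mono add_mono divide_right_mono) auto
        finally show ?thesis .
      next
        case False
        hence jk': "Suc j \<le> k" using jk by simp
        have "real m \<le> real (Suc j) / real k * real N"
          using jm(2) elim by (simp add: pos_divide_le_eq add_divide_distrib add.commute)
        hence "m \<le> n (Suc j) N" unfolding n_def by (simp add: le_nat_iff le_floor_iff)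
        hence "real (semipi m) \<le> real (semipi (n (Suc j) N))" using semipi_mono by simp
        also have "\<dots> \<le> (real (Suc j) / real k + 1 / real k) * W" by (rule bd(2)[OF jk'])
        also have "\<dots> \<le> (real m / real N + 2 / real k) * W"
          using jm(1) W by (intro mult_right_mono) (auto simp: add_divide_distrib)
        finally show ?thesis .
      qed
      have "2 / real k * W \<le> e * W" using k W by (intro mult_right_mono) auto
      thus "\<bar>real (semipi m) - real m * loglogdens N\<bar> \<le> e * (real N * loglogdens N)"
        using lo hi unfolding mW W_def[symmetric] by (simp add: abs_le_iff distrib_right left_diff_distrib)
    qed
  qed
qed

section \<open>Counting pairs of a prime and a semiprime\<close>

definition oddprimes :: "nat \<Rightarrow> nat set" where "oddprimes N = {p. prime p \<and> odd p \<and> p \<le> N}"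

lemma finite_oddprimes [simp]: "finite (oddprimes N)" unfolding oddprimes_def by (rule finite_primes_le)

lemma oddprimes_Suc: "oddprimes (Suc N) = (if prime (Suc N) \<and> odd (Suc N) then insert (Suc N) (oddprimes N) else oddprimes N)"
  by (auto simp: oddprimes_def le_Suc_eq)

text \<open>Both sides count the pairs of an odd prime p and a number n with p \<le> n < N.\<close>

lemma sum_oddprimes_complement: "(\<Sum>p\<in>oddprimes N. real (N - p)) = (\<Sum>n<N. real (oddpi n))"
proof (induction N)
  case 0
  have "oddprimes 0 = {}" by (auto simp: oddprimes_def prime_gt_0_nat)
  thus ?case by simp
next
  case (Suc N)
  have "Suc N \<notin> oddprimes N" by (simp add: oddprimes_def)
  hence "(\<Sum>p\<in>oddprimes (Suc N). real (Suc N - p)) = (\<Sum>p\<in>oddprimes N. real (Suc N - p))"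
    by (simp add: oddprimes_Suc)
  also have "\<dots> = (\<Sum>p\<in>oddprimes N. real (N - p) + 1)"
    by (intro sum.cong) (auto simp: oddprimes_def Suc_diff_le)
  also have "\<dots> = (\<Sum>p\<in>oddprimes N. real (N - p)) + real (oddpi N)"
    by (simp add: sum.distrib oddprimes_def oddpi_def)
  finally show ?case by (simp add: Suc.IH)
qed

text \<open>By the uniform estimate each \<open>semipi (N - p)\<close> may be replaced by (N - p) *
  \<open>loglogdens N\<close>. This pulls the density out and leaves the sum of N - p over the odd
  primes.\<close>

theorem prime_semiprime_pairs_asymp:
  "(\<lambda>N. (\<Sum>p\<in>oddprimes N. real (semipi (N - p))) / (real N ^ 2 / (2 * ln (real N)) * loglogdens N)) \<longlonglongrightarrow> 1"
proof -
  define W where "W = (\<lambda>N. \<Sum>p\<in>oddprimes N. real (semipi (N - p)))"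
  define X where "X = (\<lambda>N. \<Sum>n<N. real (oddpi n))"
  define D where "D = (\<lambda>N. real N ^ 2 / (2 * ln (real N)))"
  have "(\<lambda>N. (W N - loglogdens N * X N) / (D N * loglogdens N)) \<longlonglongrightarrow> 0"
  proof (rule LIMSEQ_I)
    fix r :: real assume r: "r > 0"
    have "eventually (\<lambda>N. real (oddpi N) * ln (real N) / real N < 2) sequentially"
      using order_tendstoD(2)[OF oddpi_asymp, of 2] by simp
    \<comment> \<open>With fewer than 2 N / ln N primes and the main term N^2 / (2 ln N) times the
      density, a relative accuracy r / 8 in each summand gives a total error below r / 2.\<close>
    moreover have "r / 8 > 0" using r by simp
    note semipi_uniform[OF this]
    ultimately have "eventually (\<lambda>N. norm ((W N - loglogdens N * X N) / (D N * loglogdens N) - 0) < r) sequentially"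
      using eventually_loglogdens_pos eventually_gt_at_top[of 1]
    proof eventually_elim
      case (elim N)
      have DN: "D N > 0" using elim by (simp add: D_def)
      have "W N - loglogdens N * X N = (\<Sum>p\<in>oddprimes N. real (semipi (N - p)) - real (N - p) * loglogdens N)"
        unfolding W_def X_def sum_oddprimes_complement[symmetric] by (simp add: sum_subtractf sum_distrib_left mult.commute)
      also have "\<bar>\<dots>\<bar> \<le> (\<Sum>p\<in>oddprimes N. r / 8 * (real N * loglogdens N))"
        by (rule order_trans[OF sum_abs sum_mono]) (use elim(2) in auto)
      also have "\<dots> = real (oddpi N) * (r / 8 * (real N * loglogdens N))" by (simp add: oddpi_def oddprimes_def)
      finally have le: "\<bar>W N - loglogdens N * X N\<bar> \<le> real (oddpi N) * (r / 8 * (real N * loglogdens N))" .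
      have pos: "D N * loglogdens N > 0" using DN elim by simp
      have "\<bar>(W N - loglogdens N * X N) / (D N * loglogdens N)\<bar> \<le> real (oddpi N) * (r / 8 * (real N * loglogdens N)) / (D N * loglogdens N)"
        unfolding abs_divide abs_of_pos[OF pos] using le pos by (intro divide_right_mono) auto
      also have "\<dots> = r / 4 * (real (oddpi N) * ln (real N) / real N)"
        using elim by (simp add: D_def power2_eq_square)
      also have "\<dots> < r / 4 * 2" using elim r by (intro mult_strict_left_mono) auto
      also have "\<dots> < r" using r by simp
      finally show ?case by simp
    qed
    thus "\<exists>no. \<forall>n\<ge>no. norm ((W n - loglogdens n * X n) / (D n * loglogdens n) - 0) < r"
      by (simp add: eventually_sequentially)
  qed
  from tendsto_add[OF this sum_oddpi_asymp]
  have "(\<lambda>N. (W N - loglogdens N * X N) / (D N * loglogdens N) + X N / D N) \<longlonglongrightarrow> 1"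
    by (simp add: X_def D_def)
  moreover have "eventually (\<lambda>N. (W N - loglogdens N * X N) / (D N * loglogdens N) + X N / D N = W N / (D N * loglogdens N)) sequentially"
    using eventually_loglogdens_pos by eventually_elim (simp add: diff_divide_distrib)
  ultimately have "(\<lambda>N. W N / (D N * loglogdens N)) \<longlonglongrightarrow> 1" by (rule Lim_transform_eventually)
  thus ?thesis by (simp add: W_def D_def)
qed

lemma card_even_pairs:
  assumes fin: "\<And>n. finite (S n)" and sum: "\<And>n x. x \<in> S n \<Longrightarrow> fst x + snd x = n"
  shows "(\<Sum>k\<le>K. card (S (2 * k))) = card (\<Union>k\<le>K. S (2 * k :: nat))"
proof (rule card_UN_disjoint[symmetric])
  show "\<forall>i\<in>{..K}. \<forall>j\<in>{..K}. i \<noteq> j \<longrightarrow> S (2 * i) \<inter> S (2 * j) = {}"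
  proof (intro ballI impI equals0I)
    fix i j x assume "i \<noteq> j" "x \<in> S (2 * i) \<inter> S (2 * j)"
    hence "2 * i = 2 * j" using sum[of x "2 * i"] sum[of x "2 * j"] by simp
    thus False using \<open>i \<noteq> j\<close> by simp
  qed
qed (auto simp: fin)

text \<open>Odd semiprimes being odd, the total p + m is even exactly when p is odd. Summing over
  even totals thus loses no pair with p odd.\<close>

lemma sum_spairs: "(\<Sum>k\<le>K. spairs (2 * k)) = (\<Sum>p\<in>oddprimes (2 * K). semipi (2 * K - p))"
proof -
  define S where "S = (\<lambda>n. {(p, m). prime p \<and> odd_semiprime m \<and> p + m = n})"
  have fin: "finite (S n)" for n
    by (rule finite_subset[of _ "{..n} \<times> {..n}"]) (auto simp: S_def)
  have odd: "odd m" if "odd_semiprime m" for m using that by (auto simp: odd_semiprime_def)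
  have "(\<Union>k\<le>K. S (2 * k)) = (SIGMA p:oddprimes (2 * K). {m. odd_semiprime m \<and> m \<le> 2 * K - p})"
  proof (intro equalityI subsetI)
    fix x assume "x \<in> (\<Union>k\<le>K. S (2 * k))"
    then obtain k p m where x: "x = (p, m)" "k \<le> K" "prime p" "odd_semiprime m" "p + m = 2 * k"
      by (auto simp: S_def)
    have "even (p + m)" using x by simp
    hence "odd p" using odd[OF x(4)] by simp
    thus "x \<in> (SIGMA p:oddprimes (2 * K). {m. odd_semiprime m \<and> m \<le> 2 * K - p})"
      using x by (auto simp: oddprimes_def)
  next
    fix x assume "x \<in> (SIGMA p:oddprimes (2 * K). {m. odd_semiprime m \<and> m \<le> 2 * K - p})"
    then obtain p m where x: "x = (p, m)" "prime p" "odd p" "p \<le> 2 * K" "odd_semiprime m" "m \<le> 2 * K - p"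
      by (auto simp: oddprimes_def)
    have "even (p + m)" using x odd[OF x(5)] by simp
    then obtain k where "p + m = 2 * k" by (elim evenE)
    moreover from this have "k \<le> K" using x by linarith
    ultimately show "x \<in> (\<Union>k\<le>K. S (2 * k))" using x by (auto simp: S_def)
  qed
  moreover have "(\<Sum>k\<le>K. card (S (2 * k))) = card (\<Union>k\<le>K. S (2 * k))"
    by (rule card_even_pairs[OF fin]) (auto simp: S_def)
  ultimately have "(\<Sum>k\<le>K. card (S (2 * k))) = (\<Sum>p\<in>oddprimes (2 * K). card {m. odd_semiprime m \<and> m \<le> 2 * K - p})"
    using finite_semiprimes_le by (simp add: card_SigmaI)
  thus ?thesis by (simp add: S_def spairs_def semipi_def)
qed

text \<open>A crude bound of order K^2 / (ln K)^2, which is smaller than the semiprime contribution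
  by a factor ln ln K.\<close>

lemma sum_gpairs_le: "(\<Sum>k\<le>K. gpairs (2 * k)) \<le> primepi (2 * K) ^ 2"
proof -
  define S where "S = (\<lambda>n. {(p, q). prime p \<and> prime q \<and> p \<le> q \<and> p + q = (n::nat)})"
  have fin: "finite (S n)" for n
    by (rule finite_subset[of _ "{..n} \<times> {..n}"]) (auto simp: S_def)
  have "(\<Sum>k\<le>K. card (S (2 * k))) = card (\<Union>k\<le>K. S (2 * k))"
    by (rule card_even_pairs[OF fin]) (auto simp: S_def)
  also have "\<dots> \<le> card ({p. prime p \<and> p \<le> 2 * K} \<times> {p. prime p \<and> p \<le> 2 * K})"
    by (intro card_mono finite_cartesian_product finite_primes_le) (auto simp: S_def)
  finally show ?thesis by (simp add: S_def gpairs_def primepi_def card_cartesian_product power2_eq_square)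
qed

text \<open>The normaliser x ln ln x / (ln x)^2 from \<open>ratio\<close>, taken at x = 2 k.\<close>

definition evenweight :: "nat \<Rightarrow> real" where
  "evenweight k = real (2 * k) * ln (ln (real (2 * k))) / ln (real (2 * k)) ^ 2"

theorem sum_cdec_asymp: "(\<lambda>K. (\<Sum>k\<le>K. real (cdec (2 * k))) / (real K * evenweight K)) \<longlonglongrightarrow> 1"
proof -
  have double: "filterlim (\<lambda>K::nat. 2 * K) sequentially sequentially" by real_asymp
  \<comment> \<open>In terms of N = 2 K this is N^2 / 2 * ln ln N / (ln N)^2.\<close>
  define B where "B = (\<lambda>K. real K * evenweight K)"
  have Bpos: "eventually (\<lambda>K. B K > 0) sequentially"
    unfolding B_def evenweight_def by real_asymp
  have s: "(\<lambda>K. (\<Sum>k\<le>K. real (spairs (2 * k))) / B K) \<longlonglongrightarrow> 1"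
  proof (rule Lim_transform_eventually[OF filterlim_compose[OF prime_semiprime_pairs_asymp double]])
    show "eventually (\<lambda>K. (\<Sum>p\<in>oddprimes (2 * K). real (semipi (2 * K - p))) / (real (2 * K) ^ 2 / (2 * ln (real (2 * K))) * loglogdens (2 * K)) =
       (\<Sum>k\<le>K. real (spairs (2 * k))) / B K) sequentially"
      using eventually_gt_at_top[of 1]
    proof eventually_elim
      case (elim K)
      have "real (2 * K) ^ 2 / (2 * ln (real (2 * K))) * loglogdens (2 * K) = B K"
        using elim by (simp add: B_def evenweight_def loglogdens_def power2_eq_square)
      moreover have "(\<Sum>p\<in>oddprimes (2 * K). real (semipi (2 * K - p))) = (\<Sum>k\<le>K. real (spairs (2 * k)))"
        using arg_cong[OF sum_spairs[of K], of real] by simp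
      ultimately show ?case by simp
    qed
  qed
  have g: "(\<lambda>K. (\<Sum>k\<le>K. real (gpairs (2 * k))) / B K) \<longlonglongrightarrow> 0"
  proof (rule real_tendsto_sandwich)
    show "eventually (\<lambda>K. 0 \<le> (\<Sum>k\<le>K. real (gpairs (2 * k))) / B K) sequentially"
      using Bpos by eventually_elim (auto intro!: divide_nonneg_nonneg sum_nonneg)
    show "eventually (\<lambda>K. (\<Sum>k\<le>K. real (gpairs (2 * k))) / B K \<le>
        (real (primepi (2 * K)) * ln (real (2 * K)) / real (2 * K)) ^ 2 * ((real (2 * K) / ln (real (2 * K))) ^ 2 / B K)) sequentially"
      using Bpos eventually_gt_at_top[of 1]
    proof eventually_elim
      case (elim K)
      have "(\<Sum>k\<le>K. real (gpairs (2 * k))) \<le> real (primepi (2 * K)) ^ 2"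
        using sum_gpairs_le[of K] by (metis of_nat_le_iff of_nat_power of_nat_sum)
      hence "(\<Sum>k\<le>K. real (gpairs (2 * k))) / B K \<le> real (primepi (2 * K)) ^ 2 / B K"
        using elim by (intro divide_right_mono) auto
      also have "\<dots> = (real (primepi (2 * K)) * ln (real (2 * K)) / real (2 * K)) ^ 2 * ((real (2 * K) / ln (real (2 * K))) ^ 2 / B K)"
        using elim by (simp add: power_divide power_mult_distrib)
      finally show ?case .
    qed
    have "(\<lambda>K. (real (primepi (2 * K)) * ln (real (2 * K)) / real (2 * K)) ^ 2 * ((real (2 * K) / ln (real (2 * K))) ^ 2 / B K)) \<longlonglongrightarrow> 1 ^ 2 * 0"
    proof (intro tendsto_mult tendsto_power filterlim_compose[OF prime_number_theorem double])
      show "(\<lambda>K. (real (2 * K) / ln (real (2 * K))) ^ 2 / B K) \<longlonglongrightarrow> 0"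
        unfolding B_def evenweight_def by real_asymp
    qed
    thus "(\<lambda>K. (real (primepi (2 * K)) * ln (real (2 * K)) / real (2 * K)) ^ 2 * ((real (2 * K) / ln (real (2 * K))) ^ 2 / B K)) \<longlonglongrightarrow> 0" by simp
  qed auto
  show ?thesis using tendsto_add[OF g s] by (simp add: cdec_def sum.distrib add_divide_distrib B_def)
qed

subsection \<open>The mean value of the singular series\<close>

definition twinfactor :: "nat \<Rightarrow> real" where
  "twinfactor p = (if prime p \<and> odd p then real p * (real p - 2) / (real p - 1) ^ 2 else 1)"

text \<open>The arithmetic factor of the Hardy-Littlewood singular series; the product in
  \<open>ratio\<close> is its reciprocal.\<close>

definition singular :: "nat \<Rightarrow> real" where
  "singular x = (\<Prod>p | prime p \<and> odd p \<and> p dvd x. (real p - 1) / (real p - 2))"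

text \<open>The excess over 1 of the local factor (p - 1) / (p - 2), so that \<open>singular\<close>
  becomes a product of terms 1 + \<open>twinexcess p\<close>.\<close>

definition twinexcess :: "nat \<Rightarrow> real" where "twinexcess p = 1 / (real p - 2)"

lemma odd_prime_ge_3: assumes "prime p" "odd p" shows "(p::nat) \<ge> 3"
proof -
  have "p \<ge> 2" "p \<noteq> 2" using assms prime_ge_2_nat by auto
  thus ?thesis by simp
qed

lemma oddprimes_ge_3: "p \<in> oddprimes N \<Longrightarrow> p \<ge> 3"
  by (auto simp: oddprimes_def odd_prime_ge_3)

lemma twinexcess_pos: "p \<in> oddprimes N \<Longrightarrow> twinexcess p > 0"
  using oddprimes_ge_3[of p N] by (simp add: twinexcess_def)

lemma one_plus_twinexcess: assumes "p \<ge> 3" shows "1 + twinexcess p = (real p - 1) / (real p - 2)"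
  using assms by (simp add: twinexcess_def field_simps)

lemma twinfactor_pos: "twinfactor p > 0"
proof (cases "prime p \<and> odd p")
  case True
  hence "p \<ge> 3" using odd_prime_ge_3 by auto
  hence "real p * (real p - 2) > 0" "(real p - 1) ^ 2 > 0" by auto
  thus ?thesis using True by (simp add: twinfactor_def)
qed (auto simp: twinfactor_def)

text \<open>The source of the mean value 1 / C_tw: p divides a number with density 1 / p, so the
  local factor averages to 1 + 1 / (p (p - 2)) = (p - 1)^2 / (p (p - 2)).\<close>

lemma twinfactor_inverse: assumes "p \<in> oddprimes N" shows "1 + twinexcess p / real p = inverse (twinfactor p)"
proof -
  have p: "p \<ge> 3" "prime p" "odd p" using assms oddprimes_ge_3 by (auto simp: oddprimes_def)
  hence "real p - 2 \<noteq> 0" "real p - 1 \<noteq> 0" "real p \<noteq> 0" by auto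
  thus ?thesis using p by (simp add: twinfactor_def twinexcess_def divide_simps) (simp add: power2_eq_square algebra_simps)
qed

lemma prod_dvd_iff:
  assumes "finite X" "X \<subseteq> oddprimes N"
  shows "\<Prod>X dvd k \<longleftrightarrow> (\<forall>p\<in>X. p dvd k)"
  using assms
proof (induction X rule: finite_induct)
  case (insert p X)
  have "coprime p (\<Prod>X)"
  proof (rule prod_coprime_right)
    fix q assume "q \<in> X"
    thus "coprime p q" using insert by (intro primes_coprime) (auto simp: oddprimes_def)
  qed
  hence "p * \<Prod>X dvd k \<longleftrightarrow> p dvd k \<and> \<Prod>X dvd k"
    by (auto intro: divides_mult dvd_trans[of p "p * \<Prod>X" k] dvd_trans[of "\<Prod>X" "p * \<Prod>X" k])
  thus ?case using insert by simp
qed auto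

lemma prod_oddprimes_pos: "X \<subseteq> oddprimes N \<Longrightarrow> \<Prod>X > (0::nat)"
  by (intro prod_pos) (auto simp: oddprimes_def prime_gt_0_nat)

lemma card_multiples: assumes "d > 0" shows "card {k\<in>{1..K}. d dvd k} = K div (d::nat)"
proof -
  have "{k\<in>{1..K}. d dvd k} = (\<lambda>j. d * j) ` {1..K div d}"
  proof (intro equalityI subsetI)
    fix k assume "k \<in> {k\<in>{1..K}. d dvd k}"
    then obtain j where "k = d * j" "1 \<le> k" "k \<le> K" by auto
    thus "k \<in> (\<lambda>j. d * j) ` {1..K div d}"
      using assms by (auto simp: less_eq_div_iff_mult_less_eq mult.commute Suc_le_eq)
  qed (use assms in \<open>auto simp: less_eq_div_iff_mult_less_eq mult.commute Suc_le_eq\<close>)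
  thus ?thesis using assms by (simp add: card_image inj_on_def)
qed

text \<open>Expanding the product gives a sum over sets X of primes, that is over squarefree odd d.
  The set X survives at k exactly if its product divides k, so exchanging the sums leaves a count of
  multiples.\<close>

lemma sum_truncated_singular:
  "(\<Sum>k\<in>{1..K}. \<Prod>p\<in>oddprimes Y. 1 + (if p dvd k then twinexcess p else 0)) =
   (\<Sum>X\<in>Pow (oddprimes Y). (\<Prod>p\<in>X. twinexcess p) * real (K div \<Prod>X))"
proof -
  have "(\<Prod>p\<in>oddprimes Y. 1 + (if p dvd k then twinexcess p else 0)) =
        (\<Sum>X\<in>Pow (oddprimes Y). (\<Prod>p\<in>X. twinexcess p) * (if \<Prod>X dvd k then 1 else 0))" for k
  proof -
    have "(\<Prod>p\<in>oddprimes Y. (if p dvd k then twinexcess p else 0) + 1) =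
        (\<Sum>X\<in>Pow (oddprimes Y). (\<Prod>p\<in>X. if p dvd k then twinexcess p else 0) * (\<Prod>p\<in>oddprimes Y - X. 1))"
      by (rule prod_add) simp
    also have "\<dots> = (\<Sum>X\<in>Pow (oddprimes Y). (\<Prod>p\<in>X. twinexcess p) * (if \<Prod>X dvd k then 1 else 0))"
    proof (rule sum.cong)
      fix X assume X: "X \<in> Pow (oddprimes Y)"
      hence fin: "finite X" by (auto intro: finite_subset)
      have "(\<Prod>p\<in>X. if p dvd k then twinexcess p else 0) = (\<Prod>p\<in>X. twinexcess p) * (if \<Prod>X dvd k then 1 else 0)"
      proof (cases "\<Prod>X dvd k")
        case True
        hence "\<forall>p\<in>X. p dvd k" using X fin prod_dvd_iff by auto
        thus ?thesis using True by simp
      next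
        case False
        hence "\<exists>p\<in>X. \<not> p dvd k" using X fin prod_dvd_iff by auto
        hence "(\<Prod>p\<in>X. if p dvd k then twinexcess p else 0) = 0" using fin by (auto simp: prod_zero_iff)
        thus ?thesis using False by simp
      qed
      thus "(\<Prod>p\<in>X. if p dvd k then twinexcess p else 0) * (\<Prod>p\<in>oddprimes Y - X. 1) = (\<Prod>p\<in>X. twinexcess p) * (if \<Prod>X dvd k then 1 else 0)"
        by simp
    qed simp
    finally show ?thesis by (simp add: add.commute)
  qed
  hence "(\<Sum>k\<in>{1..K}. \<Prod>p\<in>oddprimes Y. 1 + (if p dvd k then twinexcess p else 0)) =
     (\<Sum>X\<in>Pow (oddprimes Y). \<Sum>k\<in>{1..K}. (\<Prod>p\<in>X. twinexcess p) * (if \<Prod>X dvd k then 1 else 0))"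
    by (simp only:) (rule sum.swap)
  also have "\<dots> = (\<Sum>X\<in>Pow (oddprimes Y). (\<Prod>p\<in>X. twinexcess p) * real (K div \<Prod>X))"
  proof (rule sum.cong)
    fix X assume X: "X \<in> Pow (oddprimes Y)"
    have "(\<Sum>k\<in>{1..K}. if \<Prod>X dvd k then 1 else 0 :: real) = real (card {k\<in>{1..K}. \<Prod>X dvd k})"
      by (subst sum.If_cases) (auto simp: Int_def)
    also have "card {k\<in>{1..K}. \<Prod>X dvd k} = K div \<Prod>X"
      using X by (intro card_multiples prod_oddprimes_pos[of X Y]) auto
    finally show "(\<Sum>k\<in>{1..K}. (\<Prod>p\<in>X. twinexcess p) * (if \<Prod>X dvd k then 1 else 0)) = (\<Prod>p\<in>X. twinexcess p) * real (K div \<Prod>X)"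
      by (simp add: sum_distrib_left[symmetric])
  qed simp
  finally show ?thesis .
qed

definition twinprod :: "nat \<Rightarrow> real" where "twinprod Y = (\<Prod>p\<le>Y. twinfactor p)"

lemma twinprod_pos: "twinprod Y > 0" unfolding twinprod_def by (intro prod_pos) (auto simp: twinfactor_pos)

lemma sum_Pow_oddprimes:
  "(\<Sum>X\<in>Pow (oddprimes Y). (\<Prod>p\<in>X. twinexcess p) / real (\<Prod>X)) = 1 / twinprod Y"
proof -
  have "(\<Prod>p\<in>oddprimes Y. twinexcess p / real p + 1) =
      (\<Sum>X\<in>Pow (oddprimes Y). (\<Prod>p\<in>X. twinexcess p / real p) * (\<Prod>p\<in>oddprimes Y - X. 1))"
    by (rule prod_add) simp
  also have "\<dots> = (\<Sum>X\<in>Pow (oddprimes Y). (\<Prod>p\<in>X. twinexcess p) / real (\<Prod>X))"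
    by (simp add: prod_dividef)
  also have "(\<Prod>p\<in>oddprimes Y. twinexcess p / real p + 1) = (\<Prod>p\<in>oddprimes Y. inverse (twinfactor p))"
    by (intro prod.cong) (auto simp: twinfactor_inverse[symmetric])
  also have "\<dots> = inverse (\<Prod>p\<in>oddprimes Y. twinfactor p)"
    using prod_inversef[of twinfactor "oddprimes Y"] by (simp add: o_def)
  also have "(\<Prod>p\<in>oddprimes Y. twinfactor p) = twinprod Y"
    unfolding twinprod_def by (rule prod.mono_neutral_left) (auto simp: oddprimes_def twinfactor_def)
  finally show ?thesis by (simp add: inverse_eq_divide)
qed

text \<open>An odd prime dividing 2 k divides k and is thus at most K, so truncation at
  \<open>K\<close> loses nothing.\<close>

lemma singular_eq_truncated:
  assumes "k \<in> {1..K}"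
  shows "singular (2 * k) = (\<Prod>p\<in>oddprimes K. 1 + (if p dvd k then twinexcess p else 0))"
proof -
  have dv: "p dvd 2 * k \<longleftrightarrow> p dvd k" if "prime p" "odd p" for p
    using that by (simp add: coprime_dvd_mult_right_iff)
  have "(\<Prod>p\<in>oddprimes K. 1 + (if p dvd k then twinexcess p else 0)) = (\<Prod>p\<in>{p\<in>oddprimes K. p dvd k}. 1 + twinexcess p)"
    by (simp add: prod.inter_filter[symmetric] if_distrib cong: if_cong)
  also have "\<dots> = (\<Prod>p\<in>{p\<in>oddprimes K. p dvd k}. (real p - 1) / (real p - 2))"
    using oddprimes_ge_3 by (intro prod.cong one_plus_twinexcess) auto
  also have "{p\<in>oddprimes K. p dvd k} = {p. prime p \<and> odd p \<and> p dvd 2 * k}"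
    using assms dv by (auto simp: oddprimes_def intro: order_trans[OF dvd_imp_le])
  finally show ?thesis by (simp add: singular_def)
qed

lemma truncated_mono:
  assumes "Y \<le> K"
  shows "(\<Prod>p\<in>oddprimes Y. 1 + (if p dvd k then twinexcess p else 0)) \<le> (\<Prod>p\<in>oddprimes K. 1 + (if p dvd k then twinexcess p else 0))"
proof (rule prod_mono2)
  show "oddprimes Y \<subseteq> oddprimes K" using assms by (auto simp: oddprimes_def)
qed (use twinexcess_pos in \<open>auto simp: less_imp_le add_nonneg_nonneg\<close>)

definition singsum :: "nat \<Rightarrow> real" where "singsum K = (\<Sum>k\<in>{1..K}. singular (2 * k))"

text \<open>Rounding in the counts of multiples only helps an upper bound, so the full truncation at
  \<open>K\<close> can be used.\<close>

lemma singsum_upper: "singsum K \<le> real K / twinprod K"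
proof -
  have "singsum K = (\<Sum>X\<in>Pow (oddprimes K). (\<Prod>p\<in>X. twinexcess p) * real (K div \<Prod>X))"
    unfolding singsum_def sum_truncated_singular[symmetric] by (intro sum.cong singular_eq_truncated) auto
  also have "\<dots> \<le> (\<Sum>X\<in>Pow (oddprimes K). (\<Prod>p\<in>X. twinexcess p) * (real K / real (\<Prod>X)))"
    by (intro sum_mono mult_left_mono prod_nonneg of_nat_div_le_of_nat) (auto intro: less_imp_le twinexcess_pos)
  also have "\<dots> = real K * (\<Sum>X\<in>Pow (oddprimes K). (\<Prod>p\<in>X. twinexcess p) / real (\<Prod>X))"
    by (simp add: sum_distrib_left mult_ac)
  finally show ?thesis unfolding sum_Pow_oddprimes by simp
qed

text \<open>Rounding hurts here. Truncating at \<open>Y\<close> keeps the rounding loss independent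
  of K, and dropping primes only decreases \<open>singular\<close>, as all excesses are
  positive.\<close>

lemma singsum_lower:
  assumes "Y \<le> K"
  shows "singsum K \<ge> real K / twinprod Y - (\<Sum>X\<in>Pow (oddprimes Y). \<Prod>p\<in>X. twinexcess p)"
proof -
  have "real K / twinprod Y - (\<Sum>X\<in>Pow (oddprimes Y). \<Prod>p\<in>X. twinexcess p) =
     (\<Sum>X\<in>Pow (oddprimes Y). (\<Prod>p\<in>X. twinexcess p) * (real K / real (\<Prod>X) - 1))"
    unfolding divide_inverse[of "real K"] inverse_eq_divide sum_Pow_oddprimes[symmetric]
    by (simp add: sum_distrib_left sum_subtractf right_diff_distrib mult_ac)
  also have "\<dots> \<le> (\<Sum>X\<in>Pow (oddprimes Y). (\<Prod>p\<in>X. twinexcess p) * real (K div \<Prod>X))"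
  proof (intro sum_mono mult_left_mono prod_nonneg)
    fix X assume X: "X \<in> Pow (oddprimes Y)"
    have "\<Prod>X > 0" using X by (intro prod_oddprimes_pos[of X Y]) auto
    moreover have "real K = real (\<Prod>X) * real (K div \<Prod>X) + real (K mod \<Prod>X)"
      by (metis mult_div_mod_eq of_nat_add of_nat_mult)
    moreover have "real (K mod \<Prod>X) \<le> real (\<Prod>X)" using \<open>\<Prod>X > 0\<close> by (simp only: of_nat_le_iff) (simp add: less_imp_le)
    ultimately have "real K \<le> (real (K div \<Prod>X) + 1) * real (\<Prod>X)" by (simp only: distrib_right) (simp add: mult.commute)
    thus "real K / real (\<Prod>X) - 1 \<le> real (K div \<Prod>X)"
      using \<open>\<Prod>X > 0\<close> by (simp only: diff_le_eq pos_divide_le_eq of_nat_0_less_iff)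
  qed (auto intro: less_imp_le twinexcess_pos)
  also have "\<dots> = (\<Sum>k\<in>{1..K}. \<Prod>p\<in>oddprimes Y. 1 + (if p dvd k then twinexcess p else 0))"
    by (rule sum_truncated_singular[symmetric])
  also have "\<dots> \<le> (\<Sum>k\<in>{1..K}. singular (2 * k))"
    by (intro sum_mono) (simp only: singular_eq_truncated[of _ K] truncated_mono[OF assms])
  finally show ?thesis by (simp add: singsum_def)
qed

text \<open>The factor at an odd prime p is 1 - 1 / (p - 1)^2, so the product converges absolutely
  and is nonzero. \<open>C_tw\<close> is written with the total infinite product, so its meaning as
  a limit rests on this convergence.\<close>

lemma twinprod_tendsto: "twinprod \<longlonglongrightarrow> C_tw" and C_tw_pos: "C_tw > 0"
proof -
  have eq: "C_tw = prodinf twinfactor" unfolding C_tw_def twinfactor_def ..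
  have "summable (\<lambda>n. norm (twinfactor n - 1))"
  proof (rule summable_comparison_test_ev)
    show "summable (\<lambda>n. 4 * (1 / real n ^ 2))"
      using inverse_power_summable[of 2, where 'a = real] by (intro summable_mult) (simp add: inverse_eq_divide)
    show "eventually (\<lambda>n. norm (norm (twinfactor n - 1)) \<le> 4 * (1 / real n ^ 2)) sequentially"
      using eventually_ge_at_top[of 3]
    proof eventually_elim
      case (elim n)
      have "\<bar>real n * (real n - 2) / (real n - 1) ^ 2 - 1\<bar> = 1 / (real n - 1) ^ 2"
      proof -
        have "real n * (real n - 2) / (real n - 1) ^ 2 - 1 = - (1 / (real n - 1) ^ 2)"
          using elim by (simp add: divide_simps) (simp add: power2_eq_square algebra_simps)
        thus ?thesis by simp
      qed
      \<comment> \<open>For n \<ge> 3 one has n - 1 \<ge> n / 2, whence the 4 in the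
        majorant.\<close>
      also have "\<dots> \<le> 1 / (real n / 2) ^ 2" using elim by (intro divide_left_mono power_mono mult_pos_pos) auto
      finally show ?case by (auto simp: twinfactor_def power_divide)
    qed
  qed
  hence "convergent_prod twinfactor"
    by (intro abs_convergent_prod_imp_convergent_prod) (simp add: abs_convergent_prod_conv_summable)
  from convergent_prod_LIMSEQ[OF this] prodinf_nonzero[OF this]
  have lim: "twinprod \<longlonglongrightarrow> C_tw" and nz: "C_tw \<noteq> 0"
    using twinfactor_pos unfolding eq twinprod_def by (auto simp: less_le)
  have "C_tw \<ge> 0" using twinprod_pos by (intro LIMSEQ_le_const[OF lim]) (auto intro: less_imp_le)
  thus "C_tw > 0" using nz by simp
  show "twinprod \<longlonglongrightarrow> C_tw" by (rule lim)
qed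

theorem singsum_asymp: "(\<lambda>K. singsum K / real K) \<longlonglongrightarrow> 1 / C_tw"
proof (rule order_tendstoI)
  have lim: "(\<lambda>Y. 1 / twinprod Y) \<longlonglongrightarrow> 1 / C_tw"
    using C_tw_pos by (intro tendsto_intros twinprod_tendsto) auto
  {
    fix c assume "c > 1 / C_tw"
    from order_tendstoD(2)[OF lim this] show "eventually (\<lambda>K. singsum K / real K < c) sequentially"
      using eventually_gt_at_top[of 0]
    proof eventually_elim
      case (elim K)
      have "singsum K / real K \<le> real K / twinprod K / real K"
        using elim by (intro divide_right_mono singsum_upper) auto
      thus ?case using elim by simp
    qed
  }
  fix c assume "c < 1 / C_tw"
  from order_tendstoD(1)[OF lim this] obtain Y where Y: "c < 1 / twinprod Y"
    by (auto simp: eventually_sequentially)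
  define A where "A = (\<Sum>X\<in>Pow (oddprimes Y). \<Prod>p\<in>X. twinexcess p)"
  have "(\<lambda>K. 1 / twinprod Y - A / real K) \<longlonglongrightarrow> 1 / twinprod Y - 0"
    by (intro tendsto_diff tendsto_const) real_asymp
  hence "eventually (\<lambda>K. 1 / twinprod Y - A / real K > c) sequentially"
    using Y by (intro order_tendstoD(1)) auto
  thus "eventually (\<lambda>K. c < singsum K / real K) sequentially"
    using eventually_ge_at_top[of "max 1 Y"]
  proof eventually_elim
    case (elim K)
    have "1 / twinprod Y - A / real K = (real K / twinprod Y - A) / real K"
      using elim by (simp add: diff_divide_distrib)
    also have "\<dots> \<le> singsum K / real K"
      using elim unfolding A_def by (intro divide_right_mono singsum_lower) auto
    finally show ?case using elim by simp
  qed
qed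

subsection \<open>Comparing the two averages\<close>

lemma singular_pos: "singular x > 0"
  unfolding singular_def
proof (rule prod_pos)
  fix p assume "p \<in> {p. prime p \<and> odd p \<and> p dvd x}"
  hence "p \<ge> 3" using odd_prime_ge_3 by auto
  thus "(real p - 1) / (real p - 2) > 0" by simp
qed

lemma ratio_eq:
  "ratio x = real (cdec x) * (ln (real x))^2 / (real x * ln (ln (real x))) / singular x"
proof -
  have "(\<Prod>p | prime p \<and> odd p \<and> p dvd x. (real p - 2) / (real p - 1)) = inverse (singular x)"
    unfolding singular_def prod_inversef[symmetric] o_def inverse_divide ..
  thus ?thesis unfolding ratio_def by (simp add: divide_inverse)
qed

text \<open>What the hypothesis predicts for the summed c, up to the factor L. The index 0 adds
  nothing: \<open>evenweight 0\<close> is 0, while \<open>singular 0\<close> is a product over an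
  infinite set and so has the default value 1.\<close>

definition weightsum :: "nat \<Rightarrow> real" where "weightsum K = (\<Sum>k\<le>K. singular (2 * k) * evenweight k)"

lemma singsum_0 [simp]: "singsum 0 = 0" by (simp add: singsum_def)

lemma singsum_Suc: "singsum (Suc K) = singsum K + singular (2 * Suc K)"
  by (simp add: singsum_def)

text \<open>Summation by parts, which moves the averaging onto \<open>singsum\<close>, whose
  asymptotics are known.\<close>

lemma weightsum_abel:
  "weightsum K = singsum K * evenweight K - (\<Sum>k<K. singsum k * (evenweight (Suc k) - evenweight k))"
proof (induction K)
  case 0
  show ?case by (simp add: weightsum_def evenweight_def)
next
  case (Suc K)
  have "weightsum (Suc K) = weightsum K + singular (2 * Suc K) * evenweight (Suc K)"
    by (simp add: weightsum_def)
  also have "singular (2 * Suc K) = singsum (Suc K) - singsum K" by (simp add: singsum_Suc)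
  finally show ?case unfolding Suc.IH by (simp add: algebra_simps)
qed

lemma weightsum_asymp: "(\<lambda>K. weightsum K / (real K * evenweight K)) \<longlonglongrightarrow> 1 / (2 * C_tw)"
proof -
  have evpos: "eventually (\<lambda>K. evenweight K > 0) sequentially" unfolding evenweight_def by real_asymp
  have "(\<lambda>K. (\<Sum>k<K. singsum k * (evenweight (Suc k) - evenweight k)) / (real K * evenweight K)) \<longlonglongrightarrow> 1 / (2 * C_tw)"
  proof (rule stolz_cesaro)
    show "eventually (\<lambda>K. real K * evenweight K < real (Suc K) * evenweight (Suc K)) sequentially"
      unfolding evenweight_def by real_asymp
    show "filterlim (\<lambda>K. real K * evenweight K) at_top sequentially"
      unfolding evenweight_def by real_asymp
    have "(\<lambda>K. singsum K / real K * (real K * (evenweight (Suc K) - evenweight K) / (real (Suc K) * evenweight (Suc K) - real K * evenweight K)))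
        \<longlonglongrightarrow> 1 / C_tw * (1 / 2)"
    proof (intro tendsto_mult singsum_asymp)
      \<comment> \<open>Up to logarithms \<open>evenweight\<close> is linear: K times its increment
        is asymptotic to w = \<open>evenweight K\<close>, and the increment of K * w to 2 w.
        Summation by parts therefore subtracts half of the boundary term 1 / C_tw.\<close>
      show "(\<lambda>K. real K * (evenweight (Suc K) - evenweight K) / (real (Suc K) * evenweight (Suc K) - real K * evenweight K)) \<longlonglongrightarrow> 1 / 2"
        unfolding evenweight_def by real_asymp
    qed
    hence "(\<lambda>K. singsum K / real K * (real K * (evenweight (Suc K) - evenweight K) / (real (Suc K) * evenweight (Suc K) - real K * evenweight K)))
        \<longlonglongrightarrow> 1 / (2 * C_tw)" by (simp add: mult.commute)
    thus "(\<lambda>K. ((\<Sum>k<Suc K. singsum k * (evenweight (Suc k) - evenweight k)) - (\<Sum>k<K. singsum k * (evenweight (Suc k) - evenweight k))) /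
        (real (Suc K) * evenweight (Suc K) - real K * evenweight K)) \<longlonglongrightarrow> 1 / (2 * C_tw)"
    proof (rule Lim_transform_eventually)
      show "eventually (\<lambda>K. singsum K / real K * (real K * (evenweight (Suc K) - evenweight K) / (real (Suc K) * evenweight (Suc K) - real K * evenweight K)) =
        ((\<Sum>k<Suc K. singsum k * (evenweight (Suc k) - evenweight k)) - (\<Sum>k<K. singsum k * (evenweight (Suc k) - evenweight k))) /
        (real (Suc K) * evenweight (Suc K) - real K * evenweight K)) sequentially"
        using eventually_gt_at_top[of 0] by eventually_elim simp
    qed
  qed
  from tendsto_diff[OF singsum_asymp this]
  have "(\<lambda>K. singsum K / real K - (\<Sum>k<K. singsum k * (evenweight (Suc k) - evenweight k)) / (real K * evenweight K)) \<longlonglongrightarrow> 1 / (2 * C_tw)"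
    by simp
  thus ?thesis
  proof (rule Lim_transform_eventually)
    show "eventually (\<lambda>K. singsum K / real K - (\<Sum>k<K. singsum k * (evenweight (Suc k) - evenweight k)) / (real K * evenweight K) =
       weightsum K / (real K * evenweight K)) sequentially"
      using evpos by eventually_elim (simp add: weightsum_abel diff_divide_distrib)
  qed
qed

theorem theorem6:
  fixes L :: real
  assumes "(\<lambda>k::nat. ratio (2 * k)) \<longlonglongrightarrow> L"
  shows "L = 2 * C_tw"
proof -
  define T where "T = (\<lambda>K. \<Sum>k\<le>K. real (cdec (2 * k)))"
  have evpos: "eventually (\<lambda>K. evenweight K > 0) sequentially" unfolding evenweight_def by real_asymp
  hence evpos': "eventually (\<lambda>K. evenweight (Suc K) > 0) sequentially" by (rule eventually_compose_filterlim) (rule filterlim_Suc)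
  have lim: "filterlim (\<lambda>K. real K * evenweight K) at_top sequentially" unfolding evenweight_def by real_asymp
  \<comment> \<open>The only use of the hypothesis: consecutive increments of \<open>T\<close> and
    \<open>weightsum\<close> have quotient \<open>ratio (2 * Suc K)\<close>, so the pointwise limit
    passes to the averages.\<close>
  have "(\<lambda>K. T K / weightsum K) \<longlonglongrightarrow> L"
  proof (rule stolz_cesaro)
    show "eventually (\<lambda>K. weightsum K < weightsum (Suc K)) sequentially"
      using evpos' by eventually_elim (simp add: weightsum_def singular_pos)
    have "filterlim (\<lambda>K. weightsum K / (real K * evenweight K) * (real K * evenweight K)) at_top sequentially"
      using C_tw_pos by (intro filterlim_tendsto_pos_mult_at_top[OF weightsum_asymp _ lim]) simp
    moreover have "eventually (\<lambda>K. weightsum K / (real K * evenweight K) * (real K * evenweight K) = weightsum K) sequentially"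
      using evpos eventually_gt_at_top[of 0] by eventually_elim simp
    ultimately show "filterlim weightsum at_top sequentially"
      by (rule filterlim_mono_eventually[OF _ order_refl order_refl])
    show "(\<lambda>K. (T (Suc K) - T K) / (weightsum (Suc K) - weightsum K)) \<longlonglongrightarrow> L"
    proof (rule Lim_transform_eventually[OF LIMSEQ_Suc[OF assms]])
      show "eventually (\<lambda>K. ratio (2 * Suc K) = (T (Suc K) - T K) / (weightsum (Suc K) - weightsum K)) sequentially"
      proof (intro always_eventually allI)
        fix K
        have "(T (Suc K) - T K) / (weightsum (Suc K) - weightsum K) = real (cdec (2 * Suc K)) / (singular (2 * Suc K) * evenweight (Suc K))"
          by (simp add: T_def weightsum_def)
        also have "\<dots> = ratio (2 * Suc K)"
          unfolding ratio_eq evenweight_def by simp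
        finally show "ratio (2 * Suc K) = (T (Suc K) - T K) / (weightsum (Suc K) - weightsum K)" ..
      qed
    qed
  qed
  from tendsto_mult[OF this weightsum_asymp]
  have "(\<lambda>K. T K / weightsum K * (weightsum K / (real K * evenweight K))) \<longlonglongrightarrow> L * (1 / (2 * C_tw))" .
  moreover have "eventually (\<lambda>K. T K / weightsum K * (weightsum K / (real K * evenweight K)) = T K / (real K * evenweight K)) sequentially"
  proof -
    have "1 / (2 * C_tw) > 0" using C_tw_pos by simp
    from order_tendstoD(1)[OF weightsum_asymp this] show ?thesis
      by eventually_elim auto
  qed
  ultimately have "(\<lambda>K. T K / (real K * evenweight K)) \<longlonglongrightarrow> L * (1 / (2 * C_tw))"
    by (rule Lim_transform_eventually)
  moreover have "(\<lambda>K. T K / (real K * evenweight K)) \<longlonglongrightarrow> 1"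
    using sum_cdec_asymp by (simp add: T_def)
  \<comment> \<open>The summed c is compared with K * \<open>evenweight K\<close> in two ways,
    through the hypothesis and through the unconditional count.\<close>
  ultimately have "L * (1 / (2 * C_tw)) = 1" by (rule LIMSEQ_unique)
  thus ?thesis using C_tw_pos by (simp add: field_simps)
qed

end
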